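(* For an oriented link diagram $L$ with $n\ge 1$ components, let $$\Phi[R](L) = \left(\frac{z}{w}\right)^{n-1}\sum_{k=1}^n \eta^{k-1}\,\widehat{E}_k \sum_{\pi} R(\pi L),$$ where the second summation is over all partitions $\pi$ of the set of components of $L$ into $k$ (unordered, non-empty) subsets, $R(\pi L)$ denotes the product of the polynomials $R$ of the $k$ sublinks of $L$ defined by $\pi$, $\eta=\frac{a-a^{-1}}{w}$, $\widehat{E}=E\,\frac{z}{w}$, $\widehat{E}_1=1$ and $\widehat{E}_k=(\widehat{E}^{-1}-1)(\widehat{E}^{-1}-2)\cdots(\widehat{E}^{-1}-k+1)$. Consider the following two properties of a regular isotopy invariant $I$ of oriented links: (1) $I(L_+)-I(L_-)=z\,I(L_0)$ for every oriented Conway triple whose specified crossing involves two different components of the link; (2) $I(\mathcal{K}^r)=E^{1-r}R(\mathcal{K}^r)$ for every union $\mathcal{K}^r$ of $r\geq1$ unlinked knots. Then: (i) if $H[R]$ is a regular isotopy invariant of oriented links satisfying (1) and (2), then $H[R](L)=\Phi[R](L)$ for every oriented link diagram $L$; (ii) independently of that, $\Phi[R]$ is a well-defined regular isotopy invariant of oriented links and $\Phi[R]$ satisfies (1) and (2). Therefore $\Phi[R]$ is a closed formula for $H[R]$.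
   Context: $z,w,a,E$ are indeterminates; invariants take values in the ring of Laurent polynomials $\mathbb{Z}[z^{\pm1},w^{\pm1},a^{\pm1},E^{\pm1}]$. Regular isotopy is the equivalence relation on planar link diagrams generated by planar isotopy and Reidemeister moves II and III; a regular isotopy invariant is a function on diagrams constant on regular isotopy classes. An oriented Conway triple $L_+,L_-,L_0$ consists of three oriented diagrams identical except near one specified crossing, which is positive in $L_+$, switched (negative) in $L_-$, and replaced in $L_0$ by the smoothing compatible with the orientations. A union of $r$ unlinked knots $\mathcal{K}^r=\sqcup_{i=1}^r K_i$ is an $r$-component link diagram representing a split link whose $r$ split components are (possibly non-trivial) knots $K_1,\dots,K_r$. $R=R(w,a)$, the (known) regular isotopy version of the Homflypt polynomial, is the regular isotopy invariant of oriented links determined by: $R(L_+)-R(L_-)=w\,R(L_0)$ for every oriented Conway triple (any crossing); $R(\text{diagram with a positive curl})=a\,R(\text{diagram without the curl})$ and $R(\text{diagram with a negative curl})=a^{-1}R(\text{diagram without the curl})$ (a curl is a Reidemeister I kink); $R=1$ on the standard crossingless unknot diagram. It follows that $R(\mathcal{K}^r)=\eta^{r-1}\prod_{i=1}^r R(K_i)$. *)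

theory Defs
  imports Main "HOL-Library.Poly_Mapping" "HOL-Library.Product_Plus" "HOL-Library.Disjoint_Sets"
begin

section \<open>The coefficient ring\<close>

text \<open>The ring of Laurent polynomials with integer coefficients in \<open>z, w, a, E\<close> is the group ring
  of the free abelian group of exponent vectors; \<open>laurent_monom i j k l\<close> is the monomial with
  exponent \<open>i\<close> of \<open>z\<close>, \<open>j\<close> of \<open>w\<close>, \<open>k\<close> of \<open>a\<close> and \<open>l\<close> of \<open>E\<close>.\<close>

type_synonym laurent = "(int \<times> int \<times> int \<times> int) \<Rightarrow>\<^sub>0 int"

definition laurent_monom :: "int \<Rightarrow> int \<Rightarrow> int \<Rightarrow> int \<Rightarrow> laurent" where
  "laurent_monom i j k l = Poly_Mapping.single (i, j, k, l) 1"

abbreviation var_z :: laurent where "var_z \<equiv> laurent_monom 1 0 0 0"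
abbreviation var_w :: laurent where "var_w \<equiv> laurent_monom 0 1 0 0"
abbreviation var_a :: laurent where "var_a \<equiv> laurent_monom 0 0 1 0"
abbreviation inv_a :: laurent where "inv_a \<equiv> laurent_monom 0 0 (- 1) 0"
abbreviation inv_w :: laurent where "inv_w \<equiv> laurent_monom 0 (- 1) 0 0"

definition eta :: laurent where
  "eta = (var_a - inv_a) * inv_w"

text \<open>The inverse of the unit \<open>E z / w\<close>.\<close>

definition Ehat_inv :: laurent where
  "Ehat_inv = laurent_monom (- 1) 1 0 (- 1)"

definition Ehat :: "nat \<Rightarrow> laurent" where
  "Ehat k = (\<Prod>j = 1..<k. Ehat_inv - of_nat j)"

section \<open>Oriented planar diagrams\<close>

text \<open>A planar diagram in general position with respect to the height function is read from bottom
  to top. Between critical levels it is a row of vertical strands, numbered from the left starting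
  with 0 and each directed upwards (\<^const>\<open>True\<close>) or downwards (\<^const>\<open>False\<close>). At each critical
  level one event happens, at the given position:
  \<^item> \<open>Cup b\<close>: a local minimum, whose left leg has direction \<open>b\<close>;
  \<^item> \<open>Cap\<close>: a local maximum;
  \<^item> \<open>Cross u\<close>: a crossing of two adjacent strands; \<open>u\<close> tells whether the strand running from
    bottom left to top right is the upper one.\<close>

datatype event = Cup bool | Cap | Cross bool

type_synonym diagram = "(nat \<times> event) list"

fun step :: "bool list \<Rightarrow> nat \<times> event \<Rightarrow> bool list option" where
  "step s (i, Cup b) = (if i \<le> length s then Some (take i s @ [b, \<not> b] @ drop i s) else None)"
| "step s (i, Cap) =
     (if i + 1 < length s \<and> s ! i \<noteq> s ! (i + 1) then Some (take i s @ drop (i + 2) s) else None)"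
| "step s (i, Cross u) =
     (if i + 1 < length s then Some (s[i := s ! (i + 1), i + 1 := s ! i]) else None)"

fun run :: "bool list \<Rightarrow> diagram \<Rightarrow> bool list option" where
  "run s [] = Some s"
| "run s (x # xs) = (case step s x of None \<Rightarrow> None | Some t \<Rightarrow> run t xs)"

definition link_diagram :: "diagram \<Rightarrow> bool" where
  "link_diagram D \<longleftrightarrow> run [] D = Some []"

text \<open>The row of strands just below the event number \<open>l\<close>.\<close>

definition strands :: "diagram \<Rightarrow> nat \<Rightarrow> bool list" where
  "strands D l = the (run [] (take l D))"

fun ins :: "event \<Rightarrow> nat" where
  "ins (Cup b) = 0" | "ins Cap = 2" | "ins (Cross u) = 2"

fun outs :: "event \<Rightarrow> nat" where
  "outs (Cup b) = 2" | "outs Cap = 0" | "outs (Cross u) = 2"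

section \<open>Components and sublinks\<close>

text \<open>The pair \<open>(l, p)\<close> stands for the piece of the strand \<open>p\<close> in row \<open>l\<close>.\<close>

definition points :: "diagram \<Rightarrow> (nat \<times> nat) set" where
  "points D = {(l, p). l \<le> length D \<and> p < length (strands D l)}"

inductive joined :: "diagram \<Rightarrow> nat \<times> nat \<Rightarrow> nat \<times> nat \<Rightarrow> bool" for D where
  left: "\<lbrakk>l < length D; D ! l = (i, e); p < i\<rbrakk> \<Longrightarrow> joined D (l, p) (Suc l, p)"
| right: "\<lbrakk>l < length D; D ! l = (i, e); i + ins e + p < length (strands D l)\<rbrakk>
    \<Longrightarrow> joined D (l, i + ins e + p) (Suc l, i + outs e + p)"
| cup: "\<lbrakk>l < length D; D ! l = (i, Cup b)\<rbrakk> \<Longrightarrow> joined D (Suc l, i) (Suc l, i + 1)"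
| cap: "\<lbrakk>l < length D; D ! l = (i, Cap)\<rbrakk> \<Longrightarrow> joined D (l, i) (l, i + 1)"
| cross_left: "\<lbrakk>l < length D; D ! l = (i, Cross u)\<rbrakk> \<Longrightarrow> joined D (l, i) (Suc l, i + 1)"
| cross_right: "\<lbrakk>l < length D; D ! l = (i, Cross u)\<rbrakk> \<Longrightarrow> joined D (l, i + 1) (Suc l, i)"

definition same_component :: "diagram \<Rightarrow> nat \<times> nat \<Rightarrow> nat \<times> nat \<Rightarrow> bool" where
  "same_component D = equivclp (joined D)"

definition link_components :: "diagram \<Rightarrow> (nat \<times> nat) set set" where
  "link_components D = points D // {(x, y). x \<in> points D \<and> y \<in> points D \<and> same_component D x y}"

text \<open>\<open>sublink D A\<close> erases from \<open>D\<close> everything outside of \<open>A\<close>, where \<open>A\<close> is a union of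
  components. An event survives if all strands taking part in it do; the surviving strands are
  renumbered.\<close>

fun feet :: "nat \<times> nat \<times> event \<Rightarrow> (nat \<times> nat) set" where
  "feet (l, i, Cup b) = {(Suc l, i), (Suc l, i + 1)}"
| "feet (l, i, Cap) = {(l, i), (l, i + 1)}"
| "feet (l, i, Cross u) = {(l, i), (l, i + 1)}"

definition sublink :: "diagram \<Rightarrow> (nat \<times> nat) set \<Rightarrow> diagram" where
  "sublink D A =
     map (\<lambda>(l, i, e). (card {p. p < i \<and> (l, p) \<in> A}, e))
       (filter (\<lambda>x. feet x \<subseteq> A) (enumerate 0 D))"

section \<open>Planar isotopy and Reidemeister moves\<close>

text \<open>The elementary changes of the event sequence under a generic planar isotopy: two events in
  disjoint columns exchange heights; a pair of a minimum and a maximum is born or dies; a local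
  extremum of a strand passes through a crossing.\<close>

inductive planar_move :: "diagram \<Rightarrow> diagram \<Rightarrow> bool" where
  exchange: "planar_move [(i, e), (i + outs e + k, f)] [(i + ins e + k, f), (i, e)]"
| zigzag_right: "planar_move [(i + 1, Cup b), (i, Cap)] []"
| zigzag_left: "planar_move [(i, Cup b), (i + 1, Cap)] []"
| max_through: "planar_move [(i, Cross u), (i + 1, Cap)] [(i + 1, Cross (\<not> u)), (i, Cap)]"
| min_through: "planar_move [(i, Cup b), (i + 1, Cross u)] [(i + 1, Cup b), (i, Cross (\<not> u))]"

text \<open>\<open>kink u i K\<close>: \<open>K\<close> is a curl on the strand in position \<open>i\<close>, with the loop on the right or
  on the left hand side.\<close>

inductive kink :: "bool \<Rightarrow> nat \<Rightarrow> diagram \<Rightarrow> bool" where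
  loop_right: "kink u i [(i + 1, Cup b), (i, Cross u), (i + 1, Cap)]"
| loop_left: "kink u i [(i, Cup b), (i + 1, Cross u), (i, Cap)]"

inductive reidemeister1 :: "diagram \<Rightarrow> diagram \<Rightarrow> bool" where
  "kink u i K \<Longrightarrow> reidemeister1 K []"

inductive reidemeister2 :: "diagram \<Rightarrow> diagram \<Rightarrow> bool" where
  "reidemeister2 [(i, Cross u), (i, Cross (\<not> u))] []"

text \<open>The strands from the left to the right being \<open>s, t, r\<close>, the flags \<open>u, v, x\<close> say that
  \<open>s\<close> is above \<open>t\<close>, \<open>s\<close> above \<open>r\<close>, and \<open>t\<close> above \<open>r\<close>. The side condition rules out the two
  cyclic, hence impossible, configurations.\<close>

inductive reidemeister3 :: "diagram \<Rightarrow> diagram \<Rightarrow> bool" where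
  "u = v \<or> v = x \<Longrightarrow>
    reidemeister3 [(i, Cross u), (i + 1, Cross v), (i, Cross x)]
                  [(i + 1, Cross x), (i, Cross v), (i + 1, Cross u)]"

inductive local_change :: "(diagram \<Rightarrow> diagram \<Rightarrow> bool) \<Rightarrow> diagram \<Rightarrow> diagram \<Rightarrow> bool" for M where
  "\<lbrakk>M X Y; link_diagram (P @ X @ Q); link_diagram (P @ Y @ Q)\<rbrakk>
    \<Longrightarrow> local_change M (P @ X @ Q) (P @ Y @ Q)"

definition regular_isotopic :: "diagram \<Rightarrow> diagram \<Rightarrow> bool" where
  "regular_isotopic = equivclp (local_change (sup planar_move (sup reidemeister2 reidemeister3)))"

definition same_link :: "diagram \<Rightarrow> diagram \<Rightarrow> bool" where
  "same_link =
     equivclp (local_change (sup planar_move (sup reidemeister1 (sup reidemeister2 reidemeister3))))"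

definition regular_isotopy_invariant :: "(diagram \<Rightarrow> laurent) \<Rightarrow> bool" where
  "regular_isotopy_invariant I \<longleftrightarrow>
     (\<forall>D D'. link_diagram D \<and> link_diagram D' \<and> regular_isotopic D D' \<longrightarrow> I D = I D')"

section \<open>Conway triples, unlinked knots and the polynomials\<close>

text \<open>Two strands crossing in the same vertical direction cross positively iff the one running from
  bottom left to top right is above; reversing one of them changes the sign.\<close>

definition positive :: "bool list \<Rightarrow> nat \<Rightarrow> bool \<Rightarrow> bool" where
  "positive s i u \<longleftrightarrow> (u \<longleftrightarrow> s ! i = s ! (i + 1))"

text \<open>Just above a crossing at position \<open>i\<close> of the row \<open>s\<close>, the strand in position \<open>i\<close> has the
  direction \<open>s ! (i + 1)\<close>.\<close>

definition smoothing :: "bool list \<Rightarrow> nat \<Rightarrow> diagram" where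
  "smoothing s i = (if s ! i = s ! (i + 1) then [] else [(i, Cap), (i, Cup (s ! (i + 1)))])"

text \<open>The last two arguments are points of the positive diagram on the two strands that meet in the
  specified crossing.\<close>

inductive conway_triple ::
  "diagram \<Rightarrow> diagram \<Rightarrow> diagram \<Rightarrow> nat \<times> nat \<Rightarrow> nat \<times> nat \<Rightarrow> bool" where
  "\<lbrakk>link_diagram (P @ [(i, Cross u)] @ Q); run [] P = Some s; positive s i u\<rbrakk>
    \<Longrightarrow> conway_triple (P @ [(i, Cross u)] @ Q) (P @ [(i, Cross (\<not> u))] @ Q)
          (P @ smoothing s i @ Q) (length P, i) (length P, i + 1)"

definition knot_diagram :: "diagram \<Rightarrow> bool" where
  "knot_diagram K \<longleftrightarrow> link_diagram K \<and> card (link_components K) = 1"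

text \<open>Concatenation puts diagrams above each other, separated by horizontal lines.\<close>

definition unlinked_knots :: "nat \<Rightarrow> diagram \<Rightarrow> bool" where
  "unlinked_knots r D \<longleftrightarrow> link_diagram D \<and>
     (\<exists>Ks. length Ks = r \<and> (\<forall>K \<in> set Ks. knot_diagram K) \<and> same_link D (concat Ks))"

text \<open>In a curl the two strands are parallel at the crossing, hence its sign is given by the
  flag \<open>u\<close> of \<^const>\<open>kink\<close>.\<close>

definition regular_homflypt :: "(diagram \<Rightarrow> laurent) \<Rightarrow> bool" where
  "regular_homflypt R \<longleftrightarrow>
     regular_isotopy_invariant R \<and>
     (\<forall>Lp Lm L0 x y. conway_triple Lp Lm L0 x y \<longrightarrow> R Lp - R Lm = var_w * R L0) \<and>
     (\<forall>P Q K i u. kink u i K \<and> link_diagram (P @ K @ Q) \<longrightarrow>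
        R (P @ K @ Q) = (if u then var_a else inv_a) * R (P @ Q)) \<and>
     (\<forall>b. R [(0, Cup b), (0, Cap)] = 1)"

definition mixed_skein :: "(diagram \<Rightarrow> laurent) \<Rightarrow> bool" where
  "mixed_skein I \<longleftrightarrow>
     (\<forall>Lp Lm L0 x y. conway_triple Lp Lm L0 x y \<and> \<not> same_component Lp x y \<longrightarrow>
        I Lp - I Lm = var_z * I L0)"

definition unlinked_values :: "(diagram \<Rightarrow> laurent) \<Rightarrow> (diagram \<Rightarrow> laurent) \<Rightarrow> bool" where
  "unlinked_values R I \<longleftrightarrow>
     (\<forall>r D. r \<ge> 1 \<and> unlinked_knots r D \<longrightarrow> I D = laurent_monom 0 0 0 (1 - int r) * R D)"

definition Phi :: "(diagram \<Rightarrow> laurent) \<Rightarrow> diagram \<Rightarrow> laurent" where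
  "Phi R D = (let n = card (link_components D) in
     laurent_monom 1 (- 1) 0 0 ^ (n - 1) *
     (\<Sum>k = 1..n. eta ^ (k - 1) * Ehat k *
        (\<Sum>\<pi> | partition_on (link_components D) \<pi> \<and> card \<pi> = k. \<Prod>S\<in>\<pi>. R (sublink D (\<Union> S)))))"

end

theory Submission
  imports Defs
begin

text \<open>Label the strands of a diagram by components. Then \<open>Phi R\<close> becomes a sum over the
  partitions of the set of labels, and labels are carried along by the Reidemeister moves, so that
  invariance can be checked one summand at a time. At a crossing of two components, the partitions
  that separate them contribute equally to both diagrams of a Conway triple; those that unite them
  correspond to the partitions of the components of the smoothed diagram, and the skein relation of
  \<open>R\<close> applies to each of them. On unlinked knots \<open>R\<close> is multiplicative up to powers of \<open>eta\<close>, and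
  the sum collapses to the sum of \<open>Ehat (card \<pi>)\<close> over all partitions \<open>\<pi>\<close> of an \<open>r\<close>-element set,
  which is \<open>Ehat_inv ^ (r - 1)\<close>.

  For uniqueness, order the components. Switching the crossings at which the lower component passes
  over the higher one changes any solution by the values on diagrams with fewer crossings. In the
  absence of such crossings the layers can be pulled apart by a regular isotopy, and the diagram
  becomes a stack of knot diagrams, where the solution is prescribed.\<close>

section \<open>Isotopies of event sequences\<close>

text \<open>The obstacle is that components are classes of points \<open>(l, p)\<close>, and every
  move renumbers the points. A colouring stores labels row by row and is cut and glued together with
  the event list. That its colours are exactly the components is the property
  \<open>universal\<close>; it survives a move because a colouring of the move is fixed by its
  boundary, and it survives the smoothing of a mixed crossing by a parity count.

  \<open>regular_homflypt\<close> does not contain the value of \<open>R\<close> on split unions, so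
  \<open>R (K @ D) = eta * R K * R D\<close> has to be derived. Every event list is reduced, by the
  relations that define \<open>R\<close>, to lists without maxima; both sides of the formula obey
  these relations in \<open>D\<close>.

  The constants \<open>Ehat k\<close> are forced by set partitions: \<open>Ehat_inv * Ehat k\<close>
  is the k-th falling factorial of \<open>Ehat_inv\<close>, and falling factorials weighted by
  Stirling numbers of the second kind add up to a power.

  The first Reidemeister move changes \<open>R\<close>, but it scales \<open>R\<close> by a unit on
  each sublink that contains the curl. What is transported along \<open>same_link\<close> is
  therefore not a value of \<open>R\<close> but the split formula for all sublinks.\<close>

lemma run_append: "run s (X @ Y) = (case run s X of None \<Rightarrow> None | Some t \<Rightarrow> run t Y)"
  by (induction X arbitrary: s) (auto split: option.splits)

lemma run_append_Some: "run s (X @ Y) = Some t \<longleftrightarrow> (\<exists>r. run s X = Some r \<and> run r Y = Some t)"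
  by (auto simp: run_append split: option.splits)

lemma run_Cons_Some: "run s (x # Y) = Some t \<longleftrightarrow> (\<exists>r. step s x = Some r \<and> run r Y = Some t)"
  by (auto split: option.splits)

inductive local_step :: "event \<Rightarrow> bool list \<Rightarrow> bool list \<Rightarrow> bool" where
  "local_step (Cup b) [] [b, \<not> b]"
| "p \<noteq> q \<Longrightarrow> local_step Cap [p, q] []"
| "local_step (Cross u) [p, q] [q, p]"

lemma local_step_simps [simp]:
  "local_step (Cup b) x y \<longleftrightarrow> x = [] \<and> y = [b, \<not> b]"
  "local_step Cap x y \<longleftrightarrow> (\<exists>p. x = [p, \<not> p] \<and> y = [])"
  "local_step (Cross u) x y \<longleftrightarrow> (\<exists>p q. x = [p, q] \<and> y = [q, p])"
  by (auto simp: local_step.simps)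

lemma local_step_length: "local_step e x y \<Longrightarrow> length x = ins e \<and> length y = outs e"
  by (cases e) auto

lemma step_append:
  assumes "local_step e y y'"
  shows "step (x @ y @ z) (length x, e) = Some (x @ y' @ z)"
  using assms by cases (simp_all add: nth_append list_update_append)

lemma step_SomeE:
  assumes "step s (i, e) = Some t"
  obtains x y y' z where "s = x @ y @ z" "t = x @ y' @ z" "length x = i" "local_step e y y'"
proof -
  define x where "x = take i s"
  have x: "length x = i" "i + ins e \<le> length s"
    using assms by (cases e; auto simp: x_def split: if_splits)+
  define y where "y = take (ins e) (drop i s)"
  define z where "z = drop (i + ins e) s"
  have s: "s = x @ y @ z"
    by (metis append_take_drop_id drop_drop add.commute x_def y_def z_def)
  have y: "length y = ins e" using x by (simp add: y_def)
  have "\<exists>y'. local_step e y y'"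
  proof (cases e)
    case Cap
    then obtain p q where "y = [p, q]" using y by (auto simp: length_Suc_conv numeral_2_eq_2)
    with assms s x(1) Cap show ?thesis by (auto simp: nth_append split: if_splits)
  next
    case (Cross u)
    then obtain p q where "y = [p, q]" using y by (auto simp: length_Suc_conv numeral_2_eq_2)
    with Cross show ?thesis by simp
  qed (use y in simp)
  then obtain y' where y': "local_step e y y'" ..
  from step_append[OF this, of x z] have "t = x @ y' @ z"
    using assms s x(1) by (simp del: step.simps)
  with that s x(1) y' show thesis by blast
qed

lemma step_zero [simp]:
  "step s (0, Cup b) = Some (b # (\<not> b) # s)"
  "step (p # q # s) (0, Cap) = (if p = q then None else Some s)"
  "step (p # q # s) (0, Cross u) = Some (q # p # s)"
  "step [p] (0, Cap) = None" "step [p] (0, Cross u) = None"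
  "step [] (0, Cap) = None" "step [] (0, Cross u) = None"
  by auto

lemma step_Cons [simp]: "step (p # s) (Suc j, e) = map_option ((#) p) (step s (j, e))"
  by (cases e) auto

lemma step_append_add: "step (x @ s) (length x + j, e) = map_option ((@) x) (step s (j, e))"
  by (induction x) (simp_all del: step.simps add: option.map_comp o_def option.map_ident)

lemma step_append_shift [simp]:
  "step (x @ s) (length x, e) = map_option ((@) x) (step s (0, e))"
  "step (x @ s) (Suc (length x), e) = map_option ((@) x) (step s (Suc 0, e))"
  "step (x @ s) (Suc (Suc (length x)), e) = map_option ((@) x) (step s (Suc (Suc 0), e))"
  using step_append_add[of x s 0] step_append_add[of x s 1] step_append_add[of x s 2]
  by (simp_all del: step.simps add: numeral_2_eq_2)

lemma step_end [simp]:
  "step s (length s, Cup b) = Some (s @ [b, \<not> b])"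
  "step s (length s, Cap) = None" "step s (length s, Cross u) = None"
  by simp_all

lemma step_beyond [simp]: "length s < i \<Longrightarrow> step s (i, e) = None"
  by (cases e) auto

lemma step_Nil_Suc [simp]: "step [] (Suc j, e) = None"
  by simp

text \<open>Apart from the exchange of distant events, no move involves more than three adjacent
  strands. Splitting a row at position \<open>i\<close> into these five shapes lets the simplifier
  run both sides of a move symbolically, by the rules for \<open>step\<close> on appended rows
  above.\<close>

lemma at_cases [case_names beyond Nil one two more]:
  fixes s :: "'a list"
  assumes "length s < i \<Longrightarrow> thesis"
    "\<And>x. s = x @ [] \<Longrightarrow> i = length x \<Longrightarrow> thesis"
    "\<And>x p. s = x @ [p] \<Longrightarrow> i = length x \<Longrightarrow> thesis"
    "\<And>x p q. s = x @ [p, q] \<Longrightarrow> i = length x \<Longrightarrow> thesis"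
    "\<And>x p q v r. s = x @ p # q # v # r \<Longrightarrow> i = length x \<Longrightarrow> thesis"
  shows thesis
proof (cases "length s < i")
  case False
  then obtain x r where "s = x @ r" "i = length x"
    by (metis append_take_drop_id length_take linorder_not_le min.absorb2)
  then show ?thesis
  proof (cases r)
    case (Cons p r1)
    then show ?thesis
    proof (cases r1)
      case (Cons q r2)
      with \<open>r = p # r1\<close> \<open>s = x @ r\<close> \<open>i = length x\<close> show ?thesis
        using assms(4,5) by (cases r2) simp_all
    qed (use assms(3) \<open>s = x @ r\<close> \<open>i = length x\<close> in simp)
  qed (use assms(2) in simp)
qed (rule assms(1))

declare step.simps [simp del] run.simps(2) [simp del]

lemma run_Cons [simp]: "run s (x # xs) = Option.bind (step s x) (\<lambda>t. run t xs)"
  by (cases "step s x") (simp_all add: run.simps(2))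

lemma step_lengths:
  "step s (i, e) = Some t \<Longrightarrow> i + ins e \<le> length s \<and> length t + ins e = length s + outs e"
  by (auto elim!: step_SomeE dest!: local_step_length)

abbreviation iso_move :: "diagram \<Rightarrow> diagram \<Rightarrow> bool" where
  "iso_move \<equiv> sup planar_move (sup reidemeister2 reidemeister3)"

text \<open>Isotopies of tangles with fixed boundary rows \<open>s\<close> and \<open>t\<close>; all the intermediate event
  sequences are required to be valid.\<close>

inductive iso_step :: "bool list \<Rightarrow> bool list \<Rightarrow> diagram \<Rightarrow> diagram \<Rightarrow> bool" for s t where
  "\<lbrakk>iso_move M N; run s (P @ M @ Q) = Some t; run s (P @ N @ Q) = Some t\<rbrakk>
    \<Longrightarrow> iso_step s t (P @ M @ Q) (P @ N @ Q)"

definition iso :: "bool list \<Rightarrow> bool list \<Rightarrow> diagram \<Rightarrow> diagram \<Rightarrow> bool" where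
  "iso s t = equivclp (iso_step s t)"

lemma iso_refl [simp]: "iso s t X X"
  by (simp add: iso_def)

lemma iso_sym: "iso s t X Y \<Longrightarrow> iso s t Y X"
  by (metis iso_def equivclp_sym)

lemma iso_trans [trans]: "iso s t X Y \<Longrightarrow> iso s t Y Z \<Longrightarrow> iso s t X Z"
  by (metis iso_def equivclp_trans)

lemma iso_step_context:
  assumes "iso_step s' t' M N" "run s P = Some s'" "run t' Q = Some t"
  shows "iso_step s t (P @ M @ Q) (P @ N @ Q)"
  using assms(1)
proof cases
  case (1 M' N' P' Q')
  have "run s ((P @ P') @ M' @ (Q' @ Q)) = Some t" "run s ((P @ P') @ N' @ (Q' @ Q)) = Some t"
    using 1(4,5) assms(2,3) by (auto simp: run_append_Some)
  from iso_step.intros[OF 1(3) this] show ?thesis by (simp add: 1(1,2))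
qed

lemma iso_context:
  assumes "iso s' t' M N" "run s P = Some s'" "run t' Q = Some t"
  shows "iso s t (P @ M @ Q) (P @ N @ Q)"
  using assms(1) unfolding iso_def
proof (induction rule: equivclp_induct)
  case base then show ?case by simp
next
  case (step y z)
  then have "iso_step s t (P @ y @ Q) (P @ z @ Q) \<or> iso_step s t (P @ z @ Q) (P @ y @ Q)"
    using assms(2,3) iso_step_context by blast
  with step(3) show ?case by (meson equivclp_into_equivclp)
qed

text \<open>The alternative \<open>X = Y\<close> cannot be dropped: the equivalence closure is
  reflexive even on event lists that are not valid from \<open>s\<close> to
  \<open>t\<close>.\<close>

lemma iso_run: "iso s t X Y \<Longrightarrow> X = Y \<or> run s X = Some t \<and> run s Y = Some t"
  unfolding iso_def by (induction rule: equivclp_induct) (auto elim!: iso_step.cases)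

text \<open>The boundary rows are quantified away, so that local moves can be composed like rewrite
  steps. Only validity of \<open>X\<close> is assumed, which makes the relation asymmetric: a zigzag
  deforms into \<open>[]\<close>, but \<open>[]\<close> is valid on rows whose directions do not
  admit the zigzag.\<close>

definition deforms :: "diagram \<Rightarrow> diagram \<Rightarrow> bool" (infix "\<leadsto>" 50) where
  "X \<leadsto> Y \<longleftrightarrow> (\<forall>s t. run s X = Some t \<longrightarrow> iso s t X Y)"

lemma deforms_refl [simp]: "X \<leadsto> X"
  by (simp add: deforms_def)

lemma deforms_trans [trans]: "X \<leadsto> Y \<Longrightarrow> Y \<leadsto> Z \<Longrightarrow> X \<leadsto> Z"
  unfolding deforms_def by (metis iso_run iso_trans)

lemma deforms_context: 
  assumes "X \<leadsto> Y"
  shows "P @ X @ Q \<leadsto> P @ Y @ Q"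
  unfolding deforms_def
proof (intro allI impI)
  fix s t assume "run s (P @ X @ Q) = Some t"
  then obtain r r' where "run s P = Some r" "run r X = Some r'" "run r' Q = Some t"
    by (auto simp: run_append_Some)
  then show "iso s t (P @ X @ Q) (P @ Y @ Q)"
    using assms by (intro iso_context) (simp_all add: deforms_def)
qed

lemma deforms_run: "X \<leadsto> Y \<Longrightarrow> run s X = Some t \<Longrightarrow> run s Y = Some t"
  unfolding deforms_def using iso_run[of s t X Y] by auto

lemma deforms_move:
  assumes "iso_move X Y" "\<And>s t. run s X = Some t \<Longrightarrow> run s Y = Some t"
  shows "X \<leadsto> Y"
  unfolding deforms_def iso_def using iso_step.intros[OF assms(1), of _ "[]" "[]"] assms(2) by auto

lemma deforms_move_sym:
  assumes "iso_move Y X" "\<And>s t. run s X = Some t \<Longrightarrow> run s Y = Some t"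
  shows "X \<leadsto> Y"
  unfolding deforms_def 
proof (intro allI impI)
  fix s t assume "run s X = Some t"
  then have "iso_step s t Y X"
    using iso_step.intros[OF assms(1), of s "[]" "[]" t] assms(2) by auto
  then have "iso s t Y X" unfolding iso_def by (simp add: r_into_equivclp)
  then show "iso s t X Y" by (rule iso_sym)
qed

lemma append_eq_split:
  assumes "a @ b = c @ d" "length a \<le> length c"
  obtains v where "c = a @ v" "b = v @ d" "length v = length c - length a"
  using assms by (auto simp: append_eq_append_conv2)

lemma run_exchange:
  "run s [(i, e), (i + outs e + k, f)] = Some t \<longleftrightarrow> run s [(i + ins e + k, f), (i, e)] = Some t"
  (is "?L \<longleftrightarrow> ?R")
proof
  assume ?L
  then obtain s1 where s1: "step s (i, e) = Some s1" "step s1 (i + outs e + k, f) = Some t"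
    by (auto simp: bind_eq_Some_conv)
  obtain x y y' z where 1: "s = x @ y @ z" "s1 = x @ y' @ z" "length x = i" "local_step e y y'"
    by (rule step_SomeE[OF s1(1)])
  obtain x2 w w' z2 where 2: "s1 = x2 @ w @ z2" "t = x2 @ w' @ z2" "length x2 = i + outs e + k" "local_step f w w'"
    by (rule step_SomeE[OF s1(2)])
  have a: "s = x @ y @ z" "x @ y' @ z = x2 @ w @ z2" "t = x2 @ w' @ z2"
    "length x = i" "length x2 = i + outs e + k" "local_step e y y'" "local_step f w w'"
    using 1 2 by simp_all
  have l: "length y = ins e" "length y' = outs e" using local_step_length a(6) by auto
  have "(x @ y') @ z = x2 @ (w @ z2)" "length (x @ y') \<le> length x2"
    using a(2,4,5) l by simp_all
  then obtain v where v: "x2 = (x @ y') @ v" "z = v @ w @ z2" "length v = length x2 - length (x @ y')"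
    by (rule append_eq_split)
  then have x2: "x2 = x @ y' @ v" and z: "z = v @ w @ z2" and v: "length v = k"
    using a(4,5) l by simp_all
  have 1: "step s (i + ins e + k, f) = Some (x @ y @ v @ w' @ z2)"
    using step_append[OF a(7), of "x @ y @ v" z2] a l v z by (simp add: add.assoc)
  have 2: "step (x @ y @ v @ w' @ z2) (i, e) = Some t"
    using step_append[OF a(6), of x "v @ w' @ z2"] a x2 by simp
  show ?R using 1 2 by simp
next
  assume ?R
  then obtain s1 where s1: "step s (i + ins e + k, f) = Some s1" "step s1 (i, e) = Some t"
    by (auto simp: bind_eq_Some_conv)
  obtain x2 w w' z2 where 1: "s = x2 @ w @ z2" "s1 = x2 @ w' @ z2" "length x2 = i + ins e + k" "local_step f w w'"
    by (rule step_SomeE[OF s1(1)])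
  obtain x y y' z where 2: "s1 = x @ y @ z" "t = x @ y' @ z" "length x = i" "local_step e y y'"
    by (rule step_SomeE[OF s1(2)])
  have a: "s = x2 @ w @ z2" "x2 @ w' @ z2 = x @ y @ z" "t = x @ y' @ z"
    "length x = i" "length x2 = i + ins e + k" "local_step e y y'" "local_step f w w'"
    using 1 2 by simp_all
  have l: "length y = ins e" "length y' = outs e" using local_step_length a(6) by auto
  have "(x @ y) @ z = x2 @ (w' @ z2)" "length (x @ y) \<le> length x2"
    using a(2,4,5) l by simp_all
  then obtain v where v: "x2 = (x @ y) @ v" "z = v @ w' @ z2" "length v = length x2 - length (x @ y)"
    by (rule append_eq_split)
  then have x2: "x2 = x @ y @ v" and z: "z = v @ w' @ z2" and v: "length v = k"
    using a(4,5) l by simp_all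
  have 1: "step s (i, e) = Some (x @ y' @ v @ w @ z2)"
    using step_append[OF a(6), of x "v @ w @ z2"] a x2 by simp
  have 2: "step (x @ y' @ v @ w @ z2) (i + outs e + k, f) = Some t"
    using step_append[OF a(7), of "x @ y' @ v" z2] a l v z by (simp add: add.assoc)
  show ?L using 1 2 by simp
qed

lemma exchange_up: "[(i, e), (i + outs e + k, f)] \<leadsto> [(i + ins e + k, f), (i, e)]"
proof (rule deforms_move)
  show "iso_move [(i, e), (i + outs e + k, f)] [(i + ins e + k, f), (i, e)]"
    using planar_move.exchange by (simp del: append_Cons)
qed (rule iffD1[OF run_exchange])

lemma exchange_down: "[(i + ins e + k, f), (i, e)] \<leadsto> [(i, e), (i + outs e + k, f)]"
proof (rule deforms_move_sym)
  show "iso_move [(i, e), (i + outs e + k, f)] [(i + ins e + k, f), (i, e)]"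
    using planar_move.exchange by (simp del: append_Cons)
qed (rule iffD2[OF run_exchange])

lemma nth_event_up:
  "j = i + outs e + k \<Longrightarrow> j' = i + ins e + k \<Longrightarrow> [(i, e), (j, f)] \<leadsto> [(j', f), (i, e)]"
  using exchange_up by simp

lemma nth_event_down:
  "j = i + outs e + k \<Longrightarrow> j' = i + ins e + k \<Longrightarrow> [(j', f), (i, e)] \<leadsto> [(i, e), (j, f)]"
  using exchange_down by simp

lemma zigzag_right: "[(Suc i, Cup b), (i, Cap)] \<leadsto> []"
proof (rule deforms_move)
  show "iso_move [(Suc i, Cup b), (i, Cap)] []" using planar_move.zigzag_right[of i b] by simp
  show "run s [] = Some t" if "run s [(Suc i, Cup b), (i, Cap)] = Some t" for s t
    using that by (cases s i rule: at_cases) (auto split: if_splits)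
qed

lemma zigzag_left: "[(i, Cup b), (Suc i, Cap)] \<leadsto> []"
proof (rule deforms_move)
  show "iso_move [(i, Cup b), (Suc i, Cap)] []" using planar_move.zigzag_left[of i b] by simp
  show "run s [] = Some t" if "run s [(i, Cup b), (Suc i, Cap)] = Some t" for s t
    using that by (cases s i rule: at_cases) (auto split: if_splits)
qed

text \<open>\<open>run\<close> sees only directions, never which strand is on top; hence the flags
  on the two sides are independent variables.\<close>

lemma cap_slide_run: 
  "run s [(i, Cross u), (Suc i, Cap)] = run s [(Suc i, Cross v), (i, Cap)]"
  by (cases s i rule: at_cases) (auto split: if_splits)

lemma cup_slide_run:
  "run s [(i, Cup b), (Suc i, Cross u)] = Some t \<longleftrightarrow> run s [(Suc i, Cup b), (i, Cross v)] = Some t"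
  by (cases s i rule: at_cases) (auto split: if_splits)

lemma cap_slide: "[(i, Cross u), (Suc i, Cap)] \<leadsto> [(Suc i, Cross (\<not> u)), (i, Cap)]"
  by (rule deforms_move) (use planar_move.max_through[of i u] in simp, simp only: cap_slide_run[where v = "\<not> u"])

lemma cap_slide_back: "[(Suc i, Cross u), (i, Cap)] \<leadsto> [(i, Cross (\<not> u)), (Suc i, Cap)]"
  by (rule deforms_move_sym) (use planar_move.max_through[of i "\<not> u"] in simp, simp only: cap_slide_run[where v = u])

lemma cup_slide: "[(i, Cup b), (Suc i, Cross u)] \<leadsto> [(Suc i, Cup b), (i, Cross (\<not> u))]"
  by (rule deforms_move) (use planar_move.min_through[of i b u] in simp, simp only: cup_slide_run[where v = "\<not> u"])

lemma cup_slide_back: "[(Suc i, Cup b), (i, Cross u)] \<leadsto> [(i, Cup b), (Suc i, Cross (\<not> u))]"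
  by (rule deforms_move_sym) (use planar_move.min_through[of i b "\<not> u"] in simp, simp only: cup_slide_run[where v = u])

lemma cross_cancel: "v = (\<not> u) \<Longrightarrow> [(i, Cross u), (i, Cross v)] \<leadsto> []"
proof (rule deforms_move)
  show "iso_move [(i, Cross u), (i, Cross v)] []" if "v = (\<not> u)"
    using reidemeister2.intros[of i u] that by simp
  show "run s [] = Some t" if "run s [(i, Cross u), (i, Cross v)] = Some t" for s t
    using that by (cases s i rule: at_cases) (auto split: if_splits)
qed

lemma braid_run: "run s [(i, Cross u), (Suc i, Cross v), (i, Cross x)] =
  run s [(Suc i, Cross x'), (i, Cross v'), (Suc i, Cross u')]"
  by (cases s i rule: at_cases) (auto split: if_splits)

lemma braid:
  assumes "u = v \<or> v = x"
  shows "[(i, Cross u), (Suc i, Cross v), (i, Cross x)] \<leadsto> [(Suc i, Cross x), (i, Cross v), (Suc i, Cross u)]"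
  by (rule deforms_move) (use reidemeister3.intros[OF assms, of i] in simp, simp only: braid_run[where u' = u and v' = v and x' = x])

lemma braid_back:
  assumes "u = v \<or> v = x"
  shows "[(Suc i, Cross x), (i, Cross v), (Suc i, Cross u)] \<leadsto> [(i, Cross u), (Suc i, Cross v), (i, Cross x)]"
  by (rule deforms_move_sym) (use reidemeister3.intros[OF assms, of i] in simp, simp only: braid_run[where u' = u and v' = v and x' = x])

text \<open>The strand in position \<open>j\<close> passes over its \<open>k\<close> neighbours on the right.\<close>

primrec over :: "nat \<Rightarrow> nat \<Rightarrow> diagram" where
  "over j 0 = []"
| "over j (Suc k) = (j, Cross True) # over (Suc j) k"

lemma over_add: "over j (k + l) = over j k @ over (j + k) l"
  by (induction k arbitrary: j) simp_all

lemma over_snoc: "over j (Suc k) = over j k @ [(j + k, Cross True)]"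
  using over_add[of j k 1] by simp

lemma deforms_Cons: "X \<leadsto> Y \<Longrightarrow> e # X \<leadsto> e # Y"
  using deforms_context[of X Y "[e]" "[]"] by simp

lemma deforms_prefix: "X \<leadsto> Y \<Longrightarrow> P @ X \<leadsto> P @ Y"
  using deforms_context[of X Y P "[]"] by simp

lemma deforms_suffix: "X \<leadsto> Y \<Longrightarrow> X @ Q \<leadsto> Y @ Q"
  using deforms_context[of X Y "[]" Q] by simp

lemma deforms_at: "X \<leadsto> Y \<Longrightarrow> A = P @ X @ Q \<Longrightarrow> B = P @ Y @ Q \<Longrightarrow> A \<leadsto> B"
  using deforms_context by simp

section \<open>Moving an event below a strand that sweeps over its neighbours\<close>

lemma far_left:
  assumes "i + ins e \<le> j"
  shows "over j k @ [(i, e)] \<leadsto> (i, e) # over (j - ins e + outs e) k"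
  using assms
proof (induction k arbitrary: j)
  case (Suc k)
  have "over j (Suc k) @ [(i, e)] \<leadsto> (j, Cross True) # (i, e) # over (Suc j - ins e + outs e) k"
    using deforms_Cons[OF Suc.IH[of "Suc j"]] Suc.prems by simp
  also have "\<dots> \<leadsto> (i, e) # over (j - ins e + outs e) (Suc k)"
  proof -
    have "[(j, Cross True), (i, e)] \<leadsto> [(i, e), (j - ins e + outs e, Cross True)]"
      using Suc.prems by (intro nth_event_down[where k = "j - ins e - i"]) simp_all
    from deforms_suffix[OF this] Suc.prems show ?thesis by (simp add: Suc_diff_le)
  qed
  finally show ?case .
qed simp

lemma far_right:
  assumes "j + k < i \<or> k = 0"
  shows "over j k @ [(i, e)] \<leadsto> (i, e) # over j k"
  using assms
proof (induction k arbitrary: j)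
  case (Suc k)
  have "over j (Suc k) @ [(i, e)] \<leadsto> (j, Cross True) # (i, e) # over (Suc j) k"
    using deforms_Cons Suc by simp
  also have "\<dots> \<leadsto> (i, e) # over j (Suc k)"
  proof -
    have "[(j, Cross True), (i, e)] \<leadsto> [(i, e), (j, Cross True)]"
      using Suc.prems by (intro nth_event_up[where k = "i - j - 2"]) simp_all
    from deforms_suffix[OF this] show ?thesis by simp
  qed
  finally show ?case .
qed simp

lemma far_right_back:
  assumes "j + k < i \<or> k = 0"
  shows "(i, e) # over j k \<leadsto> over j k @ [(i, e)]"
  using assms
proof (induction k arbitrary: j)
  case (Suc k)
  have "(i, e) # over j (Suc k) \<leadsto> (j, Cross True) # (i, e) # over (Suc j) k"
  proof -
    have "[(i, e), (j, Cross True)] \<leadsto> [(j, Cross True), (i, e)]"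
      using Suc.prems by (intro nth_event_down[where k = "i - j - 2"]) simp_all
    from deforms_suffix[OF this] show ?thesis by simp
  qed
  also have "\<dots> \<leadsto> over j (Suc k) @ [(i, e)]"
    using deforms_Cons Suc by simp
  finally show ?case .
qed simp

text \<open>The sweeping strand lies above both strands of the crossing, so the side condition of
  the third Reidemeister move holds whatever \<open>u\<close> is.\<close>

lemma sweep_cross:
  assumes "i + 2 \<le> k"
  shows "over j k @ [(j + i, Cross u)] \<leadsto> (Suc (j + i), Cross u) # over j k"
proof -
  obtain l where k: "k = i + Suc (Suc l)" using le_Suc_ex[OF assms] by auto
  let ?a = "j + i"
  have o: "over j k = over j i @ [(?a, Cross True), (Suc ?a, Cross True)] @ over (Suc (Suc ?a)) l"
    by (simp only: k over_add over.simps append.simps)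
  have "over j k @ [(?a, Cross u)] \<leadsto>
    over j i @ [(?a, Cross True), (Suc ?a, Cross True)] @ (?a, Cross u) # over (Suc (Suc ?a)) l"
    using deforms_prefix[OF far_left[of ?a "Cross u" "Suc (Suc ?a)" l], 
        of "over j i @ [(?a, Cross True), (Suc ?a, Cross True)]"]
    by (simp add: o)
  also have "\<dots> \<leadsto> over j i @ [(Suc ?a, Cross u), (?a, Cross True), (Suc ?a, Cross True)] @ over (Suc (Suc ?a)) l"
    using deforms_context[OF braid[of True True u ?a], of "over j i" "over (Suc (Suc ?a)) l"] by simp
  also have "\<dots> \<leadsto> (Suc ?a, Cross u) # over j k"
    using deforms_suffix[OF far_right[of j i "Suc ?a" "Cross u"],
        of "[(?a, Cross True), (Suc ?a, Cross True)] @ over (Suc (Suc ?a)) l"]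
    by (simp add: o)
  finally show ?thesis .
qed

text \<open>The maximum slides through the second of the two crossings with the sweeping strand; the
  two crossings then face each other and cancel by the second Reidemeister move.\<close>

lemma sweep_cap:
  "over j (i + Suc (Suc l)) @ [(j + i, Cap)] \<leadsto> (Suc (j + i), Cap) # over j (i + l)"
proof -
  let ?a = "j + i"
  have o: "over j (i + Suc (Suc l)) = over j i @ [(?a, Cross True), (Suc ?a, Cross True)] @ over (Suc (Suc ?a)) l"
    by (simp only: over_add over.simps append.simps)
  have "over j (i + Suc (Suc l)) @ [(?a, Cap)] \<leadsto>
    over j i @ [(?a, Cross True), (Suc ?a, Cross True)] @ (?a, Cap) # over ?a l"
    using deforms_prefix[OF far_left[of ?a Cap "Suc (Suc ?a)" l], 
        of "over j i @ [(?a, Cross True), (Suc ?a, Cross True)]"]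
    unfolding o by simp
  also have "\<dots> \<leadsto> over j i @ [(?a, Cross True), (?a, Cross False), (Suc ?a, Cap)] @ over ?a l"
    using deforms_context[OF cap_slide_back[of ?a True], of "over j i @ [(?a, Cross True)]" "over ?a l"] by simp
  also have "\<dots> \<leadsto> over j i @ [(Suc ?a, Cap)] @ over ?a l"
    using deforms_context[OF cross_cancel[of False True ?a], of "over j i" "(Suc ?a, Cap) # over ?a l"] by simp
  also have "\<dots> \<leadsto> (Suc ?a, Cap) # over j (i + l)"
    using deforms_suffix[OF far_right[of j i "Suc ?a" Cap], of "over ?a l"]
    by (simp add: over_add)
  finally show ?thesis .
qed

lemma deforms_reverse:
  assumes "Y \<leadsto> X" "\<And>s t. run s X = Some t \<Longrightarrow> run s Y = Some t"
  shows "X \<leadsto> Y"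
  unfolding deforms_def
proof (intro allI impI)
  fix s t assume "run s X = Some t"
  then have "iso s t Y X" using assms by (simp add: deforms_def)
  then show "iso s t X Y" by (rule iso_sym)
qed

lemma cup_curl_run: "run s [(i, Cup b), (i, Cross u)] = Some t \<Longrightarrow>
  run s [(i, Cup (\<not> b)), (Suc (Suc i), Cup b), (Suc i, Cross v), (Suc (Suc i), Cap)] = Some t"
  by (cases s i rule: at_cases) (auto split: if_splits)

text \<open>A minimum whose legs cross is not literally a \<open>kink\<close>. Turning the minimum
  over, with its direction and the flag reversed, exposes a kink on its right leg. The proof runs
  from right to left, because in this direction each step removes events and validity is
  inherited.\<close>

lemma cup_curl:
  "[(i, Cup b), (i, Cross u)] \<leadsto>
   [(i, Cup (\<not> b)), (Suc (Suc i), Cup b), (Suc i, Cross (\<not> u)), (Suc (Suc i), Cap)]"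
proof (rule deforms_reverse)
  let ?c = "\<not> b"
  have "[(i, Cup ?c), (Suc (Suc i), Cup b), (Suc i, Cross (\<not> u)), (Suc (Suc i), Cap)] \<leadsto>
    [(i, Cup b), (i, Cup ?c), (Suc i, Cross (\<not> u)), (Suc (Suc i), Cap)]"
    by (rule deforms_at[OF nth_event_up[of "Suc (Suc i)" i "Cup ?c" 0 i "Cup b"], where P = "[]" and Q = "[(Suc i, Cross (\<not> u)), (Suc (Suc i), Cap)]"]) simp_all
  also have "\<dots> \<leadsto> [(i, Cup b), (Suc i, Cup ?c), (i, Cross u), (Suc (Suc i), Cap)]"
    by (rule deforms_at[OF cup_slide[of i ?c "\<not> u"], where P = "[(i, Cup b)]" and Q = "[(Suc (Suc i), Cap)]"]) simp_all
  also have "\<dots> \<leadsto> [(i, Cup b), (Suc i, Cup ?c), (Suc (Suc i), Cap), (i, Cross u)]"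
    by (rule deforms_at[OF nth_event_up[of "Suc (Suc i)" i "Cross u" 0 "Suc (Suc i)" Cap],
        where P = "[(i, Cup b), (Suc i, Cup ?c)]" and Q = "[]"]) simp_all
  also have "\<dots> \<leadsto> [(i, Cup b), (i, Cross u)]"
    by (rule deforms_at[OF zigzag_left[of "Suc i" ?c], where P = "[(i, Cup b)]" and Q = "[(i, Cross u)]"]) simp_all
  finally show "[(i, Cup (\<not> b)), (Suc (Suc i), Cup b), (Suc i, Cross (\<not> u)), (Suc (Suc i), Cap)] \<leadsto>
    [(i, Cup b), (i, Cross u)]" .
qed (rule cup_curl_run)

lemma cap_curl_run: "run s [(i, Cross u), (i, Cap)] = Some t \<Longrightarrow>
  run s [(Suc (Suc i), Cup (s ! Suc i)), (Suc i, Cross v), (Suc (Suc i), Cap), (i, Cap)] = Some t"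
  by (cases s i rule: at_cases) (auto simp: nth_append split: if_splits)

text \<open>The new minimum has to take its direction from the given row, so here the statement is
  about one row \<open>s\<close>, whereas \<open>cup_curl\<close> holds on all rows at once.\<close>

lemma cap_curl:
  assumes "run s [(i, Cross u), (i, Cap)] = Some t"
  shows "iso s t [(i, Cross u), (i, Cap)]
    [(Suc (Suc i), Cup (s ! Suc i)), (Suc i, Cross (\<not> u)), (Suc (Suc i), Cap), (i, Cap)]"
proof -
  define b where "b = s ! Suc i"
  have "[(Suc (Suc i), Cup b), (Suc i, Cross (\<not> u)), (Suc (Suc i), Cap), (i, Cap)] \<leadsto>
    [(Suc (Suc i), Cup b), (Suc i, Cross (\<not> u)), (i, Cap), (i, Cap)]"
    by (rule deforms_at[OF nth_event_down[of i i Cap 0 "Suc (Suc i)" Cap],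
        where P = "[(Suc (Suc i), Cup b), (Suc i, Cross (\<not> u))]" and Q = "[]"]) simp_all
  also have "\<dots> \<leadsto> [(Suc (Suc i), Cup b), (i, Cross u), (Suc i, Cap), (i, Cap)]"
    by (rule deforms_at[OF cap_slide_back[of i "\<not> u"], where P = "[(Suc (Suc i), Cup b)]" and Q = "[(i, Cap)]"]) simp_all
  also have "\<dots> \<leadsto> [(i, Cross u), (Suc (Suc i), Cup b), (Suc i, Cap), (i, Cap)]"
    by (rule deforms_at[OF nth_event_down[of "Suc (Suc i)" i "Cross u" 0 "Suc (Suc i)" "Cup b"],
        where P = "[]" and Q = "[(Suc i, Cap), (i, Cap)]"]) simp_all
  also have "\<dots> \<leadsto> [(i, Cross u), (i, Cap)]"
    by (rule deforms_at[OF zigzag_right[of "Suc i" b], where P = "[(i, Cross u)]" and Q = "[(i, Cap)]"]) simp_all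
  finally show ?thesis
    using cap_curl_run[OF assms] unfolding deforms_def b_def by (blast intro: iso_sym)
qed

lemma kink_run: "kink u i K \<Longrightarrow> run s K = Some t \<Longrightarrow> t = s"
  by (erule kink.cases; cases s i rule: at_cases) (auto split: if_splits)

lemma circle_run: "run s [(j, Cup b), (j, Cap)] = Some t \<longleftrightarrow> j \<le> length s \<and> t = s"
  by (cases s j rule: at_cases) auto

lemma smoothing_run:
  "run s [(i, Cross u)] = Some t \<Longrightarrow> run s (smoothing s i) = Some t"
  unfolding smoothing_def by (cases s i rule: at_cases) (auto simp: nth_append split: if_splits)

section \<open>Reduction to trivial diagrams\<close>

text \<open>The right leg of a minimum passes over \<open>m\<close> strands. Every event sequence reduces to such arcs by
  the relations that determine \<open>R\<close>.\<close>

definition arc :: "nat \<Rightarrow> nat \<Rightarrow> bool \<Rightarrow> diagram" where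
  "arc p m b = (p, Cup b) # over (Suc p) m"

text \<open>Each arc adds two strands and nothing ever removes any. Hence the only closed standard
  diagram is empty, and the base case of later inductions becomes vacuous.\<close>

inductive standard :: "diagram \<Rightarrow> bool" where
  "standard []"
| "standard T \<Longrightarrow> standard (T @ arc p m b)"

text \<open>The top row is left open, since the reduction adds one event at a time. The rules are
  those under which \<open>R\<close> is controlled; the skein rule makes no assumption on the sign,
  because switching and smoothing determine the third value in either case.\<close>

inductive reducible :: "diagram \<Rightarrow> bool" where
  standard: "standard T \<Longrightarrow> reducible T"
| iso: "iso [] t X Y \<Longrightarrow> reducible Y \<Longrightarrow> reducible X"
| kink: "kink u i K \<Longrightarrow> reducible (P @ Q) \<Longrightarrow> reducible (P @ K @ Q)"
| circle: "reducible (P @ Q) \<Longrightarrow> reducible (P @ [(j, Cup b), (j, Cap)] @ Q)"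
| skein: "run [] P = Some s \<Longrightarrow> reducible (P @ [(i, Cross (\<not> u))] @ Q) \<Longrightarrow> reducible (P @ smoothing s i @ Q) \<Longrightarrow>
    reducible (P @ [(i, Cross u)] @ Q)"

lemma reducible_deforms:
  assumes "X \<leadsto> Y" "run [] X = Some t" "run [] Y = Some t \<Longrightarrow> reducible Y"
  shows "reducible X"
  using assms deforms_run[OF assms(1,2)] by (metis deforms_def reducible.iso)

text \<open>The derivation of \<open>reducible P\<close> is replayed with \<open>X\<close> attached
  on top. This works because a kink, a circle, a switch and a smoothing leave the row above them
  unchanged, so \<open>X\<close> stays valid throughout and only standard lists remain to be
  treated.\<close>

lemma reducible_append:
  assumes "reducible P" "run [] P = Some s" "run s X = Some t"
    and base: "\<And>T. standard T \<Longrightarrow> run [] T = Some s \<Longrightarrow> reducible (T @ X)"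
  shows "reducible (P @ X)"
  using assms(1,2)
proof (induction rule: reducible.induct)
  case (standard T)
  then show ?case by (rule base)
next
  case (iso t' Y Z)
  show ?case
  proof (cases "Y = Z")
    case True
    then show ?thesis using iso by simp
  next
    case False
    with iso_run[OF iso(1)] iso(4) have "t' = s" "run [] Z = Some s" by auto
    have "iso [] t Y Z" if "X = []" using that iso(1) \<open>t' = s\<close> assms(3) by simp
    have "iso [] t ([] @ Y @ X) ([] @ Z @ X)"
      using iso_context[of "[]" s Y Z "[]" "[]" X t] iso(1) \<open>t' = s\<close> assms(3) by simp
    moreover have "reducible (Z @ X)" using iso(3) \<open>run [] Z = Some s\<close> .
    ultimately show ?thesis using reducible.iso by simp
  qed
next
  case (kink u i K P Q)
  have "run [] (P @ Q) = Some s"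
    using kink(4) kink_run[OF kink(1)] by (auto simp: run_append_Some)
  from reducible.kink[OF kink(1), of P "Q @ X"] kink(3)[OF this] show ?case by simp
next
  case (circle P Q j b)
  have "run [] (P @ Q) = Some s"
    using circle(3) circle_run unfolding run_append_Some by metis
  from reducible.circle[of P "Q @ X"] circle(2)[OF this] show ?case by simp
next
  case (skein P r i u Q)
  obtain r' where r': "run r [(i, Cross u)] = Some r'" "run r' Q = Some s"
    using skein(1,6) by (auto simp: run_append_Some bind_eq_Some_conv)
  have r2: "run r [(i, Cross (\<not> u))] = Some r'"
    using r'(1) by (simp add: step.simps)
  have "run [] (P @ [(i, Cross (\<not> u))] @ Q) = Some s"
    using skein(1) r2 r'(2) unfolding run_append_Some by blast
  moreover have "run [] (P @ smoothing r i @ Q) = Some s"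
    using skein(1) smoothing_run[OF r'(1)] r'(2) unfolding run_append_Some by blast
  ultimately show ?case using reducible.skein[OF skein(1), of i u "Q @ X"] skein(4,5) by simp
qed

lemma reducible_arc:
  assumes "reducible P" "run [] (P @ arc p m b) = Some t"
  shows "reducible (P @ arc p m b)"
proof -
  obtain s where "run [] P = Some s" "run s (arc p m b) = Some t"
    using assms(2) unfolding run_append_Some by blast
  then show ?thesis using assms(1) by (auto intro: reducible_append reducible.standard standard.intros)
qed

lemma reducible_cup_curl:
  assumes "run [] (P @ [(i, Cup b), (i, Cross u)] @ Q) = Some t"
    and "run [] (P @ [(i, Cup (\<not> b))] @ Q) = Some t \<Longrightarrow> reducible (P @ [(i, Cup (\<not> b))] @ Q)"
  shows "reducible (P @ [(i, Cup b), (i, Cross u)] @ Q)"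
proof -
  let ?K = "[(Suc (Suc i), Cup b), (Suc i, Cross (\<not> u)), (Suc (Suc i), Cap)]"
  have k: "kink (\<not> u) (Suc i) ?K" using kink.loop_right[of "\<not> u" "Suc i" b] by simp
  have d: "P @ [(i, Cup b), (i, Cross u)] @ Q \<leadsto> P @ ([(i, Cup (\<not> b))] @ ?K) @ Q"
    using deforms_context[OF cup_curl] by simp
  show ?thesis
  proof (rule reducible_deforms[OF d assms(1)])
    assume "run [] (P @ ([(i, Cup (\<not> b))] @ ?K) @ Q) = Some t"
    then have "run [] ((P @ [(i, Cup (\<not> b))]) @ ?K @ Q) = Some t" by simp
    then have "run [] ((P @ [(i, Cup (\<not> b))]) @ Q) = Some t"
      unfolding run_append_Some using kink_run[OF k] by blast
    then have "reducible ((P @ [(i, Cup (\<not> b))]) @ Q)" using assms(2) by simp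
    from reducible.kink[OF k this] show "reducible (P @ ([(i, Cup (\<not> b))] @ ?K) @ Q)" by simp
  qed
qed

lemma reducible_cap_curl:
  assumes "run [] (P @ [(i, Cross u), (i, Cap)] @ Q) = Some t"
    and "run [] (P @ [(i, Cap)] @ Q) = Some t \<Longrightarrow> reducible (P @ [(i, Cap)] @ Q)"
  shows "reducible (P @ [(i, Cross u), (i, Cap)] @ Q)"
proof -
  obtain s s' where s: "run [] P = Some s" "run s [(i, Cross u), (i, Cap)] = Some s'" "run s' Q = Some t"
    using assms(1) unfolding run_append_Some by blast
  let ?K = "[(Suc (Suc i), Cup (s ! Suc i)), (Suc i, Cross (\<not> u)), (Suc (Suc i), Cap)]"
  have k: "kink (\<not> u) (Suc i) ?K" using kink.loop_right[of "\<not> u" "Suc i"] by simp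
  have "iso [] t (P @ [(i, Cross u), (i, Cap)] @ Q) (P @ (?K @ [(i, Cap)]) @ Q)"
    using iso_context[OF cap_curl[OF s(2)] s(1,3)] by simp
  moreover have "reducible (P @ (?K @ [(i, Cap)]) @ Q)"
  proof -
    have "run s (?K @ [(i, Cap)]) = Some s'" using cap_curl_run[OF s(2), of "\<not> u"] by simp
    then have "run s [(i, Cap)] = Some s'"
      unfolding run_append_Some using kink_run[OF k] by blast
    then have "run [] (P @ [(i, Cap)] @ Q) = Some t"
      using s(1,3) unfolding run_append_Some by blast
    from reducible.kink[OF k assms(2)[OF this]] show ?thesis by simp
  qed
  ultimately show ?thesis by (rule reducible.iso)
qed

section \<open>Commuting or cancelling one event with the arc below it\<close>

lemma arc_far_left:
  assumes "i + ins e \<le> p"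
  shows "arc p m b @ [(i, e)] \<leadsto> (i, e) # arc (p - ins e + outs e) m b"
proof -
  have "arc p m b @ [(i, e)] \<leadsto> [(p, Cup b), (i, e)] @ over (Suc (p - ins e + outs e)) m"
    by (rule deforms_at[OF far_left[of i e "Suc p" m], where P = "[(p, Cup b)]" and Q = "[]"])
      (use assms in \<open>simp_all add: arc_def Suc_diff_le\<close>)
  also have "\<dots> \<leadsto> (i, e) # arc (p - ins e + outs e) m b"
    by (rule deforms_at[OF nth_event_down[of "p - ins e + outs e" i e "p - ins e - i" p "Cup b"],
          where P = "[]" and Q = "over (Suc (p - ins e + outs e)) m"])
      (use assms in \<open>simp_all add: arc_def\<close>)
  finally show ?thesis .
qed

lemma arc_far_right:
  "arc p m b @ [(p + m + 2 + k, e)] \<leadsto> (p + m + k, e) # arc p m b"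
proof -
  have "arc p m b @ [(p + m + 2 + k, e)] \<leadsto> [(p, Cup b), (p + m + 2 + k, e)] @ over (Suc p) m"
    by (rule deforms_at[OF far_right[of "Suc p" m "p + m + 2 + k" e], where P = "[(p, Cup b)]" and Q = "[]"])
      (simp_all add: arc_def)
  also have "\<dots> \<leadsto> (p + m + k, e) # arc p m b"
    by (rule deforms_at[OF nth_event_up[of "p + m + 2 + k" p "Cup b" "m + k" "p + m + k" e],
          where P = "[]" and Q = "over (Suc p) m"])
      (simp_all add: arc_def)
  finally show ?thesis .
qed

lemma arc_inner_cross:
  assumes "i + 2 \<le> m"
  shows "arc p m b @ [(Suc p + i, Cross u)] \<leadsto> (p + i, Cross u) # arc p m b"
proof -
  have "arc p m b @ [(Suc p + i, Cross u)] \<leadsto> [(p, Cup b), (Suc (Suc p + i), Cross u)] @ over (Suc p) m"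
    by (rule deforms_at[OF sweep_cross[of i m "Suc p" u], where P = "[(p, Cup b)]" and Q = "[]"])
      (use assms in \<open>simp_all add: arc_def\<close>)
  also have "\<dots> \<leadsto> (p + i, Cross u) # arc p m b"
    by (rule deforms_at[OF nth_event_up[of "Suc (Suc p + i)" p "Cup b" i "p + i" "Cross u"],
          where P = "[]" and Q = "over (Suc p) m"])
      (simp_all add: arc_def)
  finally show ?thesis .
qed

lemma arc_inner_cap:
  "arc p (i + Suc (Suc l)) b @ [(Suc p + i, Cap)] \<leadsto> (p + i, Cap) # arc p (i + l) b"
proof -
  have "arc p (i + Suc (Suc l)) b @ [(Suc p + i, Cap)] \<leadsto>
      [(p, Cup b), (Suc (Suc p + i), Cap)] @ over (Suc p) (i + l)"
    by (rule deforms_at[OF sweep_cap[of "Suc p" i l], where P = "[(p, Cup b)]" and Q = "[]"])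
      (simp_all add: arc_def)
  also have "\<dots> \<leadsto> (p + i, Cap) # arc p (i + l) b"
    by (rule deforms_at[OF nth_event_up[of "Suc (Suc p + i)" p "Cup b" i "p + i" Cap],
          where P = "[]" and Q = "over (Suc p) (i + l)"])
      (simp_all add: arc_def)
  finally show ?thesis .
qed

lemma arc_Suc: "arc p (Suc m) b = arc p m b @ [(Suc (p + m), Cross True)]"
  unfolding arc_def over_snoc by simp

lemma arc_left_cap:
  "arc (Suc i) m b @ [(i, Cap)] \<leadsto> over i m"
proof -
  have "arc (Suc i) m b @ [(i, Cap)] \<leadsto> [(Suc i, Cup b), (i, Cap)] @ over i m"
    by (rule deforms_at[OF far_left[of i Cap "Suc (Suc i)" m], where P = "[(Suc i, Cup b)]" and Q = "[]"])
      (simp_all add: arc_def)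
  also have "\<dots> \<leadsto> over i m"
    by (rule deforms_at[OF zigzag_right[of i b], where P = "[]" and Q = "over i m"]) simp_all
  finally show ?thesis .
qed

lemma arc_left_inner_cap:
  "arc p (Suc m) b @ [(p, Cap)] \<leadsto> [(p, Cup b), (p, Cross False)] @ (Suc p, Cap) # over p m"
proof -
  have "arc p (Suc m) b @ [(p, Cap)] \<leadsto> [(p, Cup b), (Suc p, Cross True)] @ (p, Cap) # over p m"
    by (rule deforms_at[OF far_left[of p Cap "Suc (Suc p)" m],
        where P = "[(p, Cup b), (Suc p, Cross True)]" and Q = "[]"])
      (simp_all add: arc_def)
  also have "\<dots> \<leadsto> [(p, Cup b), (p, Cross False)] @ (Suc p, Cap) # over p m"
    by (rule deforms_at[OF cap_slide_back[of p True], where P = "[(p, Cup b)]" and Q = "over p m"]) simp_all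
  finally show ?thesis .
qed

text \<open>The mirror image of \<open>over\<close>: the strand in position \<open>j + k\<close>
  passes leftwards over \<open>k\<close> neighbours. It arises when the right leg of an arc is
  joined by a maximum to the next strand on the right.\<close>

primrec over_left :: "nat \<Rightarrow> nat \<Rightarrow> diagram" where
  "over_left j 0 = []"
| "over_left j (Suc k) = (j + k, Cross False) # over_left j k"

text \<open>In each induction step the last crossing of the arc slides through the maximum, changes
  its flag, and then commutes below the rest of the arc; at the end a zigzag is left.\<close>

lemma arc_right_cap:
  "arc p m b @ [(Suc (p + m), Cap)] \<leadsto> over_left p m"
proof (induction m)
  case 0
  show ?case using zigzag_left[of p b] by (simp add: arc_def)
next
  case (Suc m)
  have "arc p (Suc m) b @ [(Suc (p + Suc m), Cap)] \<leadsto>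
      arc p m b @ [(p + m + 2 + 0, Cross False)] @ [(Suc (p + m), Cap)]"
    by (rule deforms_at[OF cap_slide[of "Suc (p + m)" True], where P = "arc p m b" and Q = "[]"])
      (simp_all add: arc_Suc)
  also have "\<dots> \<leadsto> (p + m, Cross False) # arc p m b @ [(Suc (p + m), Cap)]"
    by (rule deforms_at[OF arc_far_right[of p m b 0 "Cross False"], where P = "[]" and Q = "[(Suc (p + m), Cap)]"])
      simp_all
  also have "\<dots> \<leadsto> (p + m, Cross False) # over_left p m"
    by (rule deforms_Cons) (rule Suc.IH)
  finally show ?case by simp
qed

text \<open>The crossing slides through the minimum, which moves the arc one place to the left and
  makes its right leg pass over one more strand. Only the flag \<open>False\<close> has this effect;
  the other flag is reached through the skein relation.\<close>

lemma arc_left_cross: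
  "arc (Suc i) m b @ [(i, Cross False)] \<leadsto> arc i (Suc m) b"
proof -
  have "arc (Suc i) m b @ [(i, Cross False)] \<leadsto> [(Suc i, Cup b), (i, Cross False)] @ over (Suc (Suc i)) m"
    by (rule deforms_at[OF far_left[of i "Cross False" "Suc (Suc i)" m], where P = "[(Suc i, Cup b)]" and Q = "[]"])
      (simp_all add: arc_def)
  also have "\<dots> \<leadsto> arc i (Suc m) b"
    by (rule deforms_at[OF cup_slide_back[of i b False], where P = "[]" and Q = "over (Suc (Suc i)) m"])
      (simp_all add: arc_def)
  finally show ?thesis .
qed

lemma arc_left_inner_cross:
  "arc p (Suc m) b @ [(p, Cross True)] \<leadsto> arc (Suc p) m b"
proof -
  have "arc p (Suc m) b @ [(p, Cross True)] \<leadsto>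
      [(p, Cup b), (Suc p, Cross True), (p, Cross True)] @ over (Suc (Suc p)) m"
    by (rule deforms_at[OF far_left[of p "Cross True" "Suc (Suc p)" m],
        where P = "[(p, Cup b), (Suc p, Cross True)]" and Q = "[]"])
      (simp_all add: arc_def)
  also have "\<dots> \<leadsto> [(Suc p, Cup b), (p, Cross False), (p, Cross True)] @ over (Suc (Suc p)) m"
    by (rule deforms_at[OF cup_slide[of p b True], where P = "[]" and Q = "(p, Cross True) # over (Suc (Suc p)) m"])
      simp_all
  also have "\<dots> \<leadsto> arc (Suc p) m b"
    by (rule deforms_at[OF cross_cancel[of True False p],
        where P = "[(Suc p, Cup b)]" and Q = "over (Suc (Suc p)) m"]) (simp_all add: arc_def)
  finally show ?thesis .
qed

lemma arc_right_inner_cross: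
  "arc p (Suc m) b @ [(Suc (p + m), Cross False)] \<leadsto> arc p m b"
  by (rule deforms_at[OF cross_cancel[of False True "Suc (p + m)"], where P = "arc p m b" and Q = "[]"])
    (simp_all add: arc_Suc)

lemma run_Some_length: "run s [(i, e)] = Some t \<Longrightarrow> i + ins e \<le> length s \<and> length t + ins e = length s + outs e"
  using step_lengths by simp

lemma over_run_length: "run s (over j k) = Some t \<Longrightarrow> (k > 0 \<longrightarrow> j + k < length s) \<and> length t = length s"
proof (induction k arbitrary: s j)
  case (Suc k)
  then obtain r where "step s (j, Cross True) = Some r" "run r (over (Suc j) k) = Some t"
    by (auto simp: bind_eq_Some_conv)
  with step_lengths[OF this(1)] Suc.IH[OF this(2)] show ?case by auto
qed simp

lemma arc_run_length: "run s (arc p m b) = Some t \<Longrightarrow> p + m \<le> length s \<and> length t = length s + 2"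
proof -
  assume "run s (arc p m b) = Some t"
  then obtain r where "step s (p, Cup b) = Some r" "run r (over (Suc p) m) = Some t"
    by (auto simp: bind_eq_Some_conv arc_def)
  with step_lengths[OF this(1)] over_run_length[OF this(2)] show ?thesis by (cases m) auto
qed

text \<open>\<open>closed\<close> will be an induction hypothesis for a fixed number
  \<open>n\<close> of strands. Events with equally many ends below and above are the crossings,
  which keep the row length at \<open>n\<close>.\<close>

lemma reducible_events:
  assumes closed: "\<And>P s i e t. \<lbrakk>reducible P; run [] P = Some s; length s = n; run s [(i, e)] = Some t; ins e = outs e\<rbrakk>
      \<Longrightarrow> reducible (P @ [(i, e)])"
    and "reducible P" "run [] P = Some s" "length s = n" "run s X = Some t" "\<forall>(i, e) \<in> set X. ins e = outs e"
  shows "reducible (P @ X)"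
  using assms(2-6)
proof (induction X arbitrary: P s)
  case (Cons x X)
  obtain i e where x: "x = (i, e)" by (cases x)
  obtain r where r: "run s [x] = Some r" "run r X = Some t"
    using Cons.prems(4) by (auto simp: bind_eq_Some_conv)
  have "reducible (P @ [x])" using closed Cons.prems r(1) x by auto
  moreover have "run [] (P @ [x]) = Some r" using Cons.prems(2) r(1) unfolding run_append_Some by blast
  moreover have "length r = n" using run_Some_length[of s i e r] r(1) x Cons.prems(3,5) by auto
  ultimately have "reducible ((P @ [x]) @ X)" by (rule Cons.IH[OF _ _ _ r(2)]) (use Cons.prems(5) in simp)
  then show ?case by simp
qed simp

lemma over_events: "\<forall>(i, e) \<in> set (over j k). ins e = outs e"
  by (induction k arbitrary: j) auto

lemma over_left_events: "\<forall>(i, e) \<in> set (over_left j k). ins e = outs e"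
  by (induction k) auto

text \<open>The maximum either commutes below the last arc, where there are two strands fewer and
  \<open>IH\<close> applies, or it destroys the arc, leaving crossings on \<open>T'\<close> that
  \<open>IH\<close> also covers, up to a removed circle or curl.\<close>

lemma standard_cap:
  assumes IH: "\<And>P s i e t. \<lbrakk>reducible P; run [] P = Some s; length s < n; run s [(i, e)] = Some t\<rbrakk> \<Longrightarrow> reducible (P @ [(i, e)])"
    and "standard T" "run [] (T @ [(i, Cap)]) = Some t" "run [] T = Some s" "length s = n"
  shows "reducible (T @ [(i, Cap)])"
  using assms(2)
proof cases
  case 1
  then show ?thesis using assms(3) by (cases i) simp_all
next
  case (2 T' p m b)
  obtain s' where s': "run [] T' = Some s'" "run s' (arc p m b) = Some s"
    using assms(4) unfolding 2 run_append_Some by blast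
  have l: "p + m \<le> length s'" "n = length s' + 2" using arc_run_length[OF s'(2)] assms(5) by auto
  have T': "reducible T'" by (rule reducible.standard) (rule 2)
  have "run s [(i, Cap)] = Some t" using assms(3,4) unfolding run_append_Some by simp
  then have i: "i + 2 \<le> n" using run_Some_length assms(5) by fastforce
  have IH': "reducible (T' @ X)" if "run s' X = Some r" "\<forall>(i, e) \<in> set X. ins e = outs e" for X r
    using reducible_events[of "length s'", OF _ T' s'(1) refl that] IH l(2) by fastforce
  have slide: "reducible (T' @ arc p m b @ [(i, Cap)])"
    if d: "arc p m b @ [(i, Cap)] \<leadsto> (j, Cap) # arc p' m' b" for j p' m'
  proof (rule reducible_deforms)
    show "T' @ arc p m b @ [(i, Cap)] \<leadsto> T' @ (j, Cap) # arc p' m' b" by (rule deforms_prefix[OF d])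
    show "run [] (T' @ arc p m b @ [(i, Cap)]) = Some t" using assms(3) 2 by simp
    assume a: "run [] (T' @ (j, Cap) # arc p' m' b) = Some t"
    then obtain r where "run s' [(j, Cap)] = Some r"
      using s'(1) by (auto simp: run_append_Some bind_eq_Some_conv)
    then have "reducible (T' @ [(j, Cap)])" using IH[OF T' s'(1)] l by auto
    from reducible_arc[OF this, of p' m' b t] a show "reducible (T' @ (j, Cap) # arc p' m' b)" by simp
  qed
  have direct: "reducible (T' @ arc p m b @ [(i, Cap)])"
    if d: "arc p m b @ [(i, Cap)] \<leadsto> X" and X: "\<forall>(i, e) \<in> set X. ins e = outs e" for X
  proof (rule reducible_deforms)
    show "T' @ arc p m b @ [(i, Cap)] \<leadsto> T' @ X" by (rule deforms_prefix[OF d])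
    show "run [] (T' @ arc p m b @ [(i, Cap)]) = Some t" using assms(3) 2 by simp
    assume "run [] (T' @ X) = Some t"
    then show "reducible (T' @ X)" using IH' X s'(1) by (auto simp: run_append_Some)
  qed
  have right: "reducible (T' @ arc p m b @ [(Suc (p + m), Cap)])"
    if "run [] (T' @ arc p m b @ [(Suc (p + m), Cap)]) = Some t" for m
  proof (rule reducible_deforms[OF deforms_prefix[OF arc_right_cap] that])
    assume "run [] (T' @ over_left p m) = Some t"
    then show "reducible (T' @ over_left p m)" using IH' over_left_events s'(1) by (auto simp: run_append_Some)
  qed
  have "reducible (T' @ arc p m b @ [(i, Cap)])"
  proof -
    \<comment> \<open>Above the arc, the left leg sits in position \<open>p\<close>, the
      \<open>m\<close> crossed strands in \<open>p + 1\<close> to \<open>p + m\<close>, and the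
      right leg in \<open>p + m + 1\<close>. The cases say which two neighbours the maximum
      joins.\<close>
    consider "i + 2 \<le> p" | "p = Suc i" | "i = p" "m = 0" | m' where "i = p" "m = Suc m'"
      | i' l' where "i = Suc p + i'" "m = i' + Suc (Suc l')"
      | m' where "m = Suc m'" "i = Suc (p + m')" | "i = Suc (p + m)" | k where "i = p + m + 2 + k"
    proof -
      consider "i + 2 \<le> p" | "p = Suc i" | "i = p" | "i > p" "i + 2 \<le> Suc (p + m)" | "i > p" "i + 1 = Suc (p + m)"
        | "i = Suc (p + m)" | "i \<ge> p + m + 2" by linarith
      then show thesis
      proof cases
        case 3
        then show ?thesis using that(3,4) by (cases m) auto
      next
        case 4
        show ?thesis using that(5)[of "i - Suc p" "m - Suc (Suc (i - Suc p))"] 4 by simp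
      next
        case 5
        show ?thesis using that(6)[of "m - 1"] 5 by simp
      next
        case 7
        then show ?thesis using that(8) le_Suc_ex by blast
      qed (use that in auto)
    qed
    then show ?thesis
    proof cases
      case 1
      then show ?thesis using slide arc_far_left[of i Cap p m b] by simp
    next
      case 2
      then show ?thesis using direct arc_left_cap over_events by blast
    next
      case 3
      then show ?thesis using reducible.circle[of T' "[]" p b] T' by (simp add: arc_def)
    next
      case (4 m')
      \<comment> \<open>The maximum joins the left leg to the first strand below the right leg.
        Their crossing slides down to the legs of the minimum; removing this curl leaves a
        zigzag.\<close>
      let ?Y = "[(p, Cup b), (p, Cross False)] @ (Suc p, Cap) # over p m'"
      have d: "T' @ arc p m b @ [(i, Cap)] \<leadsto> T' @ ?Y"
        unfolding 4 by (rule deforms_prefix[OF arc_left_inner_cap])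
      show ?thesis
      proof (rule reducible_deforms[OF d])
        show "run [] (T' @ arc p m b @ [(i, Cap)]) = Some t" using assms(3) 2 by simp
        assume Y: "run [] (T' @ ?Y) = Some t"
        show "reducible (T' @ ?Y)"
        proof (rule reducible_cup_curl[OF Y])
          let ?Z = "T' @ [(p, Cup (\<not> b))] @ (Suc p, Cap) # over p m'"
          assume Z: "run [] ?Z = Some t"
          have "?Z \<leadsto> T' @ over p m'"
            by (rule deforms_at[OF zigzag_left[of p "\<not> b"], where P = T' and Q = "over p m'"]) simp_all
          then show "reducible ?Z"
          proof (rule reducible_deforms[OF _ Z])
            assume "run [] (T' @ over p m') = Some t"
            then show "reducible (T' @ over p m')" using IH' over_events s'(1) by (auto simp: run_append_Some)
          qed
        qed
      qed
    next
      case (5 i' l')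
      then show ?thesis using slide arc_inner_cap[of p i' l' b] by simp
    next
      case (6 m')
      \<comment> \<open>The maximum sits directly on the last crossing of the arc, hence the two
        form a curl; without it the maximum joins the right leg of the shorter arc to the next
        strand.\<close>
      have "reducible ((T' @ arc p m' b) @ [(i, Cross True), (i, Cap)] @ [])"
      proof (rule reducible_cap_curl)
        show "run [] ((T' @ arc p m' b) @ [(i, Cross True), (i, Cap)] @ []) = Some t"
          using assms(3) 2 6 by (simp add: arc_Suc)
        assume "run [] ((T' @ arc p m' b) @ [(i, Cap)] @ []) = Some t"
        then show "reducible ((T' @ arc p m' b) @ [(i, Cap)] @ [])" using right[of m'] 6 by simp
      qed
      then show ?thesis using 6 by (simp add: arc_Suc)
    next
      case 7
      then show ?thesis using right[of m] assms(3) 2 by simp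
    next
      case (8 k)
      then show ?thesis using slide arc_far_right[of p m b k Cap] by simp
    qed
  qed
  then show ?thesis using 2 by simp
qed

text \<open>A crossing either commutes below the arc, or one of its two flags is absorbed into an
  arc of a different shape. The skein relation then supplies the other flag, once the smoothing is
  known to be reducible.\<close>

lemma standard_cross:
  assumes IH: "\<And>P s i e t. \<lbrakk>reducible P; run [] P = Some s; length s < n; run s [(i, e)] = Some t\<rbrakk> \<Longrightarrow> reducible (P @ [(i, e)])"
    and "standard T" "run [] (T @ [(i, Cross u)]) = Some t" "run [] T = Some s" "length s = n"
  shows "reducible (T @ [(i, Cross u)])"
  using assms(2)
proof cases
  case 1
  then show ?thesis using assms(3) by (cases i) simp_all
next
  case (2 T' p m b)
  obtain s' where s': "run [] T' = Some s'" "run s' (arc p m b) = Some s"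
    using assms(4) unfolding 2 run_append_Some by blast
  have l: "p + m \<le> length s'" "n = length s' + 2" using arc_run_length[OF s'(2)] assms(5) by auto
  have T': "reducible T'" by (rule reducible.standard) (rule 2)
  have run_s: "run s [(i, Cross v)] = Some t" for v
    using assms(3,4) unfolding run_append_Some by (simp add: step.simps)
  have i: "i + 2 \<le> n" using run_Some_length[OF run_s] assms(5) by simp
  have run_T: "run [] (T' @ arc p m b @ [(i, Cross v)]) = Some t" for v
    using run_s s' unfolding run_append_Some by blast
  \<comment> \<open>In the antiparallel case the smoothing is a maximum, handled by
    \<open>standard_cap\<close>, followed by a minimum, which is an arc over no strands.\<close>
  have smooth: "reducible (T @ smoothing s i @ [])"
  proof (cases "s ! i = s ! Suc i")
    case True
    then show ?thesis using reducible.standard[OF assms(2)] by (simp add: smoothing_def)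
  next
    case False
    have "run s ([(i, Cap)] @ [(i, Cup (s ! Suc i))]) = Some t"
      using smoothing_run[OF run_s] False by (simp add: smoothing_def)
    then obtain r where r: "run s [(i, Cap)] = Some r" "run r [(i, Cup (s ! Suc i))] = Some t"
      unfolding run_append_Some by blast
    have r': "run [] (T @ [(i, Cap)]) = Some r" using assms(4) r(1) unfolding run_append_Some by blast
    have "reducible (T @ [(i, Cap)])"
      by (rule standard_cap[OF IH assms(2) r' assms(4,5)])
    then have "reducible ((T @ [(i, Cap)]) @ arc i 0 (s ! Suc i))"
      by (rule reducible_arc[where t = t]) (subst run_append, use r' r(2) in \<open>simp add: arc_def\<close>)
    then show ?thesis using False by (simp add: smoothing_def arc_def)
  qed
  \<comment> \<open>By the skein relation it is enough to reduce one of the two flags, whichever is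
    convenient.\<close>
  have either: "reducible (T' @ arc p m b @ [(i, Cross u)])" if "reducible (T' @ arc p m b @ [(i, Cross v)])" for v
  proof (cases "v = u")
    case False
    then have v: "v = (\<not> u)" by simp
    show ?thesis using reducible.skein[OF assms(4), of i u "[]"] smooth that v 2 by simp
  qed (use that in simp)
  have slide: "reducible (T' @ arc p m b @ [(i, Cross u)])"
    if d: "arc p m b @ [(i, Cross u)] \<leadsto> (j, Cross u) # arc p' m b" for j p'
  proof (rule reducible_deforms)
    show "T' @ arc p m b @ [(i, Cross u)] \<leadsto> T' @ (j, Cross u) # arc p' m b" by (rule deforms_prefix[OF d])
    show "run [] (T' @ arc p m b @ [(i, Cross u)]) = Some t" by (rule run_T)
    assume a: "run [] (T' @ (j, Cross u) # arc p' m b) = Some t"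
    then obtain r where "run s' [(j, Cross u)] = Some r"
      using s'(1) by (auto simp: run_append_Some bind_eq_Some_conv)
    then have "reducible (T' @ [(j, Cross u)])" using IH[OF T' s'(1)] l by auto
    from reducible_arc[OF this, of p' m b t] a show "reducible (T' @ (j, Cross u) # arc p' m b)" by simp
  qed
  have absorb: "reducible (T' @ arc p m b @ [(i, Cross u)])"
    if d: "arc p m b @ [(i, Cross v)] \<leadsto> arc p' m' b" for v p' m'
  proof (rule either, rule reducible_deforms)
    show "T' @ arc p m b @ [(i, Cross v)] \<leadsto> T' @ arc p' m' b" by (rule deforms_prefix[OF d])
    show "run [] (T' @ arc p m b @ [(i, Cross v)]) = Some t" by (rule run_T)
    show "reducible (T' @ arc p' m' b)" if "run [] (T' @ arc p' m' b) = Some t"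
      by (rule reducible_arc[OF T' that])
  qed
  have "reducible (T' @ arc p m b @ [(i, Cross u)])"
  proof -
    consider "i + 2 \<le> p" | "p = Suc i" | "i = p" "m = 0" | m' where "i = p" "m = Suc m'"
      | i' where "i = Suc p + i'" "i' + 2 \<le> m"
      | m' where "m = Suc m'" "i = Suc (p + m')" | "i = Suc (p + m)" | k where "i = p + m + 2 + k"
    proof -
      consider "i + 2 \<le> p" | "p = Suc i" | "i = p" | "i > p" "i + 2 \<le> Suc (p + m)" | "i > p" "i + 1 = Suc (p + m)"
        | "i = Suc (p + m)" | "i \<ge> p + m + 2" by linarith
      then show thesis
      proof cases
        case 3
        then show ?thesis using that(3,4) by (cases m) auto
      next
        case 4
        show ?thesis using that(5)[of "i - Suc p"] 4 by simp
      next
        case 5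
        show ?thesis using that(6)[of "m - 1"] 5 by simp
      next
        case 7
        then show ?thesis using that(8) le_Suc_ex by blast
      qed (use that in auto)
    qed
    then show ?thesis
    proof cases
      case 1
      then show ?thesis using slide arc_far_left[of i "Cross u" p m b] by simp
    next
      case 2
      then show ?thesis using absorb arc_left_cross by blast
    next
      case 3
      have "reducible (T' @ [(p, Cup b), (p, Cross u)] @ [])"
      proof (rule reducible_cup_curl)
        show "run [] (T' @ [(p, Cup b), (p, Cross u)] @ []) = Some t"
          using run_T[of u] 3 by (simp add: arc_def)
        assume "run [] (T' @ [(p, Cup (\<not> b))] @ []) = Some t"
        then show "reducible (T' @ [(p, Cup (\<not> b))] @ [])" using reducible_arc[OF T', of p 0 "\<not> b"] by (simp add: arc_def)
      qed
      then show ?thesis using 3 by (simp add: arc_def)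
    next
      case (4 m')
      then show ?thesis using absorb arc_left_inner_cross by blast
    next
      case (5 i')
      then show ?thesis using slide arc_inner_cross[of i' m p b u] by simp
    next
      case (6 m')
      then show ?thesis using absorb arc_right_inner_cross by blast
    next
      case 7
      then show ?thesis using absorb[of True p "Suc m"] by (simp add: arc_Suc)
    next
      case (8 k)
      then show ?thesis using slide arc_far_right[of p m b k "Cross u"] by simp
    qed
  qed
  then show ?thesis using 2 by simp
qed

text \<open>Induction on the number of strands: moving an event below an arc puts it on a row with
  two strands fewer, while the arcs on top are restored for free by
  \<open>reducible_arc\<close>.\<close>

lemma reducible_event:
  assumes "reducible P" "run [] P = Some s" "run s [(i, e)] = Some t"
  shows "reducible (P @ [(i, e)])"
  using assms
proof (induction "length s" arbitrary: P s i e t rule: less_induct)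
  case less
  have IH: "reducible (P @ [(i, e)])"
    if "reducible P" "run [] P = Some r" "length r < length s" "run r [(i, e)] = Some t" for P r i e t
    using less.hyps[of r P i e t] that by simp
  show ?case
  proof (rule reducible_append[OF less.prems])
    fix T assume T: "standard T" "run [] T = Some s"
    then have t: "run [] (T @ [(i, e)]) = Some t"
      using less.prems(3) unfolding run_append_Some by blast
    show "reducible (T @ [(i, e)])"
    proof (cases e)
      case (Cup b)
      then show ?thesis using reducible.standard[OF standard.intros(2)[OF T(1), of i 0 b]] by (simp add: arc_def)
    next
      case Cap
      show ?thesis unfolding Cap by (rule standard_cap[where n = "length s", OF IH]) (use T t Cap in auto)
    next
      case (Cross u)
      show ?thesis unfolding Cross by (rule standard_cross[where n = "length s", OF IH]) (use T t Cross in auto)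
    qed
  qed
qed

theorem all_reducible: "run [] P = Some s \<Longrightarrow> reducible P"
proof (induction P arbitrary: s rule: rev_induct)
  case Nil
  show ?case by (intro reducible.standard standard.intros)
next
  case (snoc x P)
  then obtain r where r: "run [] P = Some r" "run r [x] = Some s" unfolding run_append_Some by blast
  with snoc.IH[OF r(1)] show ?case by (cases x) (auto intro: reducible_event)
qed

section \<open>The polynomial \<open>R\<close> of split unions\<close>

lemma iso_imp_regular_isotopic:
  assumes "iso [] [] D D'"
  shows "regular_isotopic D D'"
  using assms unfolding iso_def regular_isotopic_def
proof (induction rule: equivclp_induct)
  case (step y z)
  have "local_change iso_move v w" if "iso_step [] [] v w" for v w
    using that by cases (auto intro!: local_change.intros simp: link_diagram_def)
  with step(2) have "local_change iso_move y z \<or> local_change iso_move z y" by blast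
  with step(3) show ?case by (rule equivclp_into_equivclp)
qed simp

lemma split_nth: "i < length s \<Longrightarrow> \<exists>x r. s = x @ s ! i # r \<and> i = length x"
  using id_take_nth_drop[of i s] by (intro exI[of _ "take i s"] exI[of _ "drop (Suc i) s"]) simp

lemma run_insert:
  "run s P = Some r \<Longrightarrow> run r M = Some r' \<Longrightarrow> run r' Q = Some t \<Longrightarrow> run s (P @ M @ Q) = Some t"
  by (simp add: run_append)

lemma run_switch: "run s (P @ [(i, Cross u)] @ Q) = run s (P @ [(i, Cross v)] @ Q)"
proof -
  have "step s (i, Cross u) = step s (i, Cross v)" for s by (simp add: step.simps)
  then show ?thesis by (simp only: run_append run_Cons append.simps)
qed

lemma laurent_monom_mult: "laurent_monom i j k l * laurent_monom i' j' k' l' = laurent_monom (i + i') (j + j') (k + k') (l + l')"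
  by (simp add: laurent_monom_def mult_single)

lemma laurent_monom_zero: "laurent_monom 0 0 0 0 = 1"
proof -
  have "(0, 0, 0, 0) = (0 :: int \<times> int \<times> int \<times> int)" by (simp add: zero_prod_def)
  then show ?thesis unfolding laurent_monom_def by (simp only: single_one)
qed

locale homflypt =
  fixes R :: "diagram \<Rightarrow> laurent"
  assumes homflypt: "regular_homflypt R"
begin

lemma R_regular_isotopic:
  "link_diagram D \<Longrightarrow> link_diagram D' \<Longrightarrow> regular_isotopic D D' \<Longrightarrow> R D = R D'"
  using homflypt unfolding regular_homflypt_def regular_isotopy_invariant_def by blast

lemma R_iso: "link_diagram D \<Longrightarrow> iso [] [] D D' \<Longrightarrow> R D = R D'"
  using R_regular_isotopic[of D D'] iso_imp_regular_isotopic[of D D'] iso_run[of "[]" "[]" D D']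
  by (auto simp: link_diagram_def)

lemma R_deforms: "link_diagram D \<Longrightarrow> D \<leadsto> D' \<Longrightarrow> R D = R D'"
  by (rule R_iso) (auto simp: deforms_def link_diagram_def)

lemma R_skein:
  assumes "link_diagram (P @ [(i, Cross u)] @ Q)" "run [] P = Some s" "positive s i u"
  shows "R (P @ [(i, Cross u)] @ Q) - R (P @ [(i, Cross (\<not> u))] @ Q) = var_w * R (P @ smoothing s i @ Q)"
  using homflypt conway_triple.intros[OF assms] unfolding regular_homflypt_def by blast

lemma R_kink:
  "kink u i K \<Longrightarrow> link_diagram (P @ K @ Q) \<Longrightarrow> R (P @ K @ Q) = (if u then var_a else inv_a) * R (P @ Q)"
  using homflypt unfolding regular_homflypt_def by blast

lemma R_circle_diagram: "R [(0, Cup b), (0, Cap)] = 1"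
  using homflypt unfolding regular_homflypt_def by blast

end

text \<open>The variable \<open>w\<close> is a unit, so it can be divided out without any appeal to
  the absence of zero divisors.\<close>

lemma var_w_cancel:
  assumes "var_w * x = (var_a - inv_a) * y"
  shows "x = eta * y"
proof -
  have "inv_w * var_w = 1" by (simp add: laurent_monom_mult laurent_monom_zero)
  then have "x = inv_w * (var_w * x)" by (simp only: mult.assoc[symmetric] mult_1)
  also have "\<dots> = inv_w * ((var_a - inv_a) * y)" by (simp only: assms)
  also have "\<dots> = eta * y" by (simp only: eta_def mult_ac)
  finally show ?thesis .
qed

context homflypt
begin

text \<open>The origin of \<open>eta\<close>: the strands of a curl are parallel at its crossing, so
  smoothing just deletes the crossing and leaves a strand beside a circle, while the two curls
  differ by the factors \<open>a\<close> and \<open>a^-1\<close>.\<close>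

lemma kink_skein:
  assumes "link_diagram (P @ (X @ [(j, Cross True)] @ Y) @ Q)" "run [] (P @ X) = Some r" "r ! j = r ! Suc j"
    and "kink True i (X @ [(j, Cross True)] @ Y)" "kink False i (X @ [(j, Cross False)] @ Y)"
  shows "R (P @ (X @ Y) @ Q) = eta * R (P @ Q)"
proof (rule var_w_cancel)
  have l: "link_diagram (P @ (X @ [(j, Cross False)] @ Y) @ Q)"
    using assms(1) run_switch[of "[]" "P @ X" j True "Y @ Q" False] by (simp add: link_diagram_def)
  show "var_w * R (P @ (X @ Y) @ Q) = (var_a - inv_a) * R (P @ Q)"
    using R_skein[of "P @ X" j True "Y @ Q" r] R_kink[OF assms(4,1)] R_kink[OF assms(5) l] assms(1,2,3)
    by (simp add: positive_def smoothing_def algebra_simps)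
qed

text \<open>Adding a crossing with the strand on its left turns the circle into a curl, provided
  that the circle is oriented as \<open>b = s ! i\<close> demands. Circles of the other orientation
  are treated on the other side of the strand.\<close>

lemma circle_right:
  assumes "run [] P = Some s" "i < length s" "b = s ! i" "link_diagram (P @ Q)"
  shows "R (P @ [(Suc i, Cup b), (Suc i, Cap)] @ Q) = eta * R (P @ Q)"
proof -
  have run: "run s [(Suc i, Cup b), (i, Cross v), (Suc i, Cap)] = Some s"
    "run s [(Suc i, Cup b)] = Some (take (Suc i) s @ [b, \<not> b] @ drop (Suc i) s)" for v
  proof -
    obtain x r where s: "s = x @ b # r" "i = length x" using split_nth[OF assms(2)] unfolding assms(3)[symmetric] by blast
    show "run s [(Suc i, Cup b), (i, Cross v), (Suc i, Cap)] = Some s"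
      "run s [(Suc i, Cup b)] = Some (take (Suc i) s @ [b, \<not> b] @ drop (Suc i) s)"
      unfolding s by auto
  qed
  have "R (P @ ([(Suc i, Cup b)] @ [(Suc i, Cap)]) @ Q) = eta * R (P @ Q)"
  proof (rule kink_skein[where j = i])
    show "run [] (P @ [(Suc i, Cup b)]) = Some (take (Suc i) s @ [b, \<not> b] @ drop (Suc i) s)"
      using assms(1) run(2) unfolding run_append_Some by blast
    show "(take (Suc i) s @ [b, \<not> b] @ drop (Suc i) s) ! i = (take (Suc i) s @ [b, \<not> b] @ drop (Suc i) s) ! Suc i"
      using assms(2,3) by (simp add: nth_append)
    show "link_diagram (P @ ([(Suc i, Cup b)] @ [(i, Cross True)] @ [(Suc i, Cap)]) @ Q)"
      using run_insert[OF assms(1) run(1)[of True], of Q "[]"] assms(1,4) by (simp add: link_diagram_def run_append)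
  qed (use kink.loop_right[of _ i b] in simp_all)
  then show ?thesis by simp
qed

lemma circle_left:
  assumes "run [] P = Some s" "i < length s" "b = (\<not> s ! i)" "link_diagram (P @ Q)"
  shows "R (P @ [(i, Cup b), (i, Cap)] @ Q) = eta * R (P @ Q)"
proof -
  have run: "run s [(i, Cup b), (Suc i, Cross v), (i, Cap)] = Some s"
    "run s [(i, Cup b)] = Some (take i s @ [b, \<not> b] @ drop i s)" for v
  proof -
    have "s ! i = (\<not> b)" using assms(3) by simp
    with split_nth[OF assms(2)] have "\<exists>x r. s = x @ (\<not> b) # r \<and> i = length x" by simp
    then obtain x r where s: "s = x @ (\<not> b) # r" "i = length x" by blast
    show "run s [(i, Cup b), (Suc i, Cross v), (i, Cap)] = Some s"
      "run s [(i, Cup b)] = Some (take i s @ [b, \<not> b] @ drop i s)"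
      unfolding s by auto
  qed
  have "R (P @ ([(i, Cup b)] @ [(i, Cap)]) @ Q) = eta * R (P @ Q)"
  proof (rule kink_skein[where j = "Suc i"])
    show "run [] (P @ [(i, Cup b)]) = Some (take i s @ [b, \<not> b] @ drop i s)"
      using assms(1) run(2) unfolding run_append_Some by blast
    show "(take i s @ [b, \<not> b] @ drop i s) ! Suc i = (take i s @ [b, \<not> b] @ drop i s) ! Suc (Suc i)"
      using assms(2,3) by (simp add: nth_append)
    show "link_diagram (P @ ([(i, Cup b)] @ [(Suc i, Cross True)] @ [(i, Cap)]) @ Q)"
      using run_insert[OF assms(1) run(1)[of True], of Q "[]"] assms(1,4) by (simp add: link_diagram_def run_append)
  qed (use kink.loop_left[of _ i b] in simp_all)
  then show ?thesis by simp
qed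

text \<open>In the intermediate diagram \<open>?X\<close> the minimum opens on the right of the
  strand, the strand passes over both legs, and the maximum closes on its left. Pulling the strand
  back below the crossings gives one circle, pulling it above them gives the other.\<close>

lemma circle_jump:
  "i < length s \<Longrightarrow> iso s s [(i, Cup b), (i, Cap)] [(Suc i, Cup b), (Suc i, Cap)]"
proof -
  assume i: "i < length s"
  have c: "[(Suc i, Cup b), (i, Cross True), (Suc i, Cross True)] \<leadsto> [(i, Cup b)]"
  proof -
    have "[(Suc i, Cup b), (i, Cross True), (Suc i, Cross True)] \<leadsto> [(i, Cup b), (Suc i, Cross False), (Suc i, Cross True)]"
      by (rule deforms_at[OF cup_slide_back[of i b True], where P = "[]" and Q = "[(Suc i, Cross True)]"]) simp_all
    also have "\<dots> \<leadsto> [(i, Cup b)]"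
      by (rule deforms_at[OF cross_cancel[of True False "Suc i"], where P = "[(i, Cup b)]" and Q = "[]"]) simp_all
    finally show ?thesis .
  qed
  obtain x p r where s: "s = x @ p # r" "i = length x" using split_nth[OF i] by metis
  let ?X = "[(Suc i, Cup b), (i, Cross True), (Suc i, Cross True), (i, Cap)]"
  have r: "run s ?X = Some s" unfolding s by simp
  have "?X \<leadsto> [(i, Cup b), (i, Cap)]"
    by (rule deforms_at[OF c, where P = "[]" and Q = "[(i, Cap)]"]) simp_all
  moreover have "?X \<leadsto> [(Suc i, Cup b), (Suc i, Cap)]"
    by (rule deforms_at[OF sweep_cap[of i 0 0], where P = "[(Suc i, Cup b)]" and Q = "[]"]) simp_all
  ultimately show ?thesis using r unfolding deforms_def by (meson iso_sym iso_trans)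
qed

lemma circle_near:
  assumes "run [] P = Some s" "j \<le> length s" "s \<noteq> []" "link_diagram (P @ Q)"
  shows "R (P @ [(j, Cup b), (j, Cap)] @ Q) = eta * R (P @ Q)"
proof -
  have link: "link_diagram (P @ [(j, Cup b), (j, Cap)] @ Q)" if "j \<le> length s" for j
    using assms(1,4) circle_run[of s j b s] that unfolding link_diagram_def
    by (intro run_insert[of _ _ s _ s]) (simp_all add: run_append)
  have jump: "R (P @ [(i, Cup b), (i, Cap)] @ Q) = R (P @ [(Suc i, Cup b), (Suc i, Cap)] @ Q)" if "i < length s" for i
    by (rule R_iso[OF link iso_context[OF circle_jump[OF that] assms(1)]])
       (use that assms(1,4) in \<open>auto simp: link_diagram_def run_append\<close>)
  have both: "R (P @ [(i, Cup b), (i, Cap)] @ Q) = eta * R (P @ Q)"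
     "R (P @ [(Suc i, Cup b), (Suc i, Cap)] @ Q) = eta * R (P @ Q)" if i: "i < length s" for i
    using circle_right[OF assms(1) i _ assms(4), of b] circle_left[OF assms(1) i _ assms(4), of b] jump[OF i]
    by (cases "b = s ! i"; simp)+
  show ?thesis
  proof (cases "j < length s")
    case True
    then show ?thesis by (rule both)
  next
    case False
    then have "j = Suc (length s - 1)" "length s - 1 < length s" using assms(2,3) by (cases s; simp)+
    then show ?thesis using both(2) by metis
  qed
qed

text \<open>The curl argument needs a strand beside the circle. On an empty row the preceding event
  must be a maximum, or the following one a minimum, and the circle is first exchanged with it. For
  \<open>P @ Q = []\<close> there is no such event, and indeed the value is then 1 instead of a
  multiple of \<open>eta\<close>.\<close>

lemma R_circle:
  assumes "link_diagram (P @ [(j, Cup b), (j, Cap)] @ Q)" "P @ Q \<noteq> []"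
  shows "R (P @ [(j, Cup b), (j, Cap)] @ Q) = eta * R (P @ Q)"
proof -
  obtain s where s: "run [] P = Some s" "j \<le> length s" "link_diagram (P @ Q)" "run s Q = Some []"
  proof -
    obtain s s' where "run [] P = Some s" "run s [(j, Cup b), (j, Cap)] = Some s'" "run s' Q = Some []"
      using assms(1) unfolding link_diagram_def run_append_Some by blast
    with that[of s] show thesis unfolding circle_run by (simp add: link_diagram_def run_append)
  qed
  show ?thesis
  proof (cases "s = []")
    case False
    show ?thesis by (rule circle_near[OF s(1,2) False s(3)])
  next
    case True
    then have j: "j = 0" using s by simp
    show ?thesis
    proof (cases "P = []")
      case False
      then obtain P' x where P: "P = P' @ [x]" by (cases P rule: rev_cases) auto
      obtain s' where s': "run [] P' = Some s'" "run s' [x] = Some []"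
        using s(1) True unfolding P run_append_Some by blast
      obtain i e where x: "x = (i, e)" by (cases x)
      have l: "i + ins e \<le> length s'" "ins e = length s' + outs e" using run_Some_length[of s' i e "[]"] s'(2) x by auto
      then have e: "e = Cap" "i = 0" "length s' = 2" by (cases e; simp)+
      have "P @ [(j, Cup b), (j, Cap)] @ Q \<leadsto> P' @ [(2, Cup b), (0, Cap), (0, Cap)] @ Q"
        by (rule deforms_at[OF nth_event_up[of 0 0 Cap 0 2 "Cup b"], where P = P' and Q = "(0, Cap) # Q"])
          (simp_all add: P x e j)
      also have "\<dots> \<leadsto> P' @ [(2, Cup b), (2, Cap)] @ [x] @ Q"
        by (rule deforms_at[OF nth_event_up[of 0 0 Cap 0 2 Cap], where P = "P' @ [(2, Cup b)]" and Q = Q])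
          (simp_all add: x e)
      finally have "R (P @ [(j, Cup b), (j, Cap)] @ Q) = R (P' @ [(2, Cup b), (2, Cap)] @ [x] @ Q)"
        by (rule R_deforms[OF assms(1)])
      also have "\<dots> = eta * R (P' @ [x] @ Q)"
        by (rule circle_near[OF s'(1)]) (use e s(3) P in auto)
      finally show ?thesis using P by simp
    next
      case P: True
      then obtain x Q' where Q: "Q = x # Q'" using assms(2) by (cases Q) auto
      obtain s' where s': "run [] [x] = Some s'" "run s' Q' = Some []"
        using s(4) True unfolding Q by (auto simp: bind_eq_Some_conv)
      obtain i e where x: "x = (i, e)" by (cases x)
      have l: "i + ins e \<le> 0" "length s' + ins e = outs e" using run_Some_length[of "[]" i e s'] s'(1) x by auto
      then obtain c where e: "e = Cup c" "i = 0" "length s' = 2" by (cases e) auto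
      have "P @ [(j, Cup b), (j, Cap)] @ Q \<leadsto> [(0, Cup b), (2, Cup c), (0, Cap)] @ Q'"
        by (rule deforms_at[OF nth_event_up[of 0 0 Cap 0 2 "Cup c"], where P = "[(0, Cup b)]" and Q = Q'])
          (simp_all add: P Q x e j)
      also have "\<dots> \<leadsto> [x] @ [(0, Cup b), (0, Cap)] @ Q'"
        by (rule deforms_at[OF nth_event_up[of 2 0 "Cup b" 0 0 "Cup c"], where P = "[]" and Q = "(0, Cap) # Q'"])
          (simp_all add: x e)
      finally have "R (P @ [(j, Cup b), (j, Cap)] @ Q) = R ([x] @ [(0, Cup b), (0, Cap)] @ Q')"
        by (rule R_deforms[OF assms(1)])
      also have "\<dots> = eta * R ([x] @ Q')"
        by (rule circle_near[OF s'(1)]) (use e s(3) P Q in auto)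
      finally show ?thesis using P Q by simp
    qed
  qed
qed

end

text \<open>The split formula is claimed only for nonempty diagrams, so the induction must know that
  an isotopy never reaches \<open>[]\<close>. A move with empty result is a zigzag or a pair of
  opposite crossings, and neither can start on the empty row.\<close>

lemma iso_move_Nil:
  assumes "iso_move M N"
  shows "M \<noteq> []" "N = [] \<Longrightarrow> run [] (M @ Q) = None"
proof -
  show "M \<noteq> []" using assms by (auto elim: planar_move.cases reidemeister2.cases reidemeister3.cases)
  assume "N = []"
  with assms consider i b where "M = [(i + 1, Cup b), (i, Cap)]" | i b where "M = [(i, Cup b), (i + 1, Cap)]"
    | i u where "M = [(i, Cross u), (i, Cross (\<not> u))]"
    by (auto elim!: planar_move.cases reidemeister2.cases reidemeister3.cases)
  then show "run [] (M @ Q) = None"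
  proof cases
    case (2 i b)
    then show ?thesis by (cases i) simp_all
  next
    case (3 i u)
    then show ?thesis by (cases i) simp_all
  qed simp
qed

lemma iso_Nil:
  assumes "iso [] t X Y"
  shows "X = [] \<longleftrightarrow> Y = []"
proof -
  have *: "X \<noteq> [] \<and> Y \<noteq> []" if "iso_step [] t X Y" for X Y
    using that
  proof cases
    case (1 M N P Q)
    have "run [] (M @ Q) \<noteq> None" if "P = []" using 1(4) that by simp
    with iso_move_Nil[OF 1(3)] 1(1,2) show ?thesis by (cases "P = []"; cases "N = []") auto
  qed
  from assms show ?thesis
    unfolding iso_def by (induction rule: equivclp_induct) (use * in auto)
qed

lemma kink_Nil: "kink u i K \<Longrightarrow> run [] (K @ Q) = None"
  by (erule kink.cases) (cases i; simp)+

context homflypt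
begin

text \<open>The difference of both sides, as a function of \<open>D\<close>, satisfies the relations of \<open>R\<close> and
  vanishes on a circle. Hence it vanishes on all reducible diagrams.\<close>

lemma R_split_reducible:
  assumes "reducible D" "link_diagram D" "D \<noteq> []" "link_diagram K" "K \<noteq> []"
  shows "R (K @ D) = eta * R K * R D"
  using assms(1-3)
proof (induction rule: reducible.induct)
  case (standard T)
  \<comment> \<open>A closed standard diagram is empty, against \<open>D \<noteq> []\<close>; so
    this case does not occur.\<close>
  have "standard T \<Longrightarrow> run [] T = Some s \<Longrightarrow> length s = 0 \<Longrightarrow> T = []" for s
  proof (erule standard.cases)
    fix T' p m b assume "T = T' @ arc p m b" "run [] T = Some s" "length s = 0"
    then have "run [] (T' @ arc p m b) = Some s" by simp
    then obtain r where "run r (arc p m b) = Some s" unfolding run_append_Some by blast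
    from arc_run_length[OF this] \<open>length s = 0\<close> show "T = []" by simp
  qed
  then show ?case using standard by (auto simp: link_diagram_def)
next
  case (iso t X Y)
  show ?case
  proof (cases "X = Y")
    case False
    with iso_run[OF iso(1)] iso(4) have t: "t = []" "link_diagram Y" by (auto simp: link_diagram_def)
    have "R X = R Y" using R_iso iso t by simp
    moreover have "R (K @ X) = R (K @ Y)"
    proof (rule R_iso)
      show "link_diagram (K @ X)" using assms(4) iso(4) by (simp add: link_diagram_def run_append)
      show "iso [] [] (K @ X) (K @ Y)"
        using iso_context[of "[]" "[]" X Y "[]" K "[]" "[]"] iso(1) t assms(4) by (simp add: link_diagram_def)
    qed
    moreover have "Y \<noteq> []" using iso_Nil[OF iso(1)] iso(5) by simp
    ultimately show ?thesis using iso(3) t by simp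
  qed (use iso in simp)
next
  case (kink u i L P Q)
  then have "P \<noteq> []" using kink_Nil by (auto simp: link_diagram_def)
  have l: "link_diagram (P @ Q)"
    using kink(4) kink_run[OF kink(1)] by (auto simp: link_diagram_def run_append_Some)
  have "link_diagram ((K @ P) @ L @ Q)" using assms(4) kink(4) by (simp add: link_diagram_def run_append)
  from R_kink[OF kink(1) this] R_kink[OF kink(1,4)] kink(3)[OF l] \<open>P \<noteq> []\<close> show ?case
    by (simp add: algebra_simps)
next
  case (circle P Q j b)
  have l: "link_diagram (P @ Q)"
    using circle(3) circle_run unfolding link_diagram_def run_append_Some by metis
  have "link_diagram ((K @ P) @ [(j, Cup b), (j, Cap)] @ Q)"
    using assms(4) circle(3) by (simp add: link_diagram_def run_append)
  from R_circle[OF this] assms(5)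
  have K: "R ((K @ P) @ [(j, Cup b), (j, Cap)] @ Q) = eta * R (K @ P @ Q)" by simp
  show ?case
  proof (cases "P @ Q = []")
    \<comment> \<open>Here \<open>D\<close> is a round circle with value 1, and the factor
      \<open>eta\<close> is what \<open>R_circle\<close> yields for that circle placed above
      \<open>K\<close>.\<close>
    case True
    have "j = 0" using circle(3) circle_run[of "[]" j b "[]"] True by (simp add: link_diagram_def)
    then show ?thesis using K True R_circle_diagram[of b] by simp
  next
    case False
    then show ?thesis using K R_circle[OF circle(3)] circle(2)[OF l] by (simp add: algebra_simps)
  qed
next
  case (skein P s i u Q)
  have ne: "P \<noteq> []" using skein(1,6) by (cases i) (auto simp: link_diagram_def)
  obtain r where r: "run s [(i, Cross u)] = Some r" "run r Q = Some []"
    using skein(1,6) by (auto simp: link_diagram_def run_append_Some bind_eq_Some_conv)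
  have l0: "link_diagram (P @ smoothing s i @ Q)"
    using skein(1) smoothing_run[OF r(1)] r(2) unfolding link_diagram_def run_append_Some by blast
  have l: "link_diagram (P @ [(i, Cross v)] @ Q)" for v
    using skein(6) run_switch unfolding link_diagram_def by metis
  have Kl: "link_diagram ((K @ P) @ [(i, Cross v)] @ Q)" for v
    using assms(4) l[of v] by (simp add: link_diagram_def run_append)
  have KP: "run [] (K @ P) = Some s" using assms(4) skein(1) by (simp add: link_diagram_def run_append)
  have IH: "R (K @ P @ [(i, Cross (\<not> u))] @ Q) = eta * R K * R (P @ [(i, Cross (\<not> u))] @ Q)"
    "R (K @ P @ smoothing s i @ Q) = eta * R K * R (P @ smoothing s i @ Q)"
    using skein(4)[OF l] skein(5)[OF l0] ne by simp_all
  show ?case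
  proof (cases "positive s i u")
    case True
    have "R (K @ P @ [(i, Cross u)] @ Q) = R (K @ P @ [(i, Cross (\<not> u))] @ Q) + var_w * R (K @ P @ smoothing s i @ Q)"
      using R_skein[OF Kl KP True] by (simp add: algebra_simps)
    moreover have "R (P @ [(i, Cross u)] @ Q) = R (P @ [(i, Cross (\<not> u))] @ Q) + var_w * R (P @ smoothing s i @ Q)"
      using R_skein[OF l skein(1) True] by (simp add: algebra_simps)
    ultimately show ?thesis using IH by (simp add: algebra_simps)
  next
    case False
    then have p: "positive s i (\<not> u)" by (auto simp: positive_def)
    have "R (K @ P @ [(i, Cross u)] @ Q) = R (K @ P @ [(i, Cross (\<not> u))] @ Q) - var_w * R (K @ P @ smoothing s i @ Q)"
      using R_skein[OF Kl KP p] by (simp add: algebra_simps)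
    moreover have "R (P @ [(i, Cross u)] @ Q) = R (P @ [(i, Cross (\<not> u))] @ Q) - var_w * R (P @ smoothing s i @ Q)"
      using R_skein[OF l skein(1) p] by (simp add: algebra_simps)
    ultimately show ?thesis using IH by (simp add: right_diff_distrib mult_ac)
  qed
qed

theorem R_split:
  "link_diagram K \<Longrightarrow> K \<noteq> [] \<Longrightarrow> link_diagram D \<Longrightarrow> D \<noteq> [] \<Longrightarrow> R (K @ D) = eta * R K * R D"
  using R_split_reducible all_reducible by (auto simp: link_diagram_def)

end

section \<open>Coloured diagrams\<close>

text \<open>A coloured strand is a pair of a colour and a direction. A coloured diagram lists every event
  together with the row above it.\<close>

type_synonym 'k row = "('k \<times> bool) list"
type_synonym 'k cdiagram = "((nat \<times> event) \<times> 'k row) list"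

fun clocal :: "event \<Rightarrow> 'k row \<Rightarrow> 'k row \<Rightarrow> bool" where
  "clocal (Cup b) y y' \<longleftrightarrow> y = [] \<and> (\<exists>k. y' = [(k, b), (k, \<not> b)])"
| "clocal Cap y y' \<longleftrightarrow> (\<exists>k b. y = [(k, b), (k, \<not> b)]) \<and> y' = []"
| "clocal (Cross u) y y' \<longleftrightarrow> (\<exists>p q. y = [p, q] \<and> y' = [q, p])"

lemma clocal_length: "clocal e y y' \<Longrightarrow> length y = ins e \<and> length y' = outs e"
  by (cases e) auto

text \<open>A relation and not a function, because a minimum may introduce any colour.\<close>

definition cstep :: "'k row \<Rightarrow> nat \<times> event \<Rightarrow> 'k row \<Rightarrow> bool" where
  "cstep r ie t \<longleftrightarrow> (\<exists>x y y' z. r = x @ y @ z \<and> t = x @ y' @ z \<and> length x = fst ie \<and> clocal (snd ie) y y')"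

lemma cstepE:
  assumes "cstep r (i, e) t"
  obtains x y y' z where "r = x @ y @ z" "t = x @ y' @ z" "length x = i" "clocal e y y'"
  using assms unfolding cstep_def by auto

lemma cstep_block:
  assumes "length y = ins e"
  shows "cstep (x @ y @ z) (length x, e) t \<longleftrightarrow> (\<exists>y'. clocal e y y' \<and> t = x @ y' @ z)"
proof
  assume "cstep (x @ y @ z) (length x, e) t"
  then obtain x1 y1 y' z1 where a: "x @ y @ z = x1 @ y1 @ z1" "t = x1 @ y' @ z1" "length x1 = length x" "clocal e y1 y'"
    unfolding cstep_def by auto
  with assms clocal_length[OF a(4)] have "x1 = x" "y1 = y" "z1 = z" by auto
  with a show "\<exists>y'. clocal e y y' \<and> t = x @ y' @ z" by blast
next
  assume "\<exists>y'. clocal e y y' \<and> t = x @ y' @ z"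
  then show "cstep (x @ y @ z) (length x, e) t" unfolding cstep_def by auto
qed

lemma cstep_lengths: "cstep r (i, e) t \<Longrightarrow> i + ins e \<le> length r \<and> length t + ins e = length r + outs e"
  unfolding cstep_def by (auto dest!: clocal_length)

lemma cstep_zero [simp]:
  "cstep r (0, Cup b) t \<longleftrightarrow> (\<exists>k. t = (k, b) # (k, \<not> b) # r)"
  "cstep (p # q # r) (0, Cap) t \<longleftrightarrow> fst p = fst q \<and> snd p \<noteq> snd q \<and> t = r"
  "cstep (p # q # r) (0, Cross u) t \<longleftrightarrow> t = q # p # r"
  "\<not> cstep [p] (0, Cap) t" "\<not> cstep [p] (0, Cross u) t"
  "\<not> cstep [] (0, Cap) t" "\<not> cstep [] (0, Cross u) t"
  using cstep_block[of "[]" "Cup b" "[]" r t] cstep_block[of "[p, q]" Cap "[]" r t] 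
    cstep_block[of "[p, q]" "Cross u" "[]" r t]
    cstep_lengths[of "[]" 0 Cap t] cstep_lengths[of "[]" 0 "Cross u" t]
    cstep_lengths[of "[p]" 0 Cap t] cstep_lengths[of "[p]" 0 "Cross u" t]
  by (auto simp: prod_eq_iff)

lemma cstep_append_add: "cstep (x @ r) (length x + j, e) t \<longleftrightarrow> (\<exists>t'. t = x @ t' \<and> cstep r (j, e) t')"
proof
  assume "cstep (x @ r) (length x + j, e) t"
  then obtain x1 y y' z where a: "x @ r = x1 @ y @ z" "t = x1 @ y' @ z" "length x1 = length x + j" "clocal e y y'"
    unfolding cstep_def by auto
  from a(1) have "x1 @ (y @ z) = x @ r" by simp
  from append_eq_split[OF a(1)] a(3) obtain v where "x1 = x @ v" "r = v @ y @ z" by auto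
  with a show "\<exists>t'. t = x @ t' \<and> cstep r (j, e) t'" unfolding cstep_def by auto
next
  assume "\<exists>t'. t = x @ t' \<and> cstep r (j, e) t'"
  then obtain x1 y y' z where "t = x @ x1 @ y' @ z" "r = x1 @ y @ z" "length x1 = j" "clocal e y y'"
    unfolding cstep_def by auto
  then show "cstep (x @ r) (length x + j, e) t" unfolding cstep_def
    by (intro exI[of _ "x @ x1"] exI[of _ y] exI[of _ y'] exI[of _ z]) auto
qed

lemma cstep_append_shift [simp]:
  "cstep (x @ r) (length x, e) t \<longleftrightarrow> (\<exists>t'. t = x @ t' \<and> cstep r (0, e) t')"
  "cstep (x @ r) (Suc (length x), e) t \<longleftrightarrow> (\<exists>t'. t = x @ t' \<and> cstep r (Suc 0, e) t')"
  "cstep (x @ r) (Suc (Suc (length x)), e) t \<longleftrightarrow> (\<exists>t'. t = x @ t' \<and> cstep r (Suc (Suc 0), e) t')"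
  using cstep_append_add[of x r 0] cstep_append_add[of x r 1] cstep_append_add[of x r 2]
  by (simp_all add: numeral_2_eq_2)

lemma cstep_Cons [simp]: "cstep (p # r) (Suc j, e) t \<longleftrightarrow> (\<exists>t'. t = p # t' \<and> cstep r (j, e) t')"
  using cstep_append_add[of "[p]" r j] by simp

lemma cstep_end [simp]:
  "cstep r (length r, Cup b) t \<longleftrightarrow> (\<exists>k. t = r @ [(k, b), (k, \<not> b)])"
  "\<not> cstep r (length r, Cap) t" "\<not> cstep r (length r, Cross u) t"
  using cstep_append_add[of r "[]" 0 _ t] by auto

lemma cstep_beyond [simp]: "length r < i \<Longrightarrow> \<not> cstep r (i, e) t"
  by (auto dest!: cstep_lengths)

fun chain :: "'k row \<Rightarrow> 'k cdiagram \<Rightarrow> 'k row \<Rightarrow> bool" where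
  "chain r [] r' \<longleftrightarrow> r = r'"
| "chain r (x # C) r' \<longleftrightarrow> cstep r (fst x) (snd x) \<and> chain (snd x) C r'"

lemma chain_append: "chain r (A @ B) r' \<longleftrightarrow> (\<exists>s. chain r A s \<and> chain s B r')"
  by (induction A arbitrary: r) auto

lemma chain_end_unique: "chain r C r' \<Longrightarrow> chain r C r'' \<Longrightarrow> r' = r''"
  by (induction C arbitrary: r) auto

lemma cstep_step: "cstep r ie t \<Longrightarrow> step (map snd r) ie = Some (map snd t)"
proof -
  assume "cstep r ie t"
  then obtain x y y' z where a: "r = x @ y @ z" "t = x @ y' @ z" "length x = fst ie" "clocal (snd ie) y y'"
    unfolding cstep_def by auto
  have "local_step (snd ie) (map snd y) (map snd y')" using a(4) by (cases "snd ie") auto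
  from step_append[OF this, of "map snd x" "map snd z"] a show ?thesis by (cases ie) simp
qed

lemma chain_run: "chain r C r' \<Longrightarrow> run (map snd r) (map fst C) = Some (map snd r')"
  by (induction C arbitrary: r) (auto simp: cstep_step)

section \<open>Erasing and renaming colours\<close>

definition keep :: "'k set \<Rightarrow> 'k row \<Rightarrow> 'k row" where
  "keep S r = filter (\<lambda>p. fst p \<in> S) r"

lemma keep_simps [simp]:
  "keep S [] = []" "keep S (p # r) = (if fst p \<in> S then p # keep S r else keep S r)"
  "keep S (x @ y) = keep S x @ keep S y"
  by (simp_all add: keep_def)

text \<open>The strands of an event are collected from both rows, which treats the three kinds of
  events alike: a minimum has strands only above it, a maximum only below.\<close>

definition survives :: "'k set \<Rightarrow> 'k row \<Rightarrow> nat \<times> event \<Rightarrow> 'k row \<Rightarrow> bool" where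
  "survives S r ie t \<longleftrightarrow> fst ` set (take (ins (snd ie)) (drop (fst ie) r) @ take (outs (snd ie)) (drop (fst ie) t)) \<subseteq> S"

fun csub :: "'k set \<Rightarrow> 'k row \<Rightarrow> 'k cdiagram \<Rightarrow> 'k cdiagram" where
  "csub S r [] = []"
| "csub S r (x # C) = (if survives S r (fst x) (snd x)
     then [((length (keep S (take (fst (fst x)) r)), snd (fst x)), keep S (snd x))] else []) @ csub S (snd x) C"

abbreviation sub :: "'k set \<Rightarrow> 'k row \<Rightarrow> 'k cdiagram \<Rightarrow> diagram" where
  "sub S r C \<equiv> map fst (csub S r C)"

lemma csub_append: "chain r A s \<Longrightarrow> csub S r (A @ B) = csub S r A @ csub S s B"
  by (induction A arbitrary: r) auto

text \<open>Minima and maxima carry one colour, so they vanish as a whole; an erased crossing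
  retains at most one of its two strands, which then runs straight through.\<close>

lemma clocal_not_kept:
  assumes "clocal e y y'" "\<not> fst ` set (y @ y') \<subseteq> S"
  shows "keep S y = keep S y'"
  using assms by (cases e) (auto split: if_splits)

lemma clocal_kept:
  assumes "fst ` set (y @ y') \<subseteq> S"
  shows "keep S y = y" "keep S y' = y'"
  using assms by (auto simp: keep_def image_subset_iff ball_Un intro!: filter_True)

lemma survives_block:
  "clocal e y y' \<Longrightarrow> survives S (x @ y @ z) (length x, e) (x @ y' @ z) \<longleftrightarrow> fst ` set (y @ y') \<subseteq> S"
  by (frule clocal_length) (simp add: survives_def)

lemma chain_csub: "chain r C r' \<Longrightarrow> chain (keep S r) (csub S r C) (keep S r')"
proof (induction C arbitrary: r)
  case (Cons c C)
  obtain i e t where c: "c = ((i, e), t)" by (metis surj_pair)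
  have "cstep r (i, e) t" using Cons.prems c by simp
  then obtain x y y' z where a: "r = x @ y @ z" "t = x @ y' @ z" "length x = i" "clocal e y y'"
    by (rule cstepE)
  have IH: "chain (keep S t) (csub S t C) (keep S r')" using Cons c by simp
  show ?case
  proof (cases "fst ` set (y @ y') \<subseteq> S")
    case True
    have "survives S r (i, e) t" using survives_block[OF a(4)] True a(1-3) by blast
    moreover have "cstep (keep S r) (length (keep S (take i r)), e) (keep S t)"
      unfolding cstep_def using a clocal_kept[OF True]
      by (intro exI[of _ "keep S x"] exI[of _ y] exI[of _ y'] exI[of _ "keep S z"]) simp
    ultimately show ?thesis using IH by (simp add: c)
  next
    case False
    have "\<not> survives S r (i, e) t" using survives_block[OF a(4)] False a(1-3) by blast
    moreover have "keep S r = keep S t" using clocal_not_kept[OF a(4) False] by (simp add: a)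
    ultimately show ?thesis using IH by (simp add: c)
  qed
qed simp

lemma sub_run: "chain r C r' \<Longrightarrow> run (map snd (keep S r)) (sub S r C) = Some (map snd (keep S r'))"
  by (rule chain_run[OF chain_csub])

definition recolor_row :: "('k \<Rightarrow> 'l) \<Rightarrow> 'k row \<Rightarrow> 'l row" where
  "recolor_row m = map (map_prod m id)"

definition recolor :: "('k \<Rightarrow> 'l) \<Rightarrow> 'k cdiagram \<Rightarrow> 'l cdiagram" where
  "recolor m = map (map_prod id (recolor_row m))"

lemma map_fst_recolor [simp]: "map fst (recolor m C) = map fst C"
  by (simp add: recolor_def o_def)

lemma recolor_append [simp]: "recolor m (A @ B) = recolor m A @ recolor m B"
  by (simp add: recolor_def)

lemma clocal_recolor: "clocal e y y' \<Longrightarrow> clocal e (recolor_row m y) (recolor_row m y')"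
  by (cases e) (auto simp: recolor_row_def)

lemma cstep_recolor: "cstep r ie t \<Longrightarrow> cstep (recolor_row m r) ie (recolor_row m t)"
proof -
  assume "cstep r ie t"
  then obtain x y y' z where a: "r = x @ y @ z" "t = x @ y' @ z" "length x = fst ie" "clocal (snd ie) y y'"
    unfolding cstep_def by auto
  then show ?thesis unfolding cstep_def
    by (intro exI[of _ "recolor_row m x"] exI[of _ "recolor_row m y"] exI[of _ "recolor_row m y'"] exI[of _ "recolor_row m z"])
      (use clocal_recolor[OF a(4)] in \<open>simp add: recolor_row_def\<close>)
qed

lemma chain_recolor: "chain r C r' \<Longrightarrow> chain (recolor_row m r) (recolor m C) (recolor_row m r')"
  by (induction C arbitrary: r) (auto simp: recolor_def cstep_recolor)

lemma keep_recolor: "keep S (recolor_row m r) = recolor_row m (keep (m -` S) r)"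
  by (induction r) (auto simp: recolor_row_def)

lemma length_recolor_row [simp]: "length (recolor_row m r) = length r"
  by (simp add: recolor_row_def)

lemma survives_recolor: "survives S (recolor_row m r) ie (recolor_row m t) \<longleftrightarrow> survives (m -` S) r ie t"
  by (simp add: survives_def recolor_row_def take_map drop_map image_subset_iff ball_Un)

lemma sub_recolor: "sub S (recolor_row m r) (recolor m C) = sub (m -` S) r C"
proof (induction C arbitrary: r)
  case (Cons c C)
  have "take i (recolor_row m r) = recolor_row m (take i r)" for i by (simp add: recolor_row_def take_map)
  then show ?case using Cons by (simp add: recolor_def keep_recolor survives_recolor)
qed (simp add: recolor_def)

definition row_colors :: "'k row \<Rightarrow> 'k set" where
  "row_colors r = fst ` set r"

lemma row_colors_simps [simp]:
  "row_colors [] = {}" "row_colors (p # r) = insert (fst p) (row_colors r)"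
  "row_colors (x @ y) = row_colors x \<union> row_colors y"
  by (auto simp: row_colors_def)

definition colors :: "'k cdiagram \<Rightarrow> 'k set" where
  "colors C = (\<Union>t \<in> snd ` set C. row_colors t)"

lemma colors_simps [simp]:
  "colors [] = {}" "colors (c # C) = row_colors (snd c) \<union> colors C" "colors (A @ B) = colors A \<union> colors B"
  by (auto simp: colors_def)

lemma colors_end: "chain r C r' \<Longrightarrow> row_colors r' \<subseteq> row_colors r \<union> colors C"
proof (induction C arbitrary: r)
  case (Cons c C)
  then have "row_colors r' \<subseteq> row_colors (snd c) \<union> colors C" by simp
  then show ?case by (simp add: le_supI2)
qed simp

lemma step_map_append_shift [simp]:
  "step (map f x @ s) (length x, e) = map_option ((@) (map f x)) (step s (0, e))"
  "step (map f x @ s) (Suc (length x), e) = map_option ((@) (map f x)) (step s (Suc 0, e))"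
  "step (map f x @ s) (Suc (Suc (length x)), e) = map_option ((@) (map f x)) (step s (Suc (Suc 0), e))"
  using step_append_shift[of "map f x" s e] by simp_all

lemma step_map_end [simp]:
  "step (map f x) (length x, Cup b) = Some (map f x @ [b, \<not> b])"
  "step (map f x) (length x, Cap) = None" "step (map f x) (length x, Cross u) = None"
  using step_end[of "map f x"] by simp_all

lemma map_fst_Cons_conv: "map fst C = x # xs \<longleftrightarrow> (\<exists>t C'. C = (x, t) # C' \<and> map fst C' = xs)"
  by (cases C) auto

lemma ex_map_fst [simp]:
  "(\<exists>C. map fst C = [] \<and> P C) \<longleftrightarrow> P []"
  "(\<exists>C. map fst C = x # xs \<and> P C) \<longleftrightarrow> (\<exists>t. \<exists>C. map fst C = xs \<and> P ((x, t) # C))"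
  by (auto simp: map_fst_Cons_conv)

text \<open>In all moves but the exchange, every strand reaches the boundary. Hence the colours inside
  are determined by those on the boundary.\<close>

inductive simple_side :: "nat \<Rightarrow> diagram \<Rightarrow> bool" for i where
  "simple_side i []"
| "simple_side i [(Suc i, Cup b), (i, Cap)]"
| "simple_side i [(i, Cup b), (Suc i, Cap)]"
| "simple_side i [(i, Cross u), (Suc i, Cap)]"
| "simple_side i [(Suc i, Cross u), (i, Cap)]"
| "simple_side i [(i, Cup b), (Suc i, Cross u)]"
| "simple_side i [(Suc i, Cup b), (i, Cross u)]"
| "simple_side i [(i, Cross u), (i, Cross v)]"
| "simple_side i [(i, Cross u), (Suc i, Cross v), (i, Cross x)]"
| "simple_side i [(Suc i, Cross u), (i, Cross v), (Suc i, Cross x)]"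
| "simple_side i [(Suc i, Cup b), (i, Cross u), (Suc i, Cap)]"
| "simple_side i [(i, Cup b), (Suc i, Cross u), (i, Cap)]"

lemma simple_side_colors:
  assumes "simple_side i X" "chain r C r'" "map fst C = X"
  shows "colors C \<subseteq> row_colors r \<union> row_colors r'"
  by (rule at_cases[of r i]; use assms(1) in cases; use assms(2,3) in \<open>auto simp: map_fst_Cons_conv\<close>)

text \<open>Two colourings of the same events combine into one colouring by pairs. Applied to a
  colouring and a competitor, statements about single colourings become comparisons of two; this
  serves for uniqueness here and for the parity argument at smoothings later.\<close>

definition pair_row :: "'k row \<Rightarrow> 'l row \<Rightarrow> ('k \<times> 'l) row" where
  "pair_row r s = map2 (\<lambda>p q. ((fst p, fst q), snd p)) r s"

definition pair_chain :: "'k cdiagram \<Rightarrow> 'l cdiagram \<Rightarrow> ('k \<times> 'l) cdiagram" where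
  "pair_chain C C' = map2 (\<lambda>c d. (fst c, pair_row (snd c) (snd d))) C C'"

lemma pair_row_append:
  "length x = length x' \<Longrightarrow> pair_row (x @ y) (x' @ y') = pair_row x x' @ pair_row y y'"
  by (simp add: pair_row_def)

lemma length_pair_row [simp]: "length (pair_row r s) = min (length r) (length s)"
  by (simp add: pair_row_def)

lemma cstep_pair:
  assumes "cstep r ie t" "cstep s ie u" "map snd r = map snd s"
  shows "cstep (pair_row r s) ie (pair_row t u)" "map snd t = map snd u"
proof -
  show "map snd t = map snd u" using cstep_step[OF assms(1)] cstep_step[OF assms(2)] assms(3) by simp
  obtain i e where ie: "ie = (i, e)" by (cases ie)
  obtain x y y' z where a: "r = x @ y @ z" "t = x @ y' @ z" "length x = i" "clocal e y y'"
    using assms(1) unfolding ie by (rule cstepE)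
  obtain x1 y1 y1' z1 where b: "s = x1 @ y1 @ z1" "u = x1 @ y1' @ z1" "length x1 = i" "clocal e y1 y1'"
    using assms(2) unfolding ie by (rule cstepE)
  have "map snd x = map snd x1 \<and> map snd y = map snd y1 \<and> map snd z = map snd z1"
    using assms(3) a(1,3) b(1,3) clocal_length[OF a(4)] clocal_length[OF b(4)] by simp
  moreover from this have "clocal e (pair_row y y1) (pair_row y' y1')"
    using a(4) b(4) by (cases e) (auto simp: pair_row_def)
  ultimately show "cstep (pair_row r s) ie (pair_row t u)"
    unfolding cstep_def ie using a b clocal_length[OF a(4)] clocal_length[OF b(4)]
    by (intro exI[of _ "pair_row x x1"] exI[of _ "pair_row y y1"] exI[of _ "pair_row y' y1'"] exI[of _ "pair_row z z1"])
      (simp add: pair_row_append)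
qed

lemma chain_pair:
  "chain r C r' \<Longrightarrow> chain s C' s' \<Longrightarrow> map fst C = map fst C' \<Longrightarrow> map snd r = map snd s \<Longrightarrow>
   chain (pair_row r s) (pair_chain C C') (pair_row r' s')"
proof (induction C arbitrary: r s C')
  case Nil
  then show ?case by (simp add: pair_chain_def)
next
  case (Cons c C)
  then obtain c' C'' where C': "C' = c' # C''" "fst c' = fst c" "map fst C = map fst C''" by (cases C') auto
  have "cstep s (fst c) (snd c')" using Cons.prems(2) C' by simp
  with cstep_pair[OF _ this, of r "snd c"] Cons.prems Cons.IH[of "snd c" "snd c'" C''] C'
  show ?case by (simp add: pair_chain_def)
qed

lemma map_fst_pair_chain [simp]: "length C = length C' \<Longrightarrow> map fst (pair_chain C C') = map fst C"
  by (induction C C' rule: list_induct2) (simp_all add: pair_chain_def)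

lemma pair_row_fst: "map snd r = map snd s \<Longrightarrow> recolor_row fst (pair_row r s) = r"
  by (induction r s rule: list_induct2') (auto simp: pair_row_def recolor_row_def)

lemma pair_row_snd: "map snd r = map snd s \<Longrightarrow> recolor_row snd (pair_row r s) = s"
  by (induction r s rule: list_induct2') (auto simp: pair_row_def recolor_row_def)

lemma chain_pair_fst_snd:
  "chain r C r' \<Longrightarrow> chain s C' s' \<Longrightarrow> map fst C = map fst C' \<Longrightarrow> map snd r = map snd s \<Longrightarrow>
   recolor fst (pair_chain C C') = C \<and> recolor snd (pair_chain C C') = C'"
proof (induction C arbitrary: r s C')
  case Nil
  then show ?case by (simp add: pair_chain_def recolor_def)
next
  case (Cons c C)
  then obtain c' C'' where C': "C' = c' # C''" "fst c' = fst c" "map fst C = map fst C''" by (cases C') auto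
  have "cstep s (fst c) (snd c')" using Cons.prems(2) C' by simp
  with cstep_pair(2)[OF _ this, of r "snd c"] Cons.prems have s: "map snd (snd c) = map snd (snd c')" by simp
  with Cons.prems Cons.IH[of "snd c" "snd c'" C''] C' pair_row_fst[OF s] pair_row_snd[OF s]
  show ?case by (cases c; cases c') (simp add: pair_chain_def recolor_def)
qed

lemma recolor_cong: "(\<And>k. k \<in> colors C \<Longrightarrow> m k = n k) \<Longrightarrow> recolor m C = recolor n C"
  by (fastforce simp: recolor_def recolor_row_def colors_def row_colors_def)

lemma row_colors_pair_same: "row_colors (pair_row r r) = (\<lambda>k. (k, k)) ` row_colors r"
  by (induction r) (simp_all add: pair_row_def)

text \<open>In the paired colouring the boundary carries only diagonal colours
  \<open>(k, k)\<close>. By \<open>boundary\<close> no other colours occur inside, so the two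
  projections agree.\<close>

lemma chain_unique:
  assumes boundary: "\<And>r r' (C :: ('k \<times> 'k) cdiagram). chain r C r' \<Longrightarrow> map fst C = X \<Longrightarrow>
      colors C \<subseteq> row_colors r \<union> row_colors r'"
    and "chain r (C :: 'k cdiagram) r'" "map fst C = X" "chain r C' r'" "map fst C' = X"
  shows "C = C'"
proof -
  have e: "map fst C = map fst C'" using assms by simp
  have "chain (pair_row r r) (pair_chain C C') (pair_row r' r')"
    using chain_pair[OF assms(2,4) e refl] .
  moreover have "map fst (pair_chain C C') = X" using map_eq_imp_length_eq[OF e] assms(3) by simp
  ultimately have "colors (pair_chain C C') \<subseteq> row_colors (pair_row r r) \<union> row_colors (pair_row r' r')"
    by (rule boundary)
  then have "recolor fst (pair_chain C C') = recolor snd (pair_chain C C')"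
    by (intro recolor_cong) (auto simp: row_colors_pair_same)
  then show ?thesis using chain_pair_fst_snd[OF assms(2,4) e refl] by simp
qed

section \<open>Transport of colourings through the moves\<close>

inductive simple_move :: "nat \<Rightarrow> diagram \<Rightarrow> diagram \<Rightarrow> bool" for i where
  "simple_move i [(Suc i, Cup b), (i, Cap)] []"
| "simple_move i [(i, Cup b), (Suc i, Cap)] []"
| "simple_move i [(i, Cross u), (Suc i, Cap)] [(Suc i, Cross (\<not> u)), (i, Cap)]"
| "simple_move i [(i, Cup b), (Suc i, Cross u)] [(Suc i, Cup b), (i, Cross (\<not> u))]"
| "simple_move i [(i, Cross u), (i, Cross (\<not> u))] []"
| "u = v \<or> v = x \<Longrightarrow> simple_move i [(i, Cross u), (Suc i, Cross v), (i, Cross x)]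
    [(Suc i, Cross x), (i, Cross v), (Suc i, Cross u)]"
| "simple_move i [(Suc i, Cup b), (i, Cross u), (Suc i, Cap)] []"
| "simple_move i [(i, Cup b), (Suc i, Cross u), (i, Cap)] []"

lemma simple_move_sides: "simple_move i X Y \<Longrightarrow> simple_side i X \<and> simple_side i Y"
  by (erule simple_move.cases) (auto intro: simple_side.intros)

text \<open>The existence of a coloured chain over given events, by recursion on the events, so that
  the simplifier can decide it on rows split by \<open>at_cases\<close>.\<close>

fun chainable :: "diagram \<Rightarrow> 'k row \<Rightarrow> 'k row \<Rightarrow> bool" where
  "chainable [] r r' \<longleftrightarrow> r = r'"
| "chainable (x # X) r r' \<longleftrightarrow> (\<exists>t. cstep r x t \<and> chainable X t r')"

lemma chainable_iff: "chainable X r r' \<longleftrightarrow> (\<exists>C. map fst C = X \<and> chain r C r')"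
proof (induction X arbitrary: r)
  case (Cons x X)
  show ?case unfolding chainable.simps ex_map_fst Cons.IH chain.simps fst_conv snd_conv by iprover
qed simp

lemma ex_pull [simp]:
  "(\<exists>t. (\<exists>t'. t = g t' \<and> A t') \<and> P t) \<longleftrightarrow> (\<exists>t'. A t' \<and> P (g t'))"
  "(\<exists>t. (\<exists>t'. t = g t') \<and> P t) \<longleftrightarrow> (\<exists>t'. P (g t'))"
  by auto

lemma simple_move_transfer:
  assumes "simple_move i X Y" "chainable X r r'"
  shows "chainable Y r r'"
  using assms(1)
proof cases
  case 1
  then show ?thesis using assms(2) by (cases r i rule: at_cases) (simp_all add: prod_eq_iff)
next
  case 2
  then show ?thesis using assms(2) by (cases r i rule: at_cases) (simp_all add: prod_eq_iff)
next
  case 3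
  then show ?thesis using assms(2) by (cases r i rule: at_cases) (simp_all add: prod_eq_iff)
next
  case 4
  then show ?thesis using assms(2) by (cases r i rule: at_cases) (simp_all add: prod_eq_iff)
next
  case 5
  then show ?thesis using assms(2) by (cases r i rule: at_cases) (simp_all add: prod_eq_iff)
next
  case 6
  then show ?thesis using assms(2) by (cases r i rule: at_cases) (simp_all add: prod_eq_iff)
next
  case 7
  then show ?thesis using assms(2) by (cases r i rule: at_cases) (simp_all add: prod_eq_iff)
next
  case 8
  then show ?thesis using assms(2) by (cases r i rule: at_cases) (simp_all add: prod_eq_iff)
qed

text \<open>When \<open>Y\<close> is empty it says nothing about directions; the assumption that
  \<open>X\<close> runs on the directions of \<open>r\<close> makes the inserted zigzag or kink
  fit.\<close>

lemma simple_move_transfer_back: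
  assumes "simple_move i X Y" "chainable Y r r'" "run (map snd r) X = Some t"
  shows "chainable X r r'"
  using assms(1)
proof cases
  case 1
  with assms(2) have "r' = r" by simp
  then show ?thesis using assms(3) 1
    by (cases r i rule: at_cases) (simp_all add: prod_eq_iff split: if_splits)
next
  case 2
  with assms(2) have "r' = r" by simp
  then show ?thesis using assms(3) 2
    by (cases r i rule: at_cases) (simp_all add: prod_eq_iff split: if_splits)
next
  case 3
  then show ?thesis using assms(2) by (cases r i rule: at_cases) (simp_all add: prod_eq_iff)
next
  case 4
  then show ?thesis using assms(2) by (cases r i rule: at_cases) (simp_all add: prod_eq_iff)
next
  case 5
  with assms(2) have "r' = r" by simp
  then show ?thesis using assms(3) 5
    by (cases r i rule: at_cases) (simp_all add: prod_eq_iff split: if_splits)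
next
  case 6
  then show ?thesis using assms(2) by (cases r i rule: at_cases) (simp_all add: prod_eq_iff)
next
  case 7
  with assms(2) have "r' = r" by simp
  then show ?thesis using assms(3) 7
    by (cases r i rule: at_cases) (simp_all add: prod_eq_iff split: if_splits)
next
  case 8
  with assms(2) have "r' = r" by simp
  then show ?thesis using assms(3) 8
    by (cases r i rule: at_cases) (simp_all add: prod_eq_iff split: if_splits)
qed

lemma cstepI: "clocal e y y' \<Longrightarrow> length x = i \<Longrightarrow> cstep (x @ y @ z) (i, e) (x @ y' @ z)"
  unfolding cstep_def by (rule exI[of _ x], rule exI[of _ y], rule exI[of _ y'], rule exI[of _ z]) simp

text \<open>Symmetric in the order of the two events: \<open>v\<close> is the gap between their
  columns, and both orders are chainable exactly under this condition.\<close>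

definition exchanged :: "nat \<Rightarrow> event \<Rightarrow> nat \<Rightarrow> event \<Rightarrow> 'k row \<Rightarrow> 'k row \<Rightarrow> bool" where
  "exchanged i e k f r r' \<longleftrightarrow>
   (\<exists>x y y' v w w' z. r = x @ y @ v @ w @ z \<and> r' = x @ y' @ v @ w' @ z \<and>
      length x = i \<and> length v = k \<and> clocal e y y' \<and> clocal f w w')"

lemma exchangedE:
  assumes "exchanged i e k f r r'"
  obtains x y y' v w w' z where "r = x @ y @ v @ w @ z" "r' = x @ y' @ v @ w' @ z"
      "length x = i" "length v = k" "clocal e y y'" "clocal f w w'"
  using assms unfolding exchanged_def by blast

lemma exchangedI:
  "\<lbrakk>length x = i; length v = k; clocal e y y'; clocal f w w'\<rbrakk> \<Longrightarrow>
    exchanged i e k f (x @ y @ v @ w @ z) (x @ y' @ v @ w' @ z)"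
  unfolding exchanged_def
  by (rule exI[of _ x], rule exI[of _ y], rule exI[of _ y'], rule exI[of _ v], rule exI[of _ w],
      rule exI[of _ w'], rule exI[of _ z]) simp

lemma exchange_chain_lower:
  assumes "cstep r (i, e) t" "cstep t (i + outs e + k, f) r'"
  obtains x y y' v w w' z where "r = x @ y @ v @ w @ z" "t = x @ y' @ v @ w @ z" "r' = x @ y' @ v @ w' @ z"
      "length x = i" "length v = k" "clocal e y y'" "clocal f w w'"
proof -
  obtain x y y' z where 1: "r = x @ y @ z" "t = x @ y' @ z" "length x = i" "clocal e y y'"
    using assms(1) by (rule cstepE)
  obtain x2 w w' z2 where 2: "t = x2 @ w @ z2" "r' = x2 @ w' @ z2" "length x2 = i + outs e + k" "clocal f w w'"
    using assms(2) by (rule cstepE)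
  have l: "length y = ins e" "length y' = outs e" using clocal_length[OF 1(4)] by auto
  have "(x @ y') @ z = x2 @ (w @ z2)" "length (x @ y') \<le> length x2" using 1 2 l by simp_all
  then obtain v where v: "x2 = (x @ y') @ v" "z = v @ w @ z2" "length v = length x2 - length (x @ y')"
    by (rule append_eq_split)
  have "length v = k" using v(3) 1 2 l by simp
  have "r = x @ y @ v @ w @ z2" "t = x @ y' @ v @ w @ z2" by (simp_all only: 1(1,2) v(2) append_assoc)
  moreover have "r' = x @ y' @ v @ w' @ z2" by (simp only: 2(2) v(1) append_assoc)
  ultimately show ?thesis by (rule that[OF _ _ _ 1(3) \<open>length v = k\<close> 1(4) 2(4)])
qed

lemma exchange_chain_upper:
  assumes "cstep r (i + ins e + k, f) t" "cstep t (i, e) r'"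
  obtains x y y' v w w' z where "r = x @ y @ v @ w @ z" "t = x @ y @ v @ w' @ z" "r' = x @ y' @ v @ w' @ z"
      "length x = i" "length v = k" "clocal e y y'" "clocal f w w'"
proof -
  obtain x2 w w' z2 where 1: "r = x2 @ w @ z2" "t = x2 @ w' @ z2" "length x2 = i + ins e + k" "clocal f w w'"
    using assms(1) by (rule cstepE)
  obtain x y y' z where 2: "t = x @ y @ z" "r' = x @ y' @ z" "length x = i" "clocal e y y'"
    using assms(2) by (rule cstepE)
  have l: "length y = ins e" "length y' = outs e" using clocal_length[OF 2(4)] by auto
  have "(x @ y) @ z = x2 @ (w' @ z2)" "length (x @ y) \<le> length x2" using 1 2 l by simp_all
  then obtain v where v: "x2 = (x @ y) @ v" "z = v @ w' @ z2" "length v = length x2 - length (x @ y)"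
    by (rule append_eq_split)
  have "length v = k" using v(3) 1 2 l by simp
  have "r = x @ y @ v @ w @ z2" by (simp only: 1(1) v(1) append_assoc)
  moreover have "t = x @ y @ v @ w' @ z2" "r' = x @ y' @ v @ w' @ z2" by (simp_all only: 2(1,2) v(2) append_assoc)
  ultimately show ?thesis by (rule that[OF _ _ _ 2(3) \<open>length v = k\<close> 2(4) 1(4)])
qed

lemma exchange_chainable: "chainable [(i, e), (i + outs e + k, f)] r r' \<longleftrightarrow> exchanged i e k f r r'"
proof
  assume "chainable [(i, e), (i + outs e + k, f)] r r'"
  then obtain t where "cstep r (i, e) t" "cstep t (i + outs e + k, f) r'" by auto
  then show "exchanged i e k f r r'" by (rule exchange_chain_lower) (simp add: exchangedI)
next
  assume "exchanged i e k f r r'"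
  then obtain x y y' v w w' z where a: "r = x @ y @ v @ w @ z" "r' = x @ y' @ v @ w' @ z"
    "length x = i" "length v = k" "clocal e y y'" "clocal f w w'" by (rule exchangedE)
  have "cstep r (i, e) (x @ y' @ v @ w @ z)" unfolding a(1,2) by (rule cstepI[OF a(5,3)])
  moreover have "cstep ((x @ y' @ v) @ w @ z) (i + outs e + k, f) ((x @ y' @ v) @ w' @ z)"
    by (rule cstepI[OF a(6)]) (use a clocal_length[OF a(5)] in simp)
  ultimately show "chainable [(i, e), (i + outs e + k, f)] r r'" using a(2) by auto
qed

lemma exchange_chainable': "chainable [(i + ins e + k, f), (i, e)] r r' \<longleftrightarrow> exchanged i e k f r r'"
proof
  assume "chainable [(i + ins e + k, f), (i, e)] r r'"
  then obtain t where "cstep r (i + ins e + k, f) t" "cstep t (i, e) r'" by auto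
  then show "exchanged i e k f r r'" by (rule exchange_chain_upper) (simp add: exchangedI)
next
  assume "exchanged i e k f r r'"
  then obtain x y y' v w w' z where a: "r = x @ y @ v @ w @ z" "r' = x @ y' @ v @ w' @ z"
    "length x = i" "length v = k" "clocal e y y'" "clocal f w w'" by (rule exchangedE)
  have "cstep ((x @ y @ v) @ w @ z) (i + ins e + k, f) ((x @ y @ v) @ w' @ z)"
    by (rule cstepI[OF a(6)]) (use a clocal_length[OF a(5)] in simp)
  moreover have "cstep (x @ y @ v @ w' @ z) (i, e) r'" unfolding a(1,2) by (rule cstepI[OF a(5,3)])
  ultimately show "chainable [(i + ins e + k, f), (i, e)] r r'" using a(1) by auto
qed

abbreviation link_move :: "diagram \<Rightarrow> diagram \<Rightarrow> bool" where
  "link_move \<equiv> sup planar_move (sup reidemeister1 (sup reidemeister2 reidemeister3))"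

lemma link_move_cases [consumes 1, case_names exchange simple]:
  assumes "link_move X Y"
  obtains i e k f where "X = [(i, e), (i + outs e + k, f)]" "Y = [(i + ins e + k, f), (i, e)]"
  | i where "simple_move i X Y"
proof -
  have "(\<exists>i e k f. X = [(i, e), (i + outs e + k, f)] \<and> Y = [(i + ins e + k, f), (i, e)]) \<or> (\<exists>i. simple_move i X Y)"
    using assms
  proof (simp, elim disjE)
    assume "planar_move X Y"
    then show ?thesis by cases (auto intro: simple_move.intros)
  next
    assume "reidemeister1 X Y"
    then obtain u i where "kink u i X" "Y = []" by cases auto
    then show ?thesis
    proof cases
      case (loop_right b)
      then show ?thesis using simple_move.intros(7)[of i b u] \<open>Y = []\<close> by auto
    next
      case (loop_left b)
      then show ?thesis using simple_move.intros(8)[of i b u] \<open>Y = []\<close> by auto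
    qed
  next
    assume "reidemeister2 X Y"
    then show ?thesis by cases (auto intro: simple_move.intros)
  next
    assume "reidemeister3 X Y"
    then show ?thesis by cases (auto intro: simple_move.intros)
  qed
  then show thesis using that by blast
qed

lemma link_move_transfer:
  assumes "link_move X Y" "chainable X r r'"
  shows "chainable Y r r'"
  using assms(1)
proof (cases rule: link_move_cases)
  case (exchange i e k f)
  then show ?thesis using assms(2) by (simp only: exchange_chainable exchange_chainable')
next
  case (simple i)
  then show ?thesis using assms(2) by (rule simple_move_transfer)
qed

lemma link_move_transfer_back:
  assumes "link_move X Y" "chainable Y r r'" "run (map snd r) X = Some t"
  shows "chainable X r r'"
  using assms(1)
proof (cases rule: link_move_cases)
  case (exchange i e k f)
  then show ?thesis using assms(2) by (simp only: exchange_chainable exchange_chainable')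
next
  case (simple i)
  then show ?thesis using assms(2,3) by (rule simple_move_transfer_back)
qed

lemma link_move_colors:
  assumes "link_move X Y \<or> link_move Y X" "chain r C r'" "map fst C = X"
  shows "colors C \<subseteq> row_colors r \<union> row_colors r'"
proof -
  have "(\<exists>i. simple_side i X) \<or> (\<exists>i e k f. X = [(i, e), (i + outs e + k, f)]) \<or>
      (\<exists>i e k f. X = [(i + ins e + k, f), (i, e)])"
    using assms(1) by (elim disjE link_move_cases) (blast dest: simple_move_sides)+
  then consider i where "simple_side i X" | i e k f where "X = [(i, e), (i + outs e + k, f)]"
    | i e k f where "X = [(i + ins e + k, f), (i, e)]" by blast
  then show ?thesis
  proof cases
    case 1
    then show ?thesis using simple_side_colors assms(2,3) by blast
  next
    case (2 i e k f)
    then obtain t where C: "C = [((i, e), t), ((i + outs e + k, f), r')]"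
      "cstep r (i, e) t" "cstep t (i + outs e + k, f) r'" using assms(2,3) by (auto simp: map_fst_Cons_conv)
    show ?thesis by (rule exchange_chain_lower[OF C(2,3)]) (auto simp: C(1))
  next
    case (3 i e k f)
    then obtain t where C: "C = [((i + ins e + k, f), t), ((i, e), r')]"
      "cstep r (i + ins e + k, f) t" "cstep t (i, e) r'" using assms(2,3) by (auto simp: map_fst_Cons_conv)
    show ?thesis by (rule exchange_chain_upper[OF C(2,3)]) (auto simp: C(1))
  qed
qed

lemma link_move_unique:
  assumes "link_move X Y \<or> link_move Y X" "chain r C r'" "map fst C = X" "chain r C' r'" "map fst C' = X"
  shows "C = C'"
  using link_move_colors[OF assms(1)] assms(2-5) by (rule chain_unique)

section \<open>Restriction of moves to sublinks\<close>

lemma survives_shift [simp]: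
  "survives S (x @ r) (length x, e) (x @ t) = survives S r (0, e) t"
  "survives S (x @ r) (Suc (length x), e) (x @ t) = survives S r (Suc 0, e) t"
  "survives S (p # r) (Suc j, e) (q # t) = survives S r (j, e) t"
  by (simp_all add: survives_def)

lemma survives_zero [simp]:
  "survives S r (0, Cup b) (p # q # t) \<longleftrightarrow> fst p \<in> S \<and> fst q \<in> S"
  "survives S (p # q # r) (0, Cap) t \<longleftrightarrow> fst p \<in> S \<and> fst q \<in> S"
  "survives S (p # q # r) (0, Cross u) (q # p # r) \<longleftrightarrow> fst p \<in> S \<and> fst q \<in> S"
  by (auto simp: survives_def numeral_2_eq_2)

lemma csub_Cons [simp]:
  "csub S r (((i, e), t) # C) =
    (if survives S r (i, e) t then ((length (keep S (take i r)), e), keep S t) # csub S t C else csub S t C)"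
  by simp

declare csub.simps(2) [simp del]

lemma planar_moves:
  "planar_move [(Suc i, Cup b), (i, Cap)] []"
  "planar_move [(i, Cup b), (Suc i, Cap)] []"
  "planar_move [(i, Cross u), (Suc i, Cap)] [(Suc i, Cross (\<not> u)), (i, Cap)]"
  "planar_move [(i, Cup b), (Suc i, Cross u)] [(Suc i, Cup b), (i, Cross (\<not> u))]"
  using planar_move.intros(2-5)[of i] by simp_all

lemma iso_move_cases [consumes 1, case_names exchange zigzag_right zigzag_left max_through min_through r2 r3]:
  assumes "iso_move X Y"
  obtains i e k f where "X = [(i, e), (i + outs e + k, f)]" "Y = [(i + ins e + k, f), (i, e)]"
  | i b where "X = [(Suc i, Cup b), (i, Cap)]" "Y = []"
  | i b where "X = [(i, Cup b), (Suc i, Cap)]" "Y = []"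
  | i u where "X = [(i, Cross u), (Suc i, Cap)]" "Y = [(Suc i, Cross (\<not> u)), (i, Cap)]"
  | i b u where "X = [(i, Cup b), (Suc i, Cross u)]" "Y = [(Suc i, Cup b), (i, Cross (\<not> u))]"
  | i u where "X = [(i, Cross u), (i, Cross (\<not> u))]" "Y = []"
  | i u v x where "u = v \<or> v = x" "X = [(i, Cross u), (Suc i, Cross v), (i, Cross x)]"
      "Y = [(Suc i, Cross x), (i, Cross v), (Suc i, Cross u)]"
proof -
  from assms have "planar_move X Y \<or> reidemeister2 X Y \<or> reidemeister3 X Y" by simp
  then show thesis
  proof (elim disjE)
    assume "planar_move X Y"
    then show thesis by cases (use that(1-5) in auto)
  next
    assume "reidemeister2 X Y"
    then show thesis by cases (use that(6) in auto)
  next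
    assume "reidemeister3 X Y"
    then show thesis by cases (use that(7) in auto)
  qed
qed

text \<open>If all strands of a move survive, the restriction is a move of the same kind in shifted
  position. As soon as one is erased, the events that remain are literally the same on both
  sides.\<close>

lemma iso_move_sub:
  assumes "iso_move X Y" "chain r C r'" "map fst C = X" "chain r C' r'" "map fst C' = Y"
  shows "sub S r C = sub S r C' \<or> iso_move (sub S r C) (sub S r C')"
  using assms(1)
proof (cases rule: iso_move_cases)
  case (exchange i e k f)
  obtain t where C: "C = [((i, e), t), ((i + outs e + k, f), r')]"
      "cstep r (i, e) t" "cstep t (i + outs e + k, f) r'" using assms(2,3) exchange by (auto simp: map_fst_Cons_conv)
  obtain x y y' v w w' z where a: "r = x @ y @ v @ w @ z" "t = x @ y' @ v @ w @ z" "r' = x @ y' @ v @ w' @ z"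
      "length x = i" "length v = k" "clocal e y y'" "clocal f w w'" by (rule exchange_chain_lower[OF C(2,3)])
  obtain t' where C': "C' = [((i + ins e + k, f), t'), ((i, e), r')]"
      "cstep r (i + ins e + k, f) t'" "cstep t' (i, e) r'" using assms(4,5) exchange by (auto simp: map_fst_Cons_conv)
  have l: "length y = ins e" "length y' = outs e" using clocal_length[OF a(6)] by auto
  \<comment> \<open>The rows at both ends and the block lengths fix the decomposition, so the middle
    row of the other order uses the same blocks.\<close>
  have t': "t' = x @ y @ v @ w' @ z"
  proof -
    obtain x1 y1 y1' v1 w1 w1' z1 where b: "r = x1 @ y1 @ v1 @ w1 @ z1" "t' = x1 @ y1 @ v1 @ w1' @ z1" 
      "r' = x1 @ y1' @ v1 @ w1' @ z1" "length x1 = i" "length v1 = k" "clocal e y1 y1'" "clocal f w1 w1'" 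
      by (rule exchange_chain_upper[OF C'(2,3)])
    have "x1 = x \<and> y1 = y \<and> v1 = v \<and> w1 = w \<and> z1 = z"
      using a(1,4-7) b(1,4-7) clocal_length[OF b(6)] clocal_length[OF a(6)] clocal_length[OF b(7)] clocal_length[OF a(7)]
      by auto
    moreover have "w1' = w'" using a(3,4-7) b(3,4-7) calculation clocal_length[OF b(6)] clocal_length[OF a(6)] by auto
    ultimately show ?thesis using b(2) by simp
  qed
  have s1: "survives S r (i, e) t \<longleftrightarrow> fst ` set (y @ y') \<subseteq> S"
    using survives_block[OF a(6), of S x "v @ w @ z"] a(1,2,4) by simp
  have s2: "survives S t (i + outs e + k, f) r' \<longleftrightarrow> fst ` set (w @ w') \<subseteq> S"
    using survives_block[OF a(7), of S "x @ y' @ v" z] a(2,3,4,5) l by (simp add: add.assoc)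
  have s3: "survives S r (i + ins e + k, f) t' \<longleftrightarrow> fst ` set (w @ w') \<subseteq> S"
    using survives_block[OF a(7), of S "x @ y @ v" z] a(1,4,5) l t' by (simp add: add.assoc)
  have s4: "survives S t' (i, e) r' \<longleftrightarrow> fst ` set (y @ y') \<subseteq> S"
    using survives_block[OF a(6), of S x "v @ w' @ z"] a(3,4) t' by simp
  let ?n = "length (keep S x)"
  have k: "take i r = x" "take i t' = x" "take (i + outs e + k) t = x @ y' @ v" "take (i + ins e + k) r = x @ y @ v"
    using a l t' by simp_all
  show ?thesis
  proof (cases "fst ` set (y @ y') \<subseteq> S")
    case False
    then have "keep S y = keep S y'" by (rule clocal_not_kept[OF a(6)])
    then show ?thesis using False by (simp add: C(1) C'(1) s1 s2 s3 s4 k del: set_append)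
  next
    case True
    then have y: "length (keep S y) = ins e" "length (keep S y') = outs e" using clocal_kept[OF True] l by simp_all
    show ?thesis
    proof (cases "fst ` set (w @ w') \<subseteq> S")
      case False
      then show ?thesis using True by (simp add: C(1) C'(1) s1 s2 s3 s4 k del: set_append)
    next
      case w: True
      have "sub S r C = [(?n, e), (?n + outs e + length (keep S v), f)]"
        using True w y by (simp add: C(1) s1 s2 k del: set_append)
      moreover have "sub S r C' = [(?n + ins e + length (keep S v), f), (?n, e)]"
        using True w y by (simp add: C'(1) s3 s4 k del: set_append)
      ultimately show ?thesis using planar_move.exchange by simp
    qed
  qed
next
  case (zigzag_right i b)
  then show ?thesis using assms(2-5) by (cases r i rule: at_cases) (auto simp: map_fst_Cons_conv planar_moves)
next
  case (zigzag_left i b)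
  obtain t where t: "C = [((i, Cup b), t), ((Suc i, Cap), r')]" "cstep r (i, Cup b) t" "cstep t (Suc i, Cap) r'"
    using assms(2,3) zigzag_left by (auto simp: map_fst_Cons_conv)
  have "i < length r" using cstep_lengths[OF t(2)] cstep_lengths[OF t(3)] by simp
  then obtain x p rs where r: "r = x @ p # rs" "i = length x" using split_nth by blast
  obtain k where k: "t = x @ (k, b) # (k, \<not> b) # p # rs" using t(2) unfolding r by auto
  have "C' = []" using assms(5) zigzag_left by simp
  moreover have "fst p = k" "r' = x @ (k, b) # rs" using t(3) unfolding r k by auto
  ultimately show ?thesis unfolding t(1) k r by (simp add: planar_moves)
next
  case (max_through i u)
  then show ?thesis using assms(2-5) by (cases r i rule: at_cases) (auto simp: map_fst_Cons_conv planar_moves)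
next
  case (min_through i b u)
  show ?thesis
  proof (cases r i rule: at_cases)
    case (one x p)
    have "\<exists>k. C = [((length x, Cup b), x @ [(k, b), (k, \<not> b), p]), ((Suc (length x), Cross u), x @ [(k, b), p, (k, \<not> b)])] \<and>
       C' = [((Suc (length x), Cup b), x @ [p, (k, b), (k, \<not> b)]), ((length x, Cross (\<not> u)), x @ [(k, b), p, (k, \<not> b)])]"
      using assms(2-5) one min_through by (auto simp: map_fst_Cons_conv)
    then show ?thesis using one by (auto simp: planar_moves)
  next
    case (two x p q)
    have "\<exists>k. C = [((length x, Cup b), x @ [(k, b), (k, \<not> b), p, q]), ((Suc (length x), Cross u), x @ [(k, b), p, (k, \<not> b), q])] \<and>
       C' = [((Suc (length x), Cup b), x @ [p, (k, b), (k, \<not> b), q]), ((length x, Cross (\<not> u)), x @ [(k, b), p, (k, \<not> b), q])]"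
      using assms(2-5) two min_through by (auto simp: map_fst_Cons_conv)
    then show ?thesis using two by (auto simp: planar_moves)
  next
    case (more x p q v rs)
    have "\<exists>k. C = [((length x, Cup b), x @ [(k, b), (k, \<not> b), p] @ q # v # rs), ((Suc (length x), Cross u), x @ [(k, b), p, (k, \<not> b)] @ q # v # rs)] \<and>
       C' = [((Suc (length x), Cup b), x @ [p, (k, b), (k, \<not> b)] @ q # v # rs), ((length x, Cross (\<not> u)), x @ [(k, b), p, (k, \<not> b)] @ q # v # rs)]"
      using assms(2-5) more min_through by (auto simp: map_fst_Cons_conv)
    then show ?thesis using more by (auto simp: planar_moves)
  qed (use assms(2-5) min_through in \<open>auto simp: map_fst_Cons_conv\<close>)
next
  case (r2 i u)
  then show ?thesis using assms(2-5)
    by (cases r i rule: at_cases) (auto simp: map_fst_Cons_conv reidemeister2.intros)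
next
  case (r3 i u v x)
  have r3m: "reidemeister3 [(j, Cross u), (Suc j, Cross v), (j, Cross x)] [(Suc j, Cross x), (j, Cross v), (Suc j, Cross u)]" for j
    using reidemeister3.intros[OF r3(1), of j] by simp
  show ?thesis
  proof (cases r i rule: at_cases)
    case (more y p q w rs)
    have "C = [((length y, Cross u), y @ q # p # w # rs), ((Suc (length y), Cross v), y @ q # w # p # rs),
        ((length y, Cross x), y @ w # q # p # rs)]"
      "C' = [((Suc (length y), Cross x), y @ p # w # q # rs), ((length y, Cross v), y @ w # p # q # rs),
        ((Suc (length y), Cross u), y @ w # q # p # rs)]"
      using assms(2-5) more unfolding r3(2,3) by (auto simp: map_fst_Cons_conv)
    then show ?thesis using more by (simp add: r3m)
  qed (use assms(2-5) r3(2,3) in \<open>auto simp: map_fst_Cons_conv\<close>)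
qed

lemma kinks: "kink u i [(Suc i, Cup b), (i, Cross u), (Suc i, Cap)]" "kink u i [(i, Cup b), (Suc i, Cross u), (i, Cap)]"
  using kink.intros[of u i b] by simp_all

text \<open>All strands of a curl have one colour \<open>k\<close>, hence a sublink contains the
  curl entirely or not at all. The order of quantifiers matters: the same \<open>k\<close> serves
  every \<open>S\<close>.\<close>

lemma kink_sub:
  assumes "kink u i X" "chain r C r'" "map fst C = X"
  shows "\<exists>k \<in> row_colors r. \<forall>S. if k \<in> S then (\<exists>j. kink u j (sub S r C)) else sub S r C = []"
  using assms(1)
proof cases
  case (loop_right b)
  obtain t t' where t: "C = [((Suc i, Cup b), t), ((i, Cross u), t'), ((Suc i, Cap), r')]"
    "cstep r (Suc i, Cup b) t" "cstep t (i, Cross u) t'" "cstep t' (Suc i, Cap) r'"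
    using assms(2,3) loop_right by (auto simp: map_fst_Cons_conv)
  have "i < length r" using cstep_lengths[OF t(2)] by simp
  then obtain x p rs where r: "r = x @ p # rs" "i = length x" using split_nth by blast
  obtain k where k: "t = x @ p # (k, b) # (k, \<not> b) # rs" using t(2) unfolding r by auto
  have t': "t' = x @ (k, b) # p # (k, \<not> b) # rs" using t(3) unfolding k r by auto
  have "fst p = k" "r' = x @ (k, b) # rs" using t(4) unfolding r t' by auto
  then show ?thesis unfolding t(1) k t' r by (intro bexI[of _ k]) (auto intro!: exI[of _ "length (keep _ x)"] kinks)
next
  case (loop_left b)
  obtain t t' where t: "C = [((i, Cup b), t), ((Suc i, Cross u), t'), ((i, Cap), r')]"
    "cstep r (i, Cup b) t" "cstep t (Suc i, Cross u) t'" "cstep t' (i, Cap) r'"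
    using assms(2,3) loop_left by (auto simp: map_fst_Cons_conv)
  have "i < length r" using cstep_lengths[OF t(2)] cstep_lengths[OF t(3)] by simp
  then obtain x p rs where r: "r = x @ p # rs" "i = length x" using split_nth by blast
  obtain k where k: "t = x @ (k, b) # (k, \<not> b) # p # rs" using t(2) unfolding r by auto
  have t': "t' = x @ (k, b) # p # (k, \<not> b) # rs" using t(3) unfolding k r by auto
  have "fst p = k" "r' = x @ (k, \<not> b) # rs" using t(4) unfolding r t' by auto
  then show ?thesis unfolding t(1) k t' r by (intro bexI[of _ k]) (auto intro!: exI[of _ "length (keep _ x)"] kinks)
qed

section \<open>Colourings and components\<close>

definition coloring :: "'k cdiagram \<Rightarrow> diagram \<Rightarrow> bool" where
  "coloring C D \<longleftrightarrow> chain [] C [] \<and> map fst C = D"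

text \<open>The empty bottom row is put in front, since a coloured diagram stores only the rows
  above its events; thus the index agrees with that of \<open>strands\<close>.\<close>

definition crow :: "'k cdiagram \<Rightarrow> nat \<Rightarrow> 'k row" where
  "crow C l = ([] # map snd C) ! l"

definition color :: "'k cdiagram \<Rightarrow> nat \<times> nat \<Rightarrow> 'k" where
  "color C x = fst (crow C (fst x) ! snd x)"

lemma chain_iff_nth:
  "chain r C r' \<longleftrightarrow> (\<forall>l < length C. cstep ((r # map snd C) ! l) (fst (C ! l)) (snd (C ! l))) \<and> last (r # map snd C) = r'"
proof (induction C arbitrary: r)
  case (Cons c C)
  show ?case by (simp add: Cons.IH All_less_Suc2)
qed simp

lemma coloring_cstep:
  assumes "coloring C D" "l < length D"
  shows "cstep (crow C l) (D ! l) (crow C (Suc l))"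
proof -
  have "map fst C = D" "length C = length D" using assms(1) by (auto simp: coloring_def)
  then show ?thesis using assms unfolding coloring_def chain_iff_nth crow_def by auto
qed

lemma coloring_length: "coloring C D \<Longrightarrow> length C = length D"
  by (auto simp: coloring_def)

lemma strands_eq:
  assumes "coloring C D" "l \<le> length D"
  shows "strands D l = map snd (crow C l)"
proof -
  have "chain [] (take l C @ drop l C) []" using assms(1) by (simp add: coloring_def)
  then obtain r where r: "chain [] (take l C) r" unfolding chain_append by blast
  have "r = crow C l"
  proof (cases l)
    case (Suc m)
    then have "take l C \<noteq> []" "length C = length D" using assms by (auto simp: coloring_def)
    then have "last ([] # map snd (take l C)) = snd (C ! m)"
      using assms(2) Suc by (simp add: last_map last_conv_nth min_def)
    then show ?thesis using r Suc assms(2) \<open>length C = length D\<close> unfolding chain_iff_nth crow_def by simp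
  qed (use r in \<open>simp add: crow_def\<close>)
  moreover have "map fst (take l C) = take l D" using assms(1) by (auto simp: coloring_def take_map)
  ultimately show ?thesis using chain_run[OF r] by (simp add: strands_def)
qed

lemma points_eq: "coloring C D \<Longrightarrow> points D = {(l, p). l \<le> length D \<and> p < length (crow C l)}"
  by (auto simp: points_def strands_eq)

lemma crow_0 [simp]: "crow C 0 = []"
  by (simp add: crow_def)

lemma crow_Suc: "crow C (Suc l) = map snd C ! l"
  by (simp add: crow_def)

lemma joined_color:
  assumes "coloring C D" "joined D x y"
  shows "color C x = color C y" "x \<in> points D" "y \<in> points D"
proof -
  have "color C x = color C y \<and> x \<in> points D \<and> y \<in> points D"
    using assms(2)
  proof cases
    case (left l i e p)
    have "cstep (crow C l) (i, e) (crow C (Suc l))" using coloring_cstep[OF assms(1) left(3)] left(4) by simp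
    then show ?thesis by (rule cstepE) (use left in \<open>auto simp: color_def points_eq[OF assms(1)] nth_append\<close>)
  next
    case (right l i e p)
    have "cstep (crow C l) (i, e) (crow C (Suc l))" using coloring_cstep[OF assms(1) right(3)] right(4) by simp
    then obtain u y1 y' z where a: "crow C l = u @ y1 @ z" "crow C (Suc l) = u @ y' @ z" "length u = i" "clocal e y1 y'"
      by (rule cstepE)
    have "i + ins e + p < length (crow C l)" using right(3,5) strands_eq[OF assms(1), of l] by simp
    then show ?thesis using a clocal_length[OF a(4)] right
      by (simp add: color_def points_eq[OF assms(1)] nth_append)
  next
    case (cup l i b)
    have "cstep (crow C l) (i, Cup b) (crow C (Suc l))" using coloring_cstep[OF assms(1) cup(3)] cup(4) by simp
    then show ?thesis by (rule cstepE) (use cup in \<open>auto simp: color_def points_eq[OF assms(1)] nth_append\<close>)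
  next
    case (cap l i)
    have "cstep (crow C l) (i, Cap) (crow C (Suc l))" using coloring_cstep[OF assms(1) cap(3)] cap(4) by simp
    then show ?thesis by (rule cstepE) (use cap in \<open>auto simp: color_def points_eq[OF assms(1)] nth_append\<close>)
  next
    case (cross_left l i u)
    have "cstep (crow C l) (i, Cross u) (crow C (Suc l))" using coloring_cstep[OF assms(1) cross_left(3)] cross_left(4) by simp
    then show ?thesis by (rule cstepE) (use cross_left in \<open>auto simp: color_def points_eq[OF assms(1)] nth_append\<close>)
  next
    case (cross_right l i u)
    have "cstep (crow C l) (i, Cross u) (crow C (Suc l))" using coloring_cstep[OF assms(1) cross_right(3)] cross_right(4) by simp
    then show ?thesis by (rule cstepE) (use cross_right in \<open>auto simp: color_def points_eq[OF assms(1)] nth_append\<close>)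
  qed
  then show "color C x = color C y" "x \<in> points D" "y \<in> points D" by auto
qed

lemma same_component_color:
  assumes "coloring C D" "same_component D x y"
  shows "color C x = color C y"
  using assms(2) unfolding same_component_def
  by (induction rule: equivclp_induct) (use joined_color(1)[OF assms(1)] in auto)

lemma coloring_eqI:
  assumes "coloring C D" "coloring C' D" "\<And>x. x \<in> points D \<Longrightarrow> color C x = color C' x"
  shows "C = C'"
proof (rule nth_equalityI)
  show len: "length C = length C'" using coloring_length assms(1,2) by metis
  fix l assume l: "l < length C"
  then have l': "Suc l \<le> length D" using coloring_length[OF assms(1)] by simp
  have s: "map snd (crow C (Suc l)) = map snd (crow C' (Suc l))"
    using strands_eq[OF assms(1) l'] strands_eq[OF assms(2) l'] by simp
  have "crow C (Suc l) = crow C' (Suc l)"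
  proof (rule nth_equalityI)
    show le: "length (crow C (Suc l)) = length (crow C' (Suc l))" using map_eq_imp_length_eq[OF s] .
    fix p assume p: "p < length (crow C (Suc l))"
    have "fst (crow C (Suc l) ! p) = fst (crow C' (Suc l) ! p)"
      using assms(3)[of "(Suc l, p)"] p l' by (simp add: color_def points_eq[OF assms(1)])
    moreover have "snd (crow C (Suc l) ! p) = snd (crow C' (Suc l) ! p)"
      using arg_cong[OF s, of "\<lambda>xs. xs ! p"] p le by simp
    ultimately show "crow C (Suc l) ! p = crow C' (Suc l) ! p" by (rule prod_eqI)
  qed
  then have "snd (C ! l) = snd (C' ! l)" using l len by (simp add: crow_Suc)
  moreover have "fst (C ! l) = fst (C' ! l)"
  proof -
    have "map fst C = map fst C'" using assms(1,2) by (simp add: coloring_def)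
    then have "map fst C ! l = map fst C' ! l" by simp
    then show ?thesis using l len by simp
  qed
  ultimately show "C ! l = C' ! l" by (simp add: prod_eq_iff)
qed

lemma colors_eq: "coloring C D \<Longrightarrow> colors C = color C ` points D"
proof (intro set_eqI iffI)
  fix k assume D: "coloring C D" and "k \<in> colors C"
  then obtain l p where "l < length C" "p < length (snd (C ! l))" "k = fst (snd (C ! l) ! p)"
    unfolding colors_def row_colors_def by (auto simp: in_set_conv_nth)
  then show "k \<in> color C ` points D"
    by (intro image_eqI[of _ _ "(Suc l, p)"]) (auto simp: color_def crow_Suc points_eq[OF D] coloring_length[OF D])
next
  fix k assume D: "coloring C D" and "k \<in> color C ` points D"
  then obtain l p where lp: "l \<le> length D" "p < length (crow C l)" "k = fst (crow C l ! p)"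
    by (auto simp: points_eq color_def)
  then obtain m where m: "l = Suc m" by (cases l) auto
  then have "snd (C ! m) \<in> snd ` set C" "m < length C" using lp(1) coloring_length[OF D] by auto
  moreover have "k \<in> row_colors (snd (C ! m))"
    using lp(2,3) m \<open>m < length C\<close> by (simp add: crow_Suc row_colors_def)
  ultimately show "k \<in> colors C" unfolding colors_def by blast
qed

lemma color_recolor: "coloring C D \<Longrightarrow> x \<in> points D \<Longrightarrow> color (recolor m C) x = m (color C x)"
proof -
  assume a: "coloring C D" "x \<in> points D"
  obtain l p where x: "x = (l, p)" by (cases x)
  with a have lp: "l \<le> length D" "p < length (crow C l)" by (auto simp: points_eq)
  then obtain n where n: "l = Suc n" by (cases l) auto
  then have "n < length C" using lp(1) coloring_length[OF a(1)] by simp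
  then have "crow (recolor m C) l = recolor_row m (crow C l)" by (simp add: n crow_Suc recolor_def)
  then show ?thesis using lp(2) by (simp add: color_def x recolor_row_def)
qed

lemma coloring_recolor: "coloring C D \<Longrightarrow> coloring (recolor m C) D"
  using chain_recolor[of "[]" C "[]" m] by (simp add: coloring_def recolor_row_def)

lemma strands_run:
  assumes "link_diagram D"
  shows "run [] (take l D) = Some (strands D l)"
proof -
  have "run [] (take l D @ drop l D) = Some []" using assms by (simp add: link_diagram_def)
  then obtain r where "run [] (take l D) = Some r" unfolding run_append_Some by blast
  then show ?thesis by (simp add: strands_def)
qed

lemma strands_step:
  assumes "link_diagram D" "l < length D"
  shows "step (strands D l) (D ! l) = Some (strands D (Suc l))"
proof -
  have "run [] (take l D @ [D ! l]) = Some (strands D (Suc l))"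
    using strands_run[OF assms(1), of "Suc l"] assms(2) by (simp add: take_Suc_conv_app_nth)
  then show ?thesis using strands_run[OF assms(1), of l] by (auto simp: run_append_Some)
qed

lemma take_2_drop: "Suc i < length r \<Longrightarrow> take 2 (drop i r) = [r ! i, r ! Suc i]"
  by (simp add: numeral_2_eq_2 take_Suc_conv_app_nth)

text \<open>A function on points that is constant along the strands is the same as a colouring. This
  is the bridge from the relation \<open>joined\<close> to chains of rows.\<close>

lemma coloring_of_function:
  assumes D: "link_diagram D" and c: "\<And>x y. joined D x y \<Longrightarrow> c x = c y"
  obtains C where "coloring C D" "\<And>x. x \<in> points D \<Longrightarrow> color C x = c x"
proof -
  define rw where "rw l = map (\<lambda>p. (c (l, p), strands D l ! p)) [0..<length (strands D l)]" for l
  have len [simp]: "length (rw l) = length (strands D l)" for l by (simp add: rw_def)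
  have nth [simp]: "rw l ! p = (c (l, p), strands D l ! p)" if "p < length (strands D l)" for l p
    using that by (simp add: rw_def)
  have cs: "cstep (rw l) (D ! l) (rw (Suc l))" if l: "l < length D" for l
  proof -
    obtain i e where ie: "D ! l = (i, e)" by (cases "D ! l")
    have "step (strands D l) (i, e) = Some (strands D (Suc l))" using strands_step[OF D l] ie by simp
    then obtain x y y' z where a: "strands D l = x @ y @ z" "strands D (Suc l) = x @ y' @ z" "length x = i"
      "local_step e y y'" by (rule step_SomeE)
    have ly: "length y = ins e" "length y' = outs e" using local_step_length[OF a(4)] by auto
    let ?y = "take (ins e) (drop i (rw l))" and ?y' = "take (outs e) (drop i (rw (Suc l)))"
    \<comment> \<open>Outside the event the two rows agree since \<open>c\<close> is constant along
      the strands running straight up; the right part is shifted by the change in row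
      length.\<close>
    have 1: "take i (rw (Suc l)) = take i (rw l)"
      by (rule nth_equalityI) (use a ly joined.left[OF l ie] in \<open>auto simp: nth_append intro!: c[symmetric]\<close>)
    have 2: "drop (i + outs e) (rw (Suc l)) = drop (i + ins e) (rw l)"
      by (rule nth_equalityI) (use a ly joined.right[OF l ie] in \<open>auto simp: nth_append intro!: c[symmetric]\<close>)
    have 3: "rw l = take i (rw l) @ ?y @ drop (i + ins e) (rw l)"
      by (metis append_take_drop_id drop_drop add.commute)
    have 4: "rw (Suc l) = take i (rw l) @ ?y' @ drop (i + ins e) (rw l)"
      unfolding 1[symmetric] 2[symmetric] by (metis append_take_drop_id drop_drop add.commute)
    have "clocal e ?y ?y'"
    proof (cases e)
      case (Cup b)
      have "?y' = [(c (Suc l, i), b), (c (Suc l, i + 1), \<not> b)]"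
        using take_2_drop[of i "rw (Suc l)"] nth[of i "Suc l"] nth[of "Suc i" "Suc l"] a Cup
        by (auto simp: nth_append)
      moreover have "c (Suc l, i) = c (Suc l, i + 1)" using joined.cup[OF l] ie Cup by (intro c) simp
      ultimately show ?thesis using Cup by simp
    next
      case Cap
      obtain b where b: "y = [b, \<not> b]" using a(4) Cap by auto
      have "?y = [(c (l, i), b), (c (l, i + 1), \<not> b)]"
        using take_2_drop[of i "rw l"] nth[of i l] nth[of "Suc i" l] a b Cap by (auto simp: nth_append)
      moreover have "c (l, i) = c (l, i + 1)" using joined.cap[OF l] ie Cap by (intro c) simp
      ultimately show ?thesis using Cap by simp
    next
      case (Cross u)
      obtain b b' where b: "y = [b, b']" "y' = [b', b]" using a(4) Cross by auto
      have "?y = [(c (l, i), b), (c (l, i + 1), b')]"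
        using take_2_drop[of i "rw l"] nth[of i l] nth[of "Suc i" l] a b Cross by (auto simp: nth_append)
      moreover have "?y' = [(c (Suc l, i), b'), (c (Suc l, i + 1), b)]"
        using take_2_drop[of i "rw (Suc l)"] nth[of i "Suc l"] nth[of "Suc i" "Suc l"] a b Cross
        by (auto simp: nth_append)
      moreover have "c (l, i) = c (Suc l, i + 1)" "c (l, i + 1) = c (Suc l, i)"
        using joined.cross_left[OF l] joined.cross_right[OF l] ie Cross by (auto intro!: c)
      ultimately show ?thesis using Cross by simp
    qed
    moreover have "length (take i (rw l)) = i" using a by simp
    ultimately have "cstep (take i (rw l) @ ?y @ drop (i + ins e) (rw l)) (i, e)
        (take i (rw l) @ ?y' @ drop (i + ins e) (rw l))" by (rule cstepI)
    then show ?thesis using 3 4 ie by simp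
  qed
  define C where "C = map (\<lambda>l. (D ! l, rw (Suc l))) [0..<length D]"
  have lC: "length C = length D" by (simp add: C_def)
  have s0: "rw 0 = []" by (simp add: rw_def strands_def)
  have cr: "([] # map snd C) ! l = rw l" if "l \<le> length D" for l
    using that by (cases l) (simp_all add: C_def s0)
  have "last ([] # map snd C) = rw (length D)"
    using cr[of "length D"] lC by (subst last_conv_nth) simp_all
  also have "\<dots> = []"
    using strands_run[OF D, of "length D"] D by (simp add: rw_def link_diagram_def)
  finally have "chain [] C []" unfolding chain_iff_nth using cs cr lC by (auto simp: C_def)
  moreover have "map fst C = D" by (rule nth_equalityI) (simp_all add: C_def)
  ultimately have C: "coloring C D" by (simp add: coloring_def)
  moreover have "color C x = c x" if "x \<in> points D" for x
    using that cr by (auto simp: points_def color_def crow_def)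
  ultimately show thesis by (rule that)
qed

text \<open>The colours distinguish exactly the components: every colouring with two colours, hence
  every colouring, factors through \<open>C\<close>.\<close>

definition universal :: "'k cdiagram \<Rightarrow> bool" where
  "universal C \<longleftrightarrow> (\<forall>B :: bool cdiagram. coloring B (map fst C) \<longrightarrow> (\<exists>m. B = recolor m C))"

text \<open>Suppose \<open>C'\<close> distinguished two points of equal colour in \<open>C\<close>.
  Then the indicator of one colour of \<open>C'\<close> would be a two-colouring that does not
  factor through \<open>C\<close>. Testing with \<open>bool\<close> keeps \<open>universal\<close>
  free of a quantification over types.\<close>

lemma universal_factor:
  assumes "coloring C D" "universal C" "coloring C' D"
  obtains h where "C' = recolor h C"
proof -
  have D: "map fst C = D" using assms(1) by (simp add: coloring_def)
  have same: "color C' x = color C' y" if xy: "x \<in> points D" "y \<in> points D" "color C x = color C y" for x y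
  proof -
    let ?f = "\<lambda>k. k = color C' x"
    have "coloring (recolor ?f C') D" by (rule coloring_recolor[OF assms(3)])
    then obtain m where m: "recolor ?f C' = recolor m C" using assms(2) D unfolding universal_def by blast
    have "(color C' z = color C' x) = m (color C z)" if "z \<in> points D" for z
      using color_recolor[OF assms(3) that, of ?f] color_recolor[OF assms(1) that, of m] m by simp
    from this[OF xy(1)] this[OF xy(2)] xy(3) show ?thesis by simp
  qed
  define h where "h k = color C' (SOME x. x \<in> points D \<and> color C x = k)" for k
  have "h (color C x) = color C' x" if x: "x \<in> points D" for x
  proof -
    have "\<exists>y. y \<in> points D \<and> color C y = color C x" using x by blast
    from someI_ex[OF this] show ?thesis unfolding h_def using same x by metis
  qed
  then have "C' = recolor h C"
    by (intro coloring_eqI[OF assms(3) coloring_recolor[OF assms(1)]]) (simp add: color_recolor[OF assms(1)])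
  then show thesis by (rule that)
qed

definition component :: "diagram \<Rightarrow> nat \<times> nat \<Rightarrow> (nat \<times> nat) set" where
  "component D x = {y \<in> points D. same_component D x y}"

lemma same_component_equiv:
  "same_component D x x" "same_component D x y \<Longrightarrow> same_component D y x"
  "same_component D x y \<Longrightarrow> same_component D y z \<Longrightarrow> same_component D x z"
  unfolding same_component_def by (auto intro: equivclp_sym equivclp_trans)

lemma component_eq_iff:
  "x \<in> points D \<Longrightarrow> y \<in> points D \<Longrightarrow> component D x = component D y \<longleftrightarrow> same_component D x y"
  unfolding component_def using same_component_equiv by blast

lemma link_components_eq: "link_components D = component D ` points D"
  unfolding link_components_def quotient_def component_def by auto

lemma component_coloring:
  assumes "link_diagram D"
  obtains C where "coloring C D" "universal C" "\<And>x. x \<in> points D \<Longrightarrow> color C x = component D x"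
    "colors C = link_components D"
proof -
  have "component D x = component D y" if "joined D x y" for x y
  proof -
    have "same_component D x y" unfolding same_component_def using that by blast
    then show ?thesis unfolding component_def using same_component_equiv by blast
  qed
  then obtain C where C: "coloring C D" "\<And>x. x \<in> points D \<Longrightarrow> color C x = component D x"
    using coloring_of_function[OF assms] by blast
  moreover have "universal C"
    unfolding universal_def
  proof (intro allI impI)
    fix B :: "bool cdiagram"
    assume "coloring B (map fst C)"
    then have B: "coloring B D" using C(1) by (simp add: coloring_def)
    define m where "m K = (\<exists>x \<in> points D. component D x = K \<and> color B x)" for K
    have "color B x = m (component D x)" if "x \<in> points D" for x
      using that same_component_color[OF B] component_eq_iff unfolding m_def by blast
    then have "B = recolor m C"
      by (intro coloring_eqI[OF B coloring_recolor[OF C(1)]]) (simp add: color_recolor[OF C(1)] C(2))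
    then show "\<exists>m. B = recolor m C" by blast
  qed
  moreover have "colors C = link_components D"
    unfolding colors_eq[OF C(1)] link_components_eq using C(2) by (intro image_cong) auto
  ultimately show thesis by (intro that)
qed

section \<open>Sublinks as restrictions to sets of colours\<close>

lemma card_less_nth: "i \<le> length r \<Longrightarrow> card {p. p < i \<and> P (r ! p)} = length (filter P (take i r))"
proof (induction i)
  case (Suc i)
  have "{p. p < Suc i \<and> P (r ! p)} = {p. p < i \<and> P (r ! p)} \<union> (if P (r ! i) then {i} else {})"
    by (auto simp: less_Suc_eq)
  then show ?case using Suc by (simp add: take_Suc_conv_app_nth)
qed simp

text \<open>The offset \<open>l\<close> and the arbitrary bottom row \<open>r\<close> make the
  induction over the events go through: the levels in \<open>enumerate\<close> and the points in
  \<open>A\<close> are absolute, whereas \<open>sub\<close> proceeds relative to the current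
  row.\<close>

lemma sublink_eq_sub_aux:
  assumes "chain r C r'"
    and "\<And>j p. j \<le> length C \<Longrightarrow> (l + j, p) \<in> A \<longleftrightarrow> p < length ((r # map snd C) ! j) \<and> fst ((r # map snd C) ! j ! p) \<in> S"
  shows "map (\<lambda>(l, i, e). (card {p. p < i \<and> (l, p) \<in> A}, e)) (filter (\<lambda>x. feet x \<subseteq> A) (enumerate l (map fst C))) = sub S r C"
  using assms
proof (induction C arbitrary: l r)
  case (Cons c C)
  obtain i e t where c: "c = ((i, e), t)" by (metis surj_pair)
  have st: "cstep r (i, e) t" and ch: "chain t C r'" using Cons.prems(1) c by auto
  have A0: "(l, p) \<in> A \<longleftrightarrow> p < length r \<and> fst (r ! p) \<in> S" for p using Cons.prems(2)[of 0 p] by simp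
  have A1: "(Suc l, p) \<in> A \<longleftrightarrow> p < length t \<and> fst (t ! p) \<in> S" for p using Cons.prems(2)[of 1 p] c by simp
  have IH: "map (\<lambda>(l, i, e). (card {p. p < i \<and> (l, p) \<in> A}, e)) (filter (\<lambda>x. feet x \<subseteq> A) (enumerate (Suc l) (map fst C))) = sub S t C"
  proof (rule Cons.IH[OF ch])
    fix j p assume "j \<le> length C"
    then show "(Suc l + j, p) \<in> A \<longleftrightarrow> p < length ((t # map snd C) ! j) \<and> fst ((t # map snd C) ! j ! p) \<in> S"
      using Cons.prems(2)[of "Suc j" p] c by simp
  qed
  obtain x y y' z where a: "r = x @ y @ z" "t = x @ y' @ z" "length x = i" "clocal e y y'"
    using st by (rule cstepE)
  have "card {p. p < i \<and> (l, p) \<in> A} = card {p. p < i \<and> fst (r ! p) \<in> S}"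
    using a(1,3) by (intro arg_cong[of _ _ card]) (auto simp: A0)
  also have "\<dots> = length (keep S (take i r))"
    using card_less_nth[of i r "\<lambda>p. fst p \<in> S"] a(1,3) by (simp add: keep_def)
  finally have card: "card {p. p < i \<and> (l, p) \<in> A} = length (keep S (take i r))" .
  have "feet (l, i, e) \<subseteq> A \<longleftrightarrow> survives S r (i, e) t"
  proof -
    have "survives S r (i, e) t \<longleftrightarrow> fst ` set (y @ y') \<subseteq> S"
      using survives_block[OF a(4), of S x z] a by simp
    also have "\<dots> \<longleftrightarrow> feet (l, i, e) \<subseteq> A"
    proof (cases e)
      case (Cup b)
      then show ?thesis using a by (auto simp: A1 nth_append)
    next
      case Cap
      then show ?thesis using a by (auto simp: A0 nth_append)
    next
      case (Cross u)
      then show ?thesis using a by (auto simp: A0 nth_append)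
    qed
    finally show ?thesis by simp
  qed
  then show ?case using IH card by (simp add: c)
qed simp

lemma sublink_eq_sub:
  assumes "coloring C D" "A \<subseteq> points D" "\<And>x. x \<in> points D \<Longrightarrow> x \<in> A \<longleftrightarrow> color C x \<in> S"
  shows "sublink D A = sub S [] C"
proof -
  have D: "map fst C = D" "length C = length D" and ch: "chain [] C []" using assms(1) by (auto simp: coloring_def)
  have "(0 + j, p) \<in> A \<longleftrightarrow> p < length (([] # map snd C) ! j) \<and> fst (([] # map snd C) ! j ! p) \<in> S" if "j \<le> length C" for j p
  proof -
    have "(j, p) \<in> points D \<longleftrightarrow> p < length (crow C j)" using that D(2) by (simp add: points_eq[OF assms(1)])
    then show ?thesis using assms(2) assms(3)[of "(j, p)"] by (auto simp: color_def crow_def)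
  qed
  from sublink_eq_sub_aux[OF ch this] show ?thesis unfolding sublink_def D(1) .
qed

section \<open>Sums over set partitions\<close>

text \<open>The sum over \<open>k\<close> and the sum over partitions into \<open>k\<close> blocks
  are contracted into one sum; \<open>g\<close> carries the dependence on the number of
  blocks.\<close>

definition psum :: "'k set \<Rightarrow> (nat \<Rightarrow> 'r::comm_ring_1) \<Rightarrow> ('k set \<Rightarrow> 'r) \<Rightarrow> 'r" where
  "psum K g w = (\<Sum>\<pi> | partition_on K \<pi>. g (card \<pi>) * (\<Prod>S\<in>\<pi>. w S))"

lemma psum_cong: "(\<And>S. S \<subseteq> K \<Longrightarrow> S \<noteq> {} \<Longrightarrow> w S = w' S) \<Longrightarrow> psum K g w = psum K g w'"
  unfolding psum_def by (intro sum.cong refl arg_cong2[of _ _ _ _ "(*)"] prod.cong) (auto simp: partition_on_def)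

lemma partition_on_image:
  assumes "partition_on A P" "inj_on f A"
  shows "partition_on (f ` A) ((`) f ` P)"
proof -
  have "{} \<notin> (`) f ` P" using partition_onD3[OF assms(1)] by auto
  then show ?thesis using partition_on_inj_image[OF assms] by simp
qed

lemma psum_reindex:
  assumes "inj_on h K"
  shows "psum (h ` K) g w = psum K g (\<lambda>S. w (h ` S))"
proof -
  define h' where "h' = inv_into K h"
  have h': "h' (h k) = k" if "k \<in> K" for k using assms that by (simp add: h'_def)
  have hh: "h' ` h ` S = S" if "S \<subseteq> K" for S
  proof -
    have "(\<lambda>k. h' (h k)) ` S = (\<lambda>k. k) ` S" by (rule image_cong) (use that h' in auto)
    then show ?thesis by (simp only: image_image image_ident)
  qed
  have hh': "h ` h' ` S = S" if "S \<subseteq> h ` K" for S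
  proof -
    have "(\<lambda>k. h (h' k)) ` S = (\<lambda>k. k) ` S"
      by (rule image_cong) (use that in \<open>auto simp: h'_def intro!: f_inv_into_f\<close>)
    then show ?thesis by (simp only: image_image image_ident)
  qed
  have inj': "inj_on h' (h ` K)" by (auto intro!: inj_onI simp: h')
  show ?thesis unfolding psum_def
  proof (rule sum.reindex_bij_witness[where i = "(`) ((`) h)" and j = "(`) ((`) h')"])
    fix P assume "P \<in> {P. partition_on (h ` K) P}"
    then have P: "partition_on (h ` K) P" by simp
    have sub: "S \<subseteq> h ` K" if "S \<in> P" for S using that partition_onD1[OF P] by auto
    have "partition_on (h' ` h ` K) ((`) h' ` P)" by (rule partition_on_image[OF P inj'])
    then show "(`) h' ` P \<in> {P. partition_on K P}" using hh[of K] by simp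
    show "(`) h ` (`) h' ` P = P"
      using image_cong[of P P "\<lambda>S. h ` h' ` S" "\<lambda>S. S"] hh' sub by (simp only: image_image image_ident)
    have inj: "inj_on ((`) h') P" by (rule inj_onI) (metis hh' sub)
    show "g (card ((`) h' ` P)) * (\<Prod>S\<in>(`) h' ` P. w (h ` S)) = g (card P) * prod w P"
      using hh' sub by (simp add: card_image[OF inj] prod.reindex[OF inj] cong: prod.cong)
  next
    fix P assume "P \<in> {P. partition_on K P}"
    then have P: "partition_on K P" by simp
    have sub: "S \<subseteq> K" if "S \<in> P" for S using that partition_onD1[OF P] by auto
    show "(`) h ` P \<in> {P. partition_on (h ` K) P}" using partition_on_image[OF P assms] by simp
    show "(`) h' ` (`) h ` P = P"
      using image_cong[of P P "\<lambda>S. h' ` h ` S" "\<lambda>S. S"] hh sub by (simp only: image_image image_ident)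
  qed
qed

text \<open>Deleting \<open>y\<close> from the block shared with \<open>x\<close> is a bijection
  onto the partitions of \<open>K - {y}\<close>, with inverse \<open>f\<close>. It preserves the
  number of blocks, so the weights \<open>g\<close> need no adjustment.\<close>

lemma psum_merge:
  assumes "x \<in> K" "y \<in> K" "x \<noteq> y"
  shows "(\<Sum>\<pi> | partition_on K \<pi> \<and> (\<exists>S\<in>\<pi>. x \<in> S \<and> y \<in> S). g (card \<pi>) * (\<Prod>S\<in>\<pi>. w S)) =
    psum (K - {y}) g (\<lambda>S. w (if x \<in> S then insert y S else S))"
proof -
  define f where "f S = (if x \<in> S then insert y S else S)" for S
  define d where "d S = S - {y}" for S
  show ?thesis unfolding psum_def f_def[symmetric]
  proof (rule sum.reindex_bij_witness[where i = "(`) f" and j = "(`) d"])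
    fix P assume "P \<in> {P. partition_on K P \<and> (\<exists>S\<in>P. x \<in> S \<and> y \<in> S)}"
    then have P: "partition_on K P" and ex: "\<exists>S\<in>P. x \<in> S \<and> y \<in> S" by auto
    have iff: "x \<in> S \<longleftrightarrow> y \<in> S" if "S \<in> P" for S
    proof -
      from ex obtain T where T: "T \<in> P" "x \<in> T" "y \<in> T" by blast
      have "S = T" if "x \<in> S \<or> y \<in> S" using that T \<open>S \<in> P\<close> partition_onD2[OF P] by (auto simp: disjoint_def)
      then show ?thesis using T by blast
    qed
    have fd: "f (d S) = S" if "S \<in> P" for S using iff[OF that] assms(3) by (auto simp: f_def d_def)
    have inj: "inj_on d P" by (rule inj_onI) (metis fd)
    show "(`) f ((`) d P) = P" using fd by force
    have "partition_on (K - {y}) (d ` P)"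
    proof (rule partition_onI)
      show "\<Union> (d ` P) = K - {y}" using partition_onD1[OF P] by (auto simp: d_def)
      show "disjnt p q" if pq: "p \<in> d ` P" "q \<in> d ` P" "p \<noteq> q" for p q
      proof -
        obtain p' q' where "p = d p'" "p' \<in> P" "q = d q'" "q' \<in> P" using pq by blast
        then show ?thesis using pq(3) partition_onD2[OF P] by (auto simp: d_def disjnt_def disjoint_def)
      qed
      show "{} \<notin> d ` P"
      proof
        assume "{} \<in> d ` P"
        then obtain S where S: "S \<in> P" "S \<subseteq> {y}" by (auto simp: d_def)
        then have "S \<noteq> {}" using partition_onD3[OF P] by auto
        then have "S = {y}" using S(2) by auto
        then show False using iff[OF S(1)] assms(3) by auto
      qed
    qed
    then show "d ` P \<in> {P. partition_on (K - {y}) P}" by simp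
    show "g (card (d ` P)) * (\<Prod>S\<in>d ` P. w (f S)) = g (card P) * prod w P"
      using fd by (simp add: card_image[OF inj] prod.reindex[OF inj] cong: prod.cong)
  next
    fix P assume "P \<in> {P. partition_on (K - {y}) P}"
    then have P: "partition_on (K - {y}) P" by simp
    have ny: "y \<notin> S" if "S \<in> P" for S using that partition_onD1[OF P] by auto
    have df: "d (f S) = S" if "S \<in> P" for S using ny[OF that] by (auto simp: f_def d_def)
    show "(`) d ((`) f P) = P" using df by force
    have "x \<in> \<Union> P" using partition_onD1[OF P] assms by auto
    then obtain T where T: "T \<in> P" "x \<in> T" by blast
    have "partition_on K (f ` P)"
    proof (rule partition_onI)
      show "\<Union> (f ` P) = K"
      proof
        show "\<Union> (f ` P) \<subseteq> K" using partition_onD1[OF P] assms(2) by (auto simp: f_def split: if_splits)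
        have "y \<in> f T" using T by (simp add: f_def)
        moreover have "z \<in> \<Union> (f ` P)" if "z \<in> K - {y}" for z
          using that partition_onD1[OF P] by (auto simp: f_def)
        ultimately show "K \<subseteq> \<Union> (f ` P)" using T(1) by blast
      qed
      show "disjnt p q" if pq: "p \<in> f ` P" "q \<in> f ` P" "p \<noteq> q" for p q
      proof -
        obtain p' q' where p': "p = f p'" "p' \<in> P" "q = f q'" "q' \<in> P" using pq by blast
        then have "p' \<noteq> q'" using pq(3) by auto
        then have "p' \<inter> q' = {}" using p' partition_onD2[OF P] by (auto simp: disjoint_def)
        then show ?thesis using p' ny by (auto simp: f_def disjnt_def)
      qed
      show "{} \<notin> f ` P" using partition_onD3[OF P] by (auto simp: f_def)
    qed
    moreover have "x \<in> f T \<and> y \<in> f T" using T by (simp add: f_def)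
    ultimately show "f ` P \<in> {P. partition_on K P \<and> (\<exists>S\<in>P. x \<in> S \<and> y \<in> S)}" using T(1) by blast
  qed
qed

text \<open>The recursion behind the Stirling numbers of the second kind: the new element is a block
  of its own or joins one of the \<open>card \<pi>\<close> existing blocks.\<close>

lemma sum_partitions_insert:
  assumes "finite K" "x \<notin> K"
  shows "(\<Sum>\<pi> | partition_on (insert x K) \<pi>. G (card \<pi>)) =
    (\<Sum>\<pi> | partition_on K \<pi>. G (Suc (card \<pi>)) + of_nat (card \<pi>) * (G (card \<pi>) :: 'r::comm_ring_1))"
proof -
  let ?P = "{\<pi>. partition_on (insert x K) \<pi>}"
  have fin: "finite ?P" using assms(1) by (intro finitely_many_partition_on) simp
  have finb: "finite \<pi>" if "partition_on K \<pi>" for \<pi> using that assms(1) by (rule finite_elements[rotated])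
  have "(\<Sum>\<pi>\<in>?P. G (card \<pi>)) = (\<Sum>\<pi>\<in>{\<pi>\<in>?P. {x} \<in> \<pi>}. G (card \<pi>)) + (\<Sum>\<pi>\<in>{\<pi>\<in>?P. {x} \<notin> \<pi>}. G (card \<pi>))"
  proof -
    have "?P = {\<pi>\<in>?P. {x} \<in> \<pi>} \<union> {\<pi>\<in>?P. {x} \<notin> \<pi>}" by blast
    then have "(\<Sum>\<pi>\<in>?P. G (card \<pi>)) = (\<Sum>\<pi>\<in>{\<pi>\<in>?P. {x} \<in> \<pi>} \<union> {\<pi>\<in>?P. {x} \<notin> \<pi>}. G (card \<pi>))"
      by (rule arg_cong[where f = "sum (\<lambda>\<pi>. G (card \<pi>))"])
    also have "\<dots> = (\<Sum>\<pi>\<in>{\<pi>\<in>?P. {x} \<in> \<pi>}. G (card \<pi>)) + (\<Sum>\<pi>\<in>{\<pi>\<in>?P. {x} \<notin> \<pi>}. G (card \<pi>))"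
      by (rule sum.union_disjoint) (use fin in auto)
    finally show ?thesis .
  qed
  also have "(\<Sum>\<pi>\<in>{\<pi>\<in>?P. {x} \<in> \<pi>}. G (card \<pi>)) = (\<Sum>\<pi> | partition_on K \<pi>. G (Suc (card \<pi>)))"
  proof (rule sum.reindex_bij_witness[where i = "insert {x}" and j = "\<lambda>\<pi>. \<pi> - {{x}}"])
    fix P assume "P \<in> {P \<in> ?P. {x} \<in> P}"
    then have P: "partition_on (insert x K) P" "{x} \<in> P" by auto
    then show "insert {x} (P - {{x}}) = P" by auto
    have "S \<inter> {x} = {}" if "S \<in> P - {{x}}" for S
      by (rule disjointD[OF partition_onD2[OF P(1)]]) (use that P(2) in auto)
    then have "disjnt {x} (\<Union> (P - {{x}}))" unfolding disjnt_def by blast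
    from partition_on_insert[OF this, of "insert x K"] P assms(2)
    have "partition_on K (P - {{x}})" by (simp add: insert_absorb)
    then show "P - {{x}} \<in> {P. partition_on K P}" by simp
    have "finite P" using assms(1) by (intro finite_elements[OF _ P(1)]) simp
    from card.remove[OF this P(2)] show "G (Suc (card (P - {{x}}))) = G (card P)" by (simp only:)
  next
    fix P assume "P \<in> {P. partition_on K P}"
    then have P: "partition_on K P" by simp
    have nx: "x \<notin> \<Union> P" using partition_onD1[OF P] assms(2) by simp
    then show "insert {x} P - {{x}} = P" by auto
    have "partition_on (insert x K) (insert {x} P)"
      using partition_on_insert[of "{x}" P "insert x K"] nx P assms(2) by (simp add: disjnt_def)
    then show "insert {x} P \<in> {P \<in> ?P. {x} \<in> P}" by simp
  qed
  \<comment> \<open>A partition in which \<open>x\<close> is not alone is encoded as the partition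
    of \<open>K\<close> left after deleting \<open>x\<close>, together with the block
    \<open>B\<close> that \<open>x\<close> had joined; the union extracts the unique block
    containing \<open>x\<close>.\<close>
  also have "(\<Sum>\<pi>\<in>{\<pi>\<in>?P. {x} \<notin> \<pi>}. G (card \<pi>)) = (\<Sum>(\<pi>, B) \<in> Sigma {\<pi>. partition_on K \<pi>} (\<lambda>\<pi>. \<pi>). G (card \<pi>))"
  proof (rule sum.reindex_bij_witness[where i = "\<lambda>(\<pi>, B). insert (insert x B) (\<pi> - {B})"
        and j = "\<lambda>\<pi>. ((\<lambda>S. S - {x}) ` \<pi>, \<Union>{S \<in> \<pi>. x \<in> S} - {x})"])
    fix P assume "P \<in> {P \<in> ?P. {x} \<notin> P}"
    then have P: "partition_on (insert x K) P" "{x} \<notin> P" by auto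
    have "x \<in> \<Union> P" using partition_onD1[OF P(1)] by blast
    then obtain T where T: "T \<in> P" "x \<in> T" by blast
    have only: "S = T" if "S \<in> P" "x \<in> S" for S using that T partition_onD2[OF P(1)] by (auto simp: disjoint_def)
    have "{S \<in> P. x \<in> S} = {T}"
    proof (intro set_eqI iffI)
      fix S assume "S \<in> {S \<in> P. x \<in> S}"
      then show "S \<in> {T}" using only[of S] by simp
    qed (use T in simp)
    then have U: "\<Union>{S \<in> P. x \<in> S} = T" by simp
    have im: "(\<lambda>S. S - {x}) ` P = insert (T - {x}) (P - {T})"
    proof -
      have "(\<lambda>S. S - {x}) ` (P - {T}) = (\<lambda>S. S) ` (P - {T})"
      proof (rule image_cong)
        fix S assume "S \<in> P - {T}"
        then have "x \<notin> S" using only[of S] by auto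
        then show "S - {x} = S" by simp
      qed simp
      moreover have "P = insert T (P - {T})" using T(1) by blast
      ultimately show ?thesis by (metis image_ident image_insert)
    qed
    have Tn: "T - {x} \<noteq> {}"
    proof
      assume "T - {x} = {}"
      then have "T = {x}" using T(2) by blast
      then show False using T(1) P(2) by simp
    qed
    have nin: "T - {x} \<notin> P - {T}"
    proof
      assume "T - {x} \<in> P - {T}"
      then have "(T - {x}) \<inter> T = {}" using T(1) partition_onD2[OF P(1)] by (auto simp: disjoint_def)
      then show False using Tn by blast
    qed
    have TT: "insert x (T - {x}) = T" using T(2) by blast
    show "(case ((\<lambda>S. S - {x}) ` P, \<Union>{S \<in> P. x \<in> S} - {x}) of (\<pi>, B) \<Rightarrow> insert (insert x B) (\<pi> - {B})) = P"
      unfolding U im using nin T by (simp add: TT insert_absorb)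
    have "partition_on K (insert (T - {x}) (P - {T}))"
    proof (rule partition_onI)
      show "\<Union> (insert (T - {x}) (P - {T})) = K"
      proof -
        have "\<Union> (P - {T}) \<union> T = insert x K" using partition_onD1[OF P(1)] T(1) by blast
        moreover have "x \<notin> \<Union> (P - {T})"
        proof
          assume "x \<in> \<Union> (P - {T})"
          then obtain S where "S \<in> P" "S \<noteq> T" "x \<in> S" by blast
          then show False using only[of S] by simp
        qed
        moreover have "\<Union> (insert (T - {x}) (P - {T})) = (\<Union> (P - {T}) \<union> T) - {x}"
          using calculation(2) by blast
        ultimately show ?thesis using assms(2) by simp
      qed
      show "{} \<notin> insert (T - {x}) (P - {T})" using Tn partition_onD3[OF P(1)] by simp
      show "disjnt p q" if "p \<in> insert (T - {x}) (P - {T})" "q \<in> insert (T - {x}) (P - {T})" "p \<noteq> q" for p q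
        using that partition_onD2[OF P(1)] T(1) by (auto simp: disjoint_def disjnt_def)
    qed
    then show "((\<lambda>S. S - {x}) ` P, \<Union>{S \<in> P. x \<in> S} - {x}) \<in> Sigma {\<pi>. partition_on K \<pi>} (\<lambda>\<pi>. \<pi>)"
      unfolding U im by simp
    have "finite P" using assms(1) by (intro finite_elements[OF _ P(1)]) simp
    then have "card (insert (T - {x}) (P - {T})) = Suc (card (P - {T}))" using nin by simp
    also have "\<dots> = card P" using card.remove[OF \<open>finite P\<close> T(1)] by (simp only:)
    finally have "card (insert (T - {x}) (P - {T})) = card P" .
    then show "(case ((\<lambda>S. S - {x}) ` P, \<Union>{S \<in> P. x \<in> S} - {x}) of (\<pi>, B) \<Rightarrow> G (card \<pi>)) = G (card P)"
      unfolding im by simp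
  next
    fix b assume b: "b \<in> Sigma {\<pi>. partition_on K \<pi>} (\<lambda>\<pi>. \<pi>)"
    obtain P B where PB: "b = (P, B)" by (cases b)
    then have P: "partition_on K P" "B \<in> P" using b by auto
    have nx: "x \<notin> S" if "S \<in> P" for S using that partition_onD1[OF P(1)] assms(2) by auto
    let ?i = "insert (insert x B) (P - {B})"
    have im: "(\<lambda>S. S - {x}) ` ?i = P"
    proof -
      have "(\<lambda>S. S - {x}) ` (P - {B}) = P - {B}" using nx by force
      then show ?thesis using P(2) nx[OF P(2)] by auto
    qed
    have U: "\<Union>{S \<in> ?i. x \<in> S} = insert x B"
    proof -
      have "{S \<in> ?i. x \<in> S} = {insert x B}" using nx by auto
      then show ?thesis by simp
    qed
    show "((\<lambda>S. S - {x}) ` (case b of (\<pi>, B) \<Rightarrow> insert (insert x B) (\<pi> - {B})),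
          \<Union>{S \<in> (case b of (\<pi>, B) \<Rightarrow> insert (insert x B) (\<pi> - {B})). x \<in> S} - {x}) = b"
      unfolding PB prod.case im U using nx[OF P(2)] by simp
    have "partition_on (insert x K) ?i"
    proof (rule partition_onI)
      show "\<Union> ?i = insert x K" using partition_onD1[OF P(1)] P(2) by auto
      show "{} \<notin> ?i" using partition_onD3[OF P(1)] by simp
      show "disjnt p q" if "p \<in> ?i" "q \<in> ?i" "p \<noteq> q" for p q
        using that partition_onD2[OF P(1)] P(2) nx by (auto simp: disjoint_def disjnt_def)
    qed
    moreover have "{x} \<notin> ?i"
    proof
      assume "{x} \<in> ?i"
      then have "insert x B = {x}" using nx by auto
      then have "B = {}" using nx[OF P(2)] by blast
      then show False using P partition_onD3 by blast
    qed
    ultimately show "(case b of (\<pi>, B) \<Rightarrow> insert (insert x B) (\<pi> - {B})) \<in> {P \<in> ?P. {x} \<notin> P}"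
      unfolding PB by simp
  qed
  also have "\<dots> = (\<Sum>\<pi> | partition_on K \<pi>. of_nat (card \<pi>) * G (card \<pi>))"
    using finb finitely_many_partition_on[OF assms(1)] by (subst sum.Sigma[symmetric]) auto
  finally show ?thesis by (simp only: sum.distrib)
qed

lemma partition_on_card_pos:
  assumes "finite K" "K \<noteq> {}" "partition_on K \<pi>"
  shows "1 \<le> card \<pi>" "card \<pi> \<le> card K"
proof -
  have f: "finite \<pi>" using assms finite_elements by blast
  have "\<pi> \<noteq> {}" using assms partition_onD1 by blast
  then show "1 \<le> card \<pi>" using f by (simp add: card_gt_0_iff Suc_leI)
  have "(\<Sum>S\<in>\<pi>. 1) \<le> (\<Sum>S\<in>\<pi>. card S)"
  proof (rule sum_mono)
    fix S assume "S \<in> \<pi>"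
    then have "S \<subseteq> K" "S \<noteq> {}" using partition_onD1[OF assms(3)] partition_onD3[OF assms(3)] by auto
    moreover from this have "finite S" using assms(1) finite_subset by blast
    ultimately show "1 \<le> card S" by (simp add: card_gt_0_iff Suc_leI)
  qed
  also have "\<dots> = card K"
    using product_partition[OF assms(3)] assms(1) partition_onD1[OF assms(3)] by (metis Sup_upper finite_subset)
  finally show "card \<pi> \<le> card K" by simp
qed

lemma Ehat_Suc: "1 \<le> k \<Longrightarrow> Ehat (Suc k) = Ehat k * (Ehat_inv - of_nat k)"
  by (simp add: Ehat_def prod.atLeastLessThan_Suc)

text \<open>With \<open>X = Ehat_inv\<close>, the product \<open>X * Ehat k\<close> is the falling
  factorial of \<open>X\<close> of length \<open>k\<close>. The claim is the classical expansion of
  a power of \<open>X\<close> in falling factorials, divided by \<open>X\<close>. One more element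
  contributes the factor \<open>X\<close>, since
  \<open>Ehat (k + 1) + k * Ehat k = X * Ehat k\<close>.\<close>

lemma sum_Ehat:
  assumes "finite K" "K \<noteq> {}"
  shows "(\<Sum>\<pi> | partition_on K \<pi>. Ehat (card \<pi>)) = Ehat_inv ^ (card K - 1)"
  using assms
proof (induction K rule: finite_ne_induct)
  case (singleton x)
  have "{\<pi>. partition_on {x} \<pi>} = {{{x}}}"
  proof (intro set_eqI iffI)
    fix \<pi> assume "\<pi> \<in> {\<pi>. partition_on {x} \<pi>}"
    then have P: "partition_on {x} \<pi>" by simp
    then have "S = {x}" if "S \<in> \<pi>" for S
      using that partition_onD1[OF P] partition_onD3[OF P] by (metis Sup_upper subset_singletonD)
    moreover have "\<pi> \<noteq> {}" using partition_onD1[OF P] by auto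
    ultimately show "\<pi> \<in> {{{x}}}" by auto
  qed (simp add: partition_on_space)
  then show ?case by (simp add: Ehat_def)
next
  case (insert x K)
  have "(\<Sum>\<pi> | partition_on (insert x K) \<pi>. Ehat (card \<pi>)) =
      (\<Sum>\<pi> | partition_on K \<pi>. Ehat (Suc (card \<pi>)) + of_nat (card \<pi>) * Ehat (card \<pi>))"
    using insert.hyps by (intro sum_partitions_insert)
  also have "\<dots> = (\<Sum>\<pi> | partition_on K \<pi>. Ehat_inv * Ehat (card \<pi>))"
  proof (rule sum.cong[OF refl])
    fix \<pi> assume "\<pi> \<in> {\<pi>. partition_on K \<pi>}"
    then have "1 \<le> card \<pi>" using partition_on_card_pos insert.hyps by blast
    then show "Ehat (Suc (card \<pi>)) + of_nat (card \<pi>) * Ehat (card \<pi>) = Ehat_inv * Ehat (card \<pi>)"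
      by (simp add: Ehat_Suc algebra_simps)
  qed
  also have "\<dots> = Ehat_inv * Ehat_inv ^ (card K - 1)" using insert.IH by (simp add: sum_distrib_left[symmetric])
  also have "\<dots> = Ehat_inv ^ (card (insert x K) - 1)"
    using insert.hyps by (simp add: power_Suc[symmetric] card_gt_0_iff del: power_Suc)
  finally show ?case .
qed

section \<open>The formula in terms of colourings\<close>

lemma finite_colors: "finite (colors C)"
  by (simp add: colors_def row_colors_def)

lemma keep_cong: "(\<And>k. k \<in> row_colors r \<Longrightarrow> k \<in> S \<longleftrightarrow> k \<in> S') \<Longrightarrow> keep S r = keep S' r"
  unfolding keep_def by (rule filter_cong) (auto simp: row_colors_def)

lemma row_colors_take: "row_colors (take i r) \<subseteq> row_colors r"
  unfolding row_colors_def by (intro image_mono set_take_subset)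

lemma csub_cong:
  "(\<And>k. k \<in> row_colors r \<union> colors C \<Longrightarrow> k \<in> S \<longleftrightarrow> k \<in> S') \<Longrightarrow> csub S r C = csub S' r C"
proof (induction C arbitrary: r)
  case (Cons c C)
  obtain i e t where c: "c = ((i, e), t)" by (metis surj_pair)
  have rt: "k \<in> S \<longleftrightarrow> k \<in> S'" if "k \<in> row_colors r \<union> row_colors t" for k using Cons.prems that c by auto
  have "csub S t C = csub S' t C" by (rule Cons.IH) (use Cons.prems c in auto)
  moreover have "keep S t = keep S' t" by (rule keep_cong) (use rt in auto)
  moreover have "keep S (take i r) = keep S' (take i r)" 
    by (rule keep_cong) (use rt row_colors_take[of i r] in auto)
  moreover have "survives S r (i, e) t = survives S' r (i, e) t"
  proof -
    have "fst x \<in> row_colors r \<union> row_colors t"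
      if "x \<in> set (take (ins e) (drop i r) @ take (outs e) (drop i t))" for x
      using that by (auto simp: row_colors_def dest!: in_set_takeD in_set_dropD)
    then have "fst x \<in> S \<longleftrightarrow> fst x \<in> S'"
      if "x \<in> set (take (ins e) (drop i r) @ take (outs e) (drop i t))" for x
      using that rt by blast
    then show ?thesis unfolding survives_def image_subset_iff fst_conv snd_conv by (intro ball_cong refl) blast
  qed
  ultimately show ?case by (simp add: c)
qed simp

lemma sub_restrict: "sub S [] C = sub (S \<inter> colors C) [] C"
  by (intro arg_cong[of _ _ "map fst"] csub_cong) auto

lemma sub_link: "chain [] C [] \<Longrightarrow> link_diagram (sub S [] C)"
  using sub_run[of "[]" C "[]" S] by (simp add: link_diagram_def)

definition weight :: "nat \<Rightarrow> laurent" where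
  "weight k = eta ^ (k - 1) * Ehat k"

definition z_over_w :: laurent where
  "z_over_w = laurent_monom 1 (- 1) 0 0"

lemma Phi_eq_psum:
  assumes "finite (link_components D)" "link_components D \<noteq> {}"
  shows "Phi R D = z_over_w ^ (card (link_components D) - 1) *
    psum (link_components D) weight (\<lambda>S. R (sublink D (\<Union> S)))"
proof -
  let ?K = "link_components D" and ?P = "{\<pi>. partition_on (link_components D) \<pi>}"
  let ?w = "\<lambda>\<pi>. \<Prod>S\<in>\<pi>. R (sublink D (\<Union> S))"
  have fin: "finite ?P" by (rule finitely_many_partition_on[OF assms(1)])
  have "psum ?K weight (\<lambda>S. R (sublink D (\<Union> S))) = (\<Sum>k = 1..card ?K. \<Sum>\<pi> | \<pi> \<in> ?P \<and> card \<pi> = k. weight (card \<pi>) * ?w \<pi>)"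
    unfolding psum_def
    by (rule sum.group[symmetric, OF fin]) (use partition_on_card_pos[OF assms] in auto)
  also have "\<dots> = (\<Sum>k = 1..card ?K. eta ^ (k - 1) * Ehat k * (\<Sum>\<pi> | partition_on ?K \<pi> \<and> card \<pi> = k. ?w \<pi>))"
    by (intro sum.cong refl) (simp add: sum_distrib_left weight_def)
  finally show ?thesis unfolding Phi_def Let_def z_over_w_def by simp
qed

text \<open>\<open>C\<close> and the colouring by components are both universal, so each factors
  through the other; hence they differ by an injective renaming \<open>h\<close> of colours.\<close>

lemma link_components_universal:
  assumes "coloring C D" "universal C" "link_diagram D"
  obtains h where "inj_on h (colors C)" "link_components D = h ` colors C"
    "\<And>S. S \<subseteq> colors C \<Longrightarrow> sublink D (\<Union> (h ` S)) = sub S [] C"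
    "\<And>x. x \<in> points D \<Longrightarrow> h (color C x) = component D x"
proof -
  obtain C0 where C0: "coloring C0 D" "universal C0" "\<And>x. x \<in> points D \<Longrightarrow> color C0 x = component D x"
    "colors C0 = link_components D" using component_coloring[OF assms(3)] by blast
  obtain h where h: "C0 = recolor h C" by (rule universal_factor[OF assms(1,2) C0(1)])
  obtain g where g: "C = recolor g C0" by (rule universal_factor[OF C0(1,2) assms(1)])
  have hc: "h (color C x) = component D x" if "x \<in> points D" for x
    using color_recolor[OF assms(1) that, of h] h C0(3)[OF that] by simp
  have gc: "g (component D x) = color C x" if "x \<in> points D" for x
    using color_recolor[OF C0(1) that, of g] g C0(3)[OF that] by simp
  have gh: "g (h k) = k" if "k \<in> colors C" for k
    using that hc gc unfolding colors_eq[OF assms(1)] by auto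
  have inj: "inj_on h (colors C)" by (rule inj_onI) (metis gh)
  have lc: "link_components D = h ` colors C"
    unfolding link_components_eq colors_eq[OF assms(1)] image_image by (rule image_cong) (simp_all add: hc)
  have "sublink D (\<Union> (h ` S)) = sub S [] C" if S: "S \<subseteq> colors C" for S
  proof -
    have "sublink D (\<Union> (h ` S)) = sub (h ` S) [] C0"
    proof (rule sublink_eq_sub[OF C0(1)])
      have "h ` S \<subseteq> component D ` points D" using S lc unfolding link_components_eq by blast
      then show "\<Union> (h ` S) \<subseteq> points D" by (auto simp: component_def)
      fix x assume x: "x \<in> points D"
      show "x \<in> \<Union> (h ` S) \<longleftrightarrow> color C0 x \<in> h ` S"
      proof
        assume "x \<in> \<Union> (h ` S)"
        then obtain K where K: "K \<in> h ` S" "x \<in> K" by blast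
        then obtain y where y: "y \<in> points D" "K = component D y"
          using \<open>h ` S \<subseteq> component D ` points D\<close> by blast
        then have "component D x = component D y"
          using K(2) x component_eq_iff[OF x y(1)] same_component_equiv(2) unfolding component_def by blast
        then show "color C0 x \<in> h ` S" using K(1) y(2) C0(3)[OF x] by simp
      next
        assume "color C0 x \<in> h ` S"
        moreover have "x \<in> component D x" using x same_component_equiv(1) by (simp add: component_def)
        ultimately show "x \<in> \<Union> (h ` S)" using C0(3)[OF x] by auto
      qed
    qed
    also have "\<dots> = sub (h -` h ` S) [] C"
      using sub_recolor[of "h ` S" h "[]" C] h by (simp add: recolor_row_def)
    \<comment> \<open>\<open>h\<close> is known to be injective only on the colours of
      \<open>C\<close>, so the preimage is first cut down to them.\<close>
    also have "\<dots> = sub (h -` h ` S \<inter> colors C) [] C" by (rule sub_restrict)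
    also have "h -` h ` S \<inter> colors C = S" using S gh by (auto dest!: arg_cong[of _ _ g])
    finally show ?thesis .
  qed
  then show thesis using that inj lc hc by blast
qed

text \<open>From here on \<open>Phi\<close> is evaluated through any universal colouring. Its
  colours persist under moves, in contrast to the point sets in
  \<open>link_components\<close>.\<close>

lemma Phi_universal:
  assumes "coloring C D" "universal C" "link_diagram D" "colors C \<noteq> {}"
  shows "Phi R D = z_over_w ^ (card (colors C) - 1) * psum (colors C) weight (\<lambda>S. R (sub S [] C))"
proof -
  obtain h where h: "inj_on h (colors C)" "link_components D = h ` colors C"
    "\<And>S. S \<subseteq> colors C \<Longrightarrow> sublink D (\<Union> (h ` S)) = sub S [] C"
    "\<And>x. x \<in> points D \<Longrightarrow> h (color C x) = component D x"
    by (rule link_components_universal[OF assms(1-3)]) (rule that; assumption)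
  have "Phi R D = z_over_w ^ (card (h ` colors C) - 1) *
      psum (h ` colors C) weight (\<lambda>S. R (sublink D (\<Union> S)))"
    unfolding h(2)[symmetric] by (rule Phi_eq_psum) (simp_all add: h(2) assms(4) finite_colors)
  also have "psum (h ` colors C) weight (\<lambda>S. R (sublink D (\<Union> S))) = psum (colors C) weight (\<lambda>S. R (sub S [] C))"
    unfolding psum_reindex[OF h(1)] by (rule psum_cong) (simp add: h(3))
  finally show ?thesis by (simp add: card_image[OF h(1)])
qed

text \<open>The sum over \<open>k\<close> from 1 to 0 is empty. Regular isotopy invariance covers
  diagrams without components too, and \<open>Phi_universal\<close> excludes them.\<close>

lemma Phi_no_components: "link_components D = {} \<Longrightarrow> Phi R D = 0"
  by (simp add: Phi_def)

lemma card_link_components: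
  "coloring C D \<Longrightarrow> universal C \<Longrightarrow> link_diagram D \<Longrightarrow> card (link_components D) = card (colors C)"
  by (erule link_components_universal, assumption, assumption) (simp add: card_image)

section \<open>Universal colourings under link moves\<close>

lemma map_append_split:
  assumes "map f C = P @ Q"
  obtains A B where "C = A @ B" "map f A = P" "map f B = Q"
proof -
  have "map f (take (length P) C) = P" "map f (drop (length P) C) = Q"
    using assms by (simp_all add: take_map[symmetric] drop_map[symmetric])
  then show thesis using that[of "take (length P) C" "drop (length P) C"] by simp
qed

lemma transfer:
  assumes "link_move X Y \<or> link_move Y X" "link_diagram (P @ Y @ Q)" "coloring C (P @ X @ Q)"
  obtains A B B' E r r' where "C = A @ B @ E" "map fst A = P" "map fst B = X" "map fst B' = Y" "map fst E = Q"
    "chain [] A r" "chain r B r'" "chain r B' r'" "chain r' E []"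
proof -
  have m: "map fst C = P @ X @ Q" and ch: "chain [] C []" using assms(3) by (simp_all add: coloring_def)
  from m obtain A BE where A: "C = A @ BE" "map fst A = P" "map fst BE = X @ Q" by (rule map_append_split)
  from A(3) obtain B E where B: "BE = B @ E" "map fst B = X" "map fst E = Q" by (rule map_append_split)
  from ch obtain r r' where r: "chain [] A r" "chain r B r'" "chain r' E []"
    unfolding A(1) B(1) chain_append by blast
  have "run [] P = Some (map snd r)" using chain_run[OF r(1)] A(2) by simp
  then obtain t where t: "run (map snd r) Y = Some t"
    using assms(2) unfolding link_diagram_def run_append_Some by auto
  have "chainable X r r'" using r(2) B(2) chainable_iff by blast
  then have "chainable Y r r'"
    using assms(1) link_move_transfer link_move_transfer_back t by metis
  then obtain B' where "map fst B' = Y" "chain r B' r'" using chainable_iff by blast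
  then show thesis using that A B r by simp
qed

lemma transfer_coloring:
  assumes "map fst A = P" "map fst B' = Y" "map fst E = Q" "chain [] A r" "chain r B' r'" "chain r' E []"
  shows "coloring (A @ B' @ E) (P @ Y @ Q)"
  using assms by (auto simp: coloring_def chain_append)

text \<open>No colour lives only inside a move: each one occurs on the rows \<open>r\<close> or
  \<open>r'\<close>, which both diagrams share. In particular the number of components is
  preserved.\<close>

lemma transfer_colors:
  assumes "link_move (map fst B) (map fst B') \<or> link_move (map fst B') (map fst B)"
    "chain [] A r" "chain r B r'" "chain r B' r'" "chain r' E []"
  shows "colors (A @ B @ E) = colors (A @ B' @ E)"
proof -
  have "row_colors r \<subseteq> colors A" using colors_end[OF assms(2)] by simp
  moreover have "row_colors r' \<subseteq> row_colors r \<union> colors B" "row_colors r' \<subseteq> row_colors r \<union> colors B'"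
    using colors_end assms(3,4) by blast+
  moreover have "colors B \<subseteq> row_colors r \<union> row_colors r'" "colors B' \<subseteq> row_colors r \<union> row_colors r'"
    using link_move_colors[OF _ assms(3)] link_move_colors[OF _ assms(4)] assms(1) by blast+
  ultimately have "colors A \<union> colors B = colors A \<union> row_colors r'" "colors A \<union> colors B' = colors A \<union> row_colors r'"
    by blast+
  then show ?thesis by auto
qed

text \<open>A test colouring of the new diagram is carried back to the old one and factored there.
  The factorisation fixes the colours on the boundary of the move, and
  \<open>link_move_unique\<close> then extends it to the inside of the new diagram.\<close>

lemma transfer_universal:
  assumes m: "link_move (map fst B) (map fst B') \<or> link_move (map fst B') (map fst B)"
    and A: "chain [] A r" "chain r B r'" "chain r B' r'" "chain r' E []"
    and u: "universal (A @ B @ E)"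
    and l: "link_diagram (map fst A @ map fst B @ map fst E)"
  shows "universal (A @ B' @ E)"
  unfolding universal_def
proof (intro allI impI)
  fix Z :: "bool cdiagram"
  assume Z: "coloring Z (map fst (A @ B' @ E))"
  have Z': "coloring Z (map fst A @ map fst B' @ map fst E)" using Z by simp
  have m': "link_move (map fst B') (map fst B) \<or> link_move (map fst B) (map fst B')" using m by blast
  obtain A1 B1 B2 E1 s s' where s: "Z = A1 @ B1 @ E1" "map fst A1 = map fst A" "map fst B1 = map fst B'"
    "map fst B2 = map fst B" "map fst E1 = map fst E"
    "chain [] A1 s" "chain s B1 s'" "chain s B2 s'" "chain s' E1 []"
    by (rule transfer[OF m' l Z'])
  have "coloring (A1 @ B2 @ E1) (map fst (A @ B @ E))"
    using transfer_coloring[OF s(2,4,5,6,8,9)] by simp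
  then obtain n where n: "A1 @ B2 @ E1 = recolor n (A @ B @ E)" using u unfolding universal_def by blast
  have "length A1 = length A" "length B2 = length B" "length E1 = length E"
    using s(2,4,5) by (metis length_map)+
  then have eq: "A1 = recolor n A" "B2 = recolor n B" "E1 = recolor n E"
    using n by (simp_all add: recolor_def)
  have "chain [] (recolor n A) (recolor_row n r)" using chain_recolor[OF A(1), of n] by (simp add: recolor_row_def)
  then have sr: "s = recolor_row n r" using s(6) eq(1) chain_end_unique by blast
  have "chain s (recolor n B) (recolor_row n r')" using chain_recolor[OF A(2), of n] sr by simp
  then have sr': "s' = recolor_row n r'" using s(8) eq(2) chain_end_unique by blast
  have "chain s (recolor n B') s'" using chain_recolor[OF A(3), of n] sr sr' by simp
  then have "B1 = recolor n B'" using link_move_unique[OF m' s(7)] s(3) by simp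
  then have "Z = recolor n (A @ B' @ E)" using s(1) eq by simp
  then show "\<exists>m. Z = recolor m (A @ B' @ E)" by blast
qed

lemma chain_join3: "chain r A s \<Longrightarrow> chain s B t \<Longrightarrow> chain t E v \<Longrightarrow> chain r (A @ B @ E) v"
  unfolding chain_append by blast

lemma link_components_empty_iff:
  "coloring C D \<Longrightarrow> universal C \<Longrightarrow> link_diagram D \<Longrightarrow> link_components D = {} \<longleftrightarrow> colors C = {}"
  by (erule link_components_universal, assumption, assumption) simp

context homflypt
begin

lemma R_sub_iso_move:
  assumes "iso_move (map fst B) (map fst B')"
    "chain [] A r" "chain r B r'" "chain r B' r'" "chain r' E []"
  shows "R (sub S [] (A @ B @ E)) = R (sub S [] (A @ B' @ E))"
proof -
  have s: "sub S [] (A @ B @ E) = sub S [] A @ sub S r B @ sub S r' E"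
    "sub S [] (A @ B' @ E) = sub S [] A @ sub S r B' @ sub S r' E"
    using assms(2-4) by (simp_all add: csub_append)
  have l: "link_diagram (sub S [] (A @ B @ E))" "link_diagram (sub S [] (A @ B' @ E))"
    using assms(2-5) by (auto intro!: sub_link chain_join3)
  have "sub S r B = sub S r B' \<or> iso_move (sub S r B) (sub S r B')"
    using iso_move_sub[OF assms(1,3) refl assms(4) refl] .
  then show ?thesis
  proof
    assume "iso_move (sub S r B) (sub S r B')"
    then have "local_change iso_move (sub S [] (A @ B @ E)) (sub S [] (A @ B' @ E))"
      using l unfolding s by (rule local_change.intros)
    then have "regular_isotopic (sub S [] (A @ B @ E)) (sub S [] (A @ B' @ E))"
      unfolding regular_isotopic_def by (rule r_into_equivclp)
    then show ?thesis using R_regular_isotopic l by blast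
  qed (simp add: s)
qed

lemma Phi_local_change:
  assumes "local_change iso_move D D'"
  shows "Phi R D = Phi R D'"
  using assms
proof cases
  case (1 X Y P Q)
  obtain C where C: "coloring C D" "universal C" "colors C = link_components D"
    using component_coloring[of D] 1 by metis
  have m: "link_move X Y \<or> link_move Y X" using 1(3) by blast
  obtain A B B' E r r' where s: "C = A @ B @ E" "map fst A = P" "map fst B = X" "map fst B' = Y" "map fst E = Q"
    "chain [] A r" "chain r B r'" "chain r B' r'" "chain r' E []"
    by (rule transfer[OF m 1(5) C(1)[unfolded 1(1)]])
  have m': "link_move (map fst B) (map fst B') \<or> link_move (map fst B') (map fst B)" using m s by simp
  let ?C = "A @ B' @ E"
  have C': "coloring ?C D'" unfolding 1(2) by (rule transfer_coloring[OF s(2,4,5,6,8,9)])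
  have col: "colors ?C = colors C" unfolding s(1) by (rule transfer_colors[OF m' s(6-9), symmetric])
  have "link_diagram (map fst A @ map fst B @ map fst E)" using 1(4) s by simp
  then have u: "universal ?C" using transfer_universal[OF m' s(6-9)] C(2) s(1) by simp
  have R: "R (sub S [] C) = R (sub S [] ?C)" for S
    unfolding s(1) by (rule R_sub_iso_move[OF _ s(6-9)]) (use 1(3) s in simp)
  show ?thesis
  proof (cases "colors C = {}")
    case True
    then have "colors ?C = {}" unfolding col .
    then have "link_components D' = {}" using link_components_empty_iff[OF C' u] 1(2,5) by simp
    moreover have "link_components D = {}" using True C(3) by simp
    ultimately show ?thesis by (simp add: Phi_no_components)
  next
    case False
    have "Phi R D = z_over_w ^ (card (colors C) - 1) * psum (colors C) weight (\<lambda>S. R (sub S [] C))"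
      using Phi_universal[OF C(1,2) _ False] 1(1,4) by simp
    also have "\<dots> = z_over_w ^ (card (colors ?C) - 1) * psum (colors ?C) weight (\<lambda>S. R (sub S [] ?C))"
      by (simp only: R col)
    also have "\<dots> = Phi R D'"
    proof (rule Phi_universal[OF C' u, symmetric])
      show "link_diagram D'" using 1(2,5) by simp
      show "colors ?C \<noteq> {}" using False unfolding col .
    qed
    finally show ?thesis .
  qed
qed

theorem Phi_regular_isotopy_invariant: "regular_isotopy_invariant (Phi R)"
proof -
  have "Phi R D = Phi R D'" if "regular_isotopic D D'" for D D'
    using that unfolding regular_isotopic_def
    by (induction rule: equivclp_induct) (use Phi_local_change in fastforce)+
  then show ?thesis unfolding regular_isotopy_invariant_def by blast
qed

lemma R_sub_kink:
  assumes "kink u i (map fst B)" "chain [] A r" "chain r B r" "chain r E []"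
  obtains k where "k \<in> colors (A @ E)"
    "\<And>S. R (sub S [] (A @ B @ E)) = (if k \<in> S then (if u then var_a else inv_a) else 1) * R (sub S [] (A @ E))"
proof -
  obtain k where k: "k \<in> row_colors r" "\<And>S. if k \<in> S then (\<exists>j. kink u j (sub S r B)) else sub S r B = []"
    using kink_sub[OF assms(1,3) refl] by metis
  have "k \<in> colors (A @ E)" using colors_end[OF assms(2)] k(1) by auto
  moreover have "R (sub S [] (A @ B @ E)) = (if k \<in> S then (if u then var_a else inv_a) else 1) * R (sub S [] (A @ E))" for S
  proof -
    have s: "sub S [] (A @ B @ E) = sub S [] A @ sub S r B @ sub S r E"
      "sub S [] (A @ E) = sub S [] A @ sub S r E"
      using assms(2-3) by (simp_all add: csub_append)
    have l: "link_diagram (sub S [] (A @ B @ E))" 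
      using assms(2-4) by (auto intro!: sub_link chain_join3)
    show ?thesis
    proof (cases "k \<in> S")
      case True
      then obtain j where "kink u j (sub S r B)" using k(2)[of S] by auto
      from R_kink[OF this l[unfolded s]] show ?thesis using True by (simp add: s)
    next
      case False
      then have "sub S r B = []" using k(2)[of S] by simp
      then show ?thesis using False by (simp add: s)
    qed
  qed
  ultimately show thesis by (rule that)
qed

end

section \<open>The skein relation at mixed crossings\<close>

text \<open>Minima and maxima create and remove strands in pairs of one colour, and crossings only
  permute strands.\<close>

lemma chain_parity: "chain r C r' \<Longrightarrow> even (length (keep S r)) \<longleftrightarrow> even (length (keep S r'))"
proof (induction C arbitrary: r)
  case (Cons c C)
  obtain i e t where c: "c = ((i, e), t)" by (metis surj_pair)
  have "cstep r (i, e) t" "chain t C r'" using Cons.prems c by auto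
  from this(1) obtain x y y' z where a: "r = x @ y @ z" "t = x @ y' @ z" "clocal e y y'" by (rule cstepE)
  have "even (length (keep S y)) \<longleftrightarrow> even (length (keep S y'))" using a(3) by (cases e) (auto split: if_splits)
  then have "even (length (keep S r)) \<longleftrightarrow> even (length (keep S t))" using a(1,2) by simp
  then show ?case using Cons.IH[OF \<open>chain t C r'\<close>] by simp
qed simp

lemma crow_prefix: "chain [] A r \<Longrightarrow> crow (A @ B) (length A) = r"
  by (cases A rule: rev_cases) (auto simp: crow_def nth_append chain_append)

lemma crossing_split:
  assumes "coloring C (P @ [(i, Cross u)] @ Q)"
  obtains A E x p q z where "C = A @ [((i, Cross u), x @ q # p # z)] @ E" "map fst A = P" "map fst E = Q"
    "chain [] A (x @ p # q # z)" "chain (x @ q # p # z) E []" "length x = i"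
    "color C (length P, i) = fst p" "color C (length P, i + 1) = fst q"
proof -
  have m: "map fst C = P @ [(i, Cross u)] @ Q" and ch: "chain [] C []" using assms by (simp_all add: coloring_def)
  from m obtain A BE where A: "C = A @ BE" "map fst A = P" "map fst BE = [(i, Cross u)] @ Q" by (rule map_append_split)
  from A(3) obtain B E where B: "BE = B @ E" "map fst B = [(i, Cross u)]" "map fst E = Q" by (rule map_append_split)
  from ch obtain r t where r: "chain [] A r" "chain r B t" "chain t E []"
    unfolding A(1) B(1) chain_append by blast
  have B': "B = [((i, Cross u), t)]" "cstep r (i, Cross u) t" using B(2) r(2) by (auto simp: map_fst_Cons_conv)
  from B'(2) obtain x y y' z where c: "r = x @ y @ z" "t = x @ y' @ z" "length x = i" "clocal (Cross u) y y'"
    by (rule cstepE)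
  from c(4) obtain p q where pq: "y = [p, q]" "y' = [q, p]" by auto
  have "crow C (length P) = r" using crow_prefix[OF r(1)] A(1,2) by auto
  then have "color C (length P, i) = fst p" "color C (length P, i + 1) = fst q"
    using c pq by (simp_all add: color_def nth_append)
  then show thesis using that[of A x q p z E] A B B' r c pq by simp
qed

text \<open>The strands of the two colours that meet in the crossing are matched outside of it.
  Counting the strands of a pair of colours modulo 2 detects this.\<close>

lemma outside_colors:
  assumes "chain [] A (x @ p # q # z)" "chain (x @ q # p # z) E []" "fst p \<noteq> fst q"
    and "chain [] A' (x' @ p1 # q1 # z')" "chain (x' @ p2 # q2 # z') E' []"
    and "map fst A = map fst A'" "map fst E = map fst E'" "length x = length x'"
    and "map snd (x @ q # p # z) = map snd (x' @ p2 # q2 # z')"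
  shows "fst q2 = fst p1" "fst p2 = fst q1"
proof -
  let ?r = "pair_row (x @ p # q # z) (x' @ p1 # q1 # z')" and ?t = "pair_row (x @ q # p # z) (x' @ p2 # q2 # z')"
  let ?X = "pair_row x x'" and ?Z = "pair_row z z'"
  let ?d = "[((fst p, fst p1), snd p), ((fst q, fst q1), snd q)]" and ?e = "[((fst q, fst p2), snd q), ((fst p, fst q2), snd p)]"
  have pr: "?r = ?X @ ?d @ ?Z" "?t = ?X @ ?e @ ?Z"
    using assms(8) by (simp_all add: pair_row_append) (simp_all add: pair_row_def)
  have "chain (pair_row [] []) (pair_chain A A') ?r"
    by (rule chain_pair[OF assms(1,4,6)]) simp
  then have 1: "even (length (keep {k} ?r))" for k
    using chain_parity[of "pair_row [] []" _ ?r "{k}"] by (simp only: pair_row_def zip.simps list.map keep_simps(1) list.size) simp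
  have "chain ?t (pair_chain E E') (pair_row [] [])"
    by (rule chain_pair[OF assms(2,5,7,9)])
  then have 2: "even (length (keep {k} ?t))" for k
    using chain_parity[of ?t _ "pair_row [] []" "{k}"] by (simp only: pair_row_def zip.simps list.map keep_simps(1) list.size) simp
  have par: "even (length (keep {k} ?d)) \<longleftrightarrow> even (length (keep {k} ?e))" for k
    using 1[of k] 2[of k] unfolding pr keep_simps(3) length_append even_add by blast
  \<comment> \<open>As \<open>fst p\<close> and \<open>fst q\<close> differ, the pair
    \<open>(fst p, fst p1)\<close> occurs exactly once in \<open>?d\<close>, so an odd number of
    times in \<open>?e\<close>. The only entry of \<open>?e\<close> with first component
    \<open>fst p\<close> is \<open>(fst p, fst q2)\<close>.\<close>
  show "fst q2 = fst p1" using par[of "(fst p, fst p1)"] assms(3) by (auto split: if_splits)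
  show "fst p2 = fst q1" using par[of "(fst q, fst q1)"] assms(3) by (auto split: if_splits)
qed

lemma colors_recolor: "colors (recolor m C) = m ` colors C"
  by (induction C) (auto simp: recolor_def recolor_row_def row_colors_def image_Un image_image)

lemma recolor_row_simps [simp]:
  "recolor_row m [] = []" "recolor_row m (p # r) = (m (fst p), snd p) # recolor_row m r"
  "recolor_row m (x @ y) = recolor_row m x @ recolor_row m y"
  by (simp_all add: recolor_row_def map_prod_def split_beta)

lemma recolor_row_comp: "recolor_row m (recolor_row n r) = recolor_row (m \<circ> n) r"
  by (induction r) auto

lemma recolor_comp: "recolor m (recolor n C) = recolor (m \<circ> n) C"
  by (simp add: recolor_def recolor_row_comp[unfolded comp_def] comp_def split_beta map_prod_def)

lemma row_colors_recolor_row: "row_colors (recolor_row m r) = m ` row_colors r"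
  by (induction r) auto

lemma map_snd_recolor_row [simp]: "map snd (recolor_row m r) = map snd r"
  by (simp add: recolor_row_def)

text \<open>For parallel strands the list is empty; it still leads from \<open>x @ p # q # z\<close>
  to \<open>x @ q # p # z\<close>, because \<open>p\<close> and \<open>q\<close> coincide once they
  have the same colour.\<close>

definition smoothing_colored :: "'k row \<Rightarrow> 'k \<times> bool \<Rightarrow> 'k \<times> bool \<Rightarrow> 'k row \<Rightarrow> 'k cdiagram" where
  "smoothing_colored x p q z = (if snd p = snd q then []
     else [((length x, Cap), x @ z), ((length x, Cup (snd q)), x @ q # p # z)])"

lemma smoothing_split: "length x = i \<Longrightarrow> smoothing (map snd (x @ p # q # z)) i =
    (if snd p = snd q then [] else [(i, Cap), (i, Cup (snd q))])"
  by (auto simp: smoothing_def nth_append)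

lemma smoothing_colored_fst: "map fst (smoothing_colored x p q z) = smoothing (map snd (x @ p # q # z)) (length x)"
  by (subst smoothing_split) (simp_all add: smoothing_colored_def)

lemma smoothing_colored_chain:
  "fst p = fst q \<Longrightarrow> chain (x @ p # q # z) (smoothing_colored x p q z) (x @ q # p # z)"
  by (auto simp: smoothing_colored_def prod_eq_iff)

text \<open>In the antiparallel case the smoothing ends in a fresh minimum, whose colour is at first
  unrelated to that of the maximum below. The last conclusion identifies the colouring once the
  outside of the crossing has forced this colour.\<close>

lemma smoothing_chainE:
  assumes "chain (x @ p # q # z) Z t" "map fst Z = smoothing (map snd (x @ p # q # z)) (length x)"
  obtains p2 q2 where "t = x @ p2 # q2 # z" "snd p2 = snd q" "snd q2 = snd p"
    "snd p = snd q \<longrightarrow> p2 = p \<and> q2 = q" "snd p \<noteq> snd q \<longrightarrow> fst p = fst q \<and> fst p2 = fst q2"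
    "fst p2 = fst q \<and> fst q2 = fst p \<longrightarrow> Z = smoothing_colored x p q z"
proof (cases "snd p = snd q")
  case True
  then have "Z = []" using assms(2) smoothing_split[OF refl, of x p q z] by simp
  show thesis
  proof (rule that[of p q])
    show "t = x @ p # q # z" using assms(1) \<open>Z = []\<close> by simp
    show "fst p = fst q \<and> fst q = fst p \<longrightarrow> Z = smoothing_colored x p q z"
      using \<open>Z = []\<close> True by (simp add: smoothing_colored_def)
  qed (use True in simp_all)
next
  case False
  then have "map fst Z = [(length x, Cap), (length x, Cup (snd q))]"
    using assms(2) smoothing_split[OF refl, of x p q z] by simp
  then obtain t1 where Z: "Z = [((length x, Cap), t1), ((length x, Cup (snd q)), t)]"
    "cstep (x @ p # q # z) (length x, Cap) t1" "cstep t1 (length x, Cup (snd q)) t"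
    using assms(1) by (auto simp: map_fst_Cons_conv)
  have t1: "t1 = x @ z" "fst p = fst q" using Z(2) by auto
  obtain k where "t = x @ (k, snd q) # (k, \<not> snd q) # z" using Z(3) unfolding t1 by auto
  moreover have "(\<not> snd q) = snd p" using False by auto
  ultimately have t: "t = x @ (k, snd q) # (k, snd p) # z" by simp
  show thesis
  proof (rule that[OF t])
    have "Z = smoothing_colored x p q z" if "fst (k, snd q) = fst q" "fst (k, snd p) = fst p"
    proof -
      have "(k, snd q) = q" "(k, snd p) = p" using that by (auto simp: prod_eq_iff)
      then show ?thesis using Z(1) t1(1) t False by (simp add: smoothing_colored_def)
    qed
    then show "fst (k, snd q) = fst q \<and> fst (k, snd p) = fst p \<longrightarrow> Z = smoothing_colored x p q z" by blast
  qed (use False t1(2) in simp_all)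
qed

lemma cstep_switch: "cstep r (i, Cross u) t \<Longrightarrow> cstep r (i, Cross v) t"
  by (simp add: cstep_def)

lemma crossing_cstep: "length x = i \<Longrightarrow> cstep (x @ p # q # z) (i, Cross u) (x @ q # p # z)"
  using cstepI[of "Cross u" "[p, q]" "[q, p]" x i z] by simp

lemma switch_coloring:
  "coloring (A @ [((i, Cross u), t)] @ E) D \<Longrightarrow>
   coloring (A @ [((i, Cross v), t)] @ E) (map fst A @ [(i, Cross v)] @ map fst E)"
  by (auto simp: coloring_def chain_append intro: cstep_switch)

text \<open>Colourings do not see which strand is on top, so those of the two diagrams correspond
  row by row.\<close>

lemma switch_universal:
  assumes "universal (A @ [((i, Cross u), t)] @ E)"
  shows "universal (A @ [((i, Cross v), t)] @ E)"
  unfolding universal_def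
proof (intro allI impI)
  fix Z :: "bool cdiagram"
  assume Z: "coloring Z (map fst (A @ [((i, Cross v), t)] @ E))"
  then have "map fst Z = map fst A @ [(i, Cross v)] @ map fst E" by (simp add: coloring_def)
  then obtain A1 BE where A1: "Z = A1 @ BE" "map fst A1 = map fst A" "map fst BE = [(i, Cross v)] @ map fst E"
    by (rule map_append_split)
  from A1(3) obtain B1 E1 where B1: "BE = B1 @ E1" "map fst B1 = [(i, Cross v)]" "map fst E1 = map fst E"
    by (rule map_append_split)
  from B1(2) obtain t1 where t1: "B1 = [((i, Cross v), t1)]" by (auto simp: map_fst_Cons_conv)
  have "coloring (A1 @ [((i, Cross u), t1)] @ E1) (map fst (A @ [((i, Cross u), t)] @ E))"
    using switch_coloring[of A1 i v t1 E1 _ u] Z A1 B1 t1 by simp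
  then obtain n where n: "A1 @ [((i, Cross u), t1)] @ E1 = recolor n (A @ [((i, Cross u), t)] @ E)"
    using assms unfolding universal_def by blast
  have "length A1 = length A" "length E1 = length E" using A1(2) B1(3) by (metis length_map)+
  with n have "A1 = recolor n A" "t1 = recolor_row n t" "E1 = recolor n E" by (simp_all add: recolor_def)
  then have "Z = recolor n (A @ [((i, Cross v), t)] @ E)" using A1 B1 t1 by (simp add: recolor_def)
  then show "\<exists>m. Z = recolor m (A @ [((i, Cross v), t)] @ E)" by blast
qed

lemma sub_smoothing_colored:
  assumes "fst p = fst q"
  shows "sub S (x @ p # q # z) (smoothing_colored x p q z) = (if fst p \<in> S \<and> snd p \<noteq> snd q
    then [(length (keep S x), Cap), (length (keep S x), Cup (snd q))] else [])"
  using assms by (simp add: smoothing_colored_def)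

locale mixed_crossing =
  fixes A E :: "'k cdiagram" and x z :: "'k row" and p q :: "'k \<times> bool" and u :: bool
  assumes A: "chain [] A (x @ p # q # z)" and E: "chain (x @ q # p # z) E []" and pq: "fst p \<noteq> fst q"
    and univ: "universal (A @ [((length x, Cross u), x @ q # p # z)] @ E)"
begin

abbreviation "C \<equiv> A @ [((length x, Cross u), x @ q # p # z)] @ E"
abbreviation "D \<equiv> map fst A @ [(length x, Cross u)] @ map fst E"
abbreviation "s \<equiv> map snd (x @ p # q # z)"
abbreviation "D0 \<equiv> map fst A @ smoothing s (length x) @ map fst E"

definition merge :: "'k \<Rightarrow> 'k" where
  "merge k = (if k = fst q then fst p else k)"

abbreviation "x0 \<equiv> recolor_row merge x"
abbreviation "z0 \<equiv> recolor_row merge z"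
abbreviation "p0 \<equiv> (fst p, snd p)"
abbreviation "q0 \<equiv> (fst p, snd q)"

definition C0 :: "'k cdiagram" where
  "C0 = recolor merge A @ smoothing_colored x0 p0 q0 z0 @ recolor merge E"

lemma merge_simps [simp]: "merge (fst p) = fst p" "merge (fst q) = fst p"
  by (simp_all add: merge_def)

lemma rows: "recolor_row merge (x @ p # q # z) = x0 @ p0 # q0 # z0"
  "recolor_row merge (x @ q # p # z) = x0 @ q0 # p0 # z0"
  by simp_all

lemma chains0: "chain [] (recolor merge A) (x0 @ p0 # q0 # z0)"
  "chain (x0 @ p0 # q0 # z0) (smoothing_colored x0 p0 q0 z0) (x0 @ q0 # p0 # z0)"
  "chain (x0 @ q0 # p0 # z0) (recolor merge E) []"
  using chain_recolor[OF A, of merge] chain_recolor[OF E, of merge] smoothing_colored_chain[of p0 q0 x0 z0]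
  by (simp_all only: rows recolor_row_simps(1) fst_conv)

lemma coloring_D: "coloring C D"
  unfolding coloring_def using A E crossing_cstep[OF refl, of x p q z u] by (auto simp: chain_append)

lemma coloring_D0: "coloring C0 D0"
proof -
  have "map fst (smoothing_colored x0 p0 q0 z0) = smoothing s (length x)"
    by (simp only: smoothing_colored_fst length_recolor_row) simp
  then show ?thesis unfolding coloring_def C0_def using chain_join3[OF chains0] by simp
qed

lemma colors_C: "colors C = colors A \<union> colors E"
  using colors_end[OF A] by auto

lemma fst_in_colors: "fst p \<in> colors C" "fst q \<in> colors C"
  using colors_end[OF A] by auto

lemma colors_C0: "colors C0 = colors C - {fst q}"
proof -
  have "row_colors (x @ p # q # z) \<subseteq> colors A" using colors_end[OF A] by simp
  then have sub: "row_colors x \<union> row_colors z \<union> {fst p, fst q} \<subseteq> colors A" by auto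
  have "colors (smoothing_colored x0 p0 q0 z0) \<subseteq> merge ` colors A"
    using image_mono[OF sub, of merge] by (auto simp: smoothing_colored_def row_colors_recolor_row image_Un)
  then have "colors C0 = merge ` (colors A \<union> colors E)" unfolding C0_def by (auto simp: colors_recolor image_Un)
  also have "\<dots> = colors C - {fst q}"
    unfolding colors_C using sub pq by (auto simp: merge_def image_iff)
  finally show ?thesis .
qed

text \<open>By \<open>outside_colors\<close> a two-colouring of the smoothed diagram meets the
  crossing as a colouring of the original diagram would, hence it extends over the crossing and
  factors through \<open>C\<close> by some \<open>n\<close>. At the smoothing the strands
  \<open>p\<close> and \<open>q\<close> receive equal colours, so \<open>n\<close> factors through
  \<open>merge\<close>.\<close>

lemma universal_C0: "universal C0"
  unfolding universal_def
proof (intro allI impI)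
  fix Z :: "bool cdiagram"
  assume "coloring Z (map fst C0)"
  then have Z: "coloring Z D0" using coloring_D0 by (simp add: coloring_def)
  then have "map fst Z = map fst A @ smoothing s (length x) @ map fst E" by (simp add: coloring_def)
  then obtain A1 BE where A1: "Z = A1 @ BE" "map fst A1 = map fst A" "map fst BE = smoothing s (length x) @ map fst E"
    by (rule map_append_split)
  from A1(3) obtain B1 E1 where B1: "BE = B1 @ E1" "map fst B1 = smoothing s (length x)" "map fst E1 = map fst E"
    by (rule map_append_split)
  from Z obtain r1 t1 where c: "chain [] A1 r1" "chain r1 B1 t1" "chain t1 E1 []"
    unfolding coloring_def A1(1) B1(1) chain_append by blast
  have s: "map snd r1 = s" using chain_run[OF c(1)] chain_run[OF A] A1(2) by simp
  obtain x1 pz where x1: "r1 = x1 @ pz" "map snd x1 = map snd x" "map snd pz = snd p # snd q # map snd z"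
    using s map_append_split[of snd r1 "map snd x" "snd p # snd q # map snd z"] by auto
  then obtain p1 q1 z1 where pz: "pz = p1 # q1 # z1" "snd p1 = snd p" "snd q1 = snd q" "map snd z1 = map snd z"
    by (cases pz; cases "tl pz") auto
  have r1: "r1 = x1 @ p1 # q1 # z1" using x1 pz by simp
  have len: "length x1 = length x" using x1(2) by (metis length_map)
  have sm: "map fst B1 = smoothing (map snd (x1 @ p1 # q1 # z1)) (length x1)" using B1(2) s r1 len by simp
  obtain p2 q2 where t: "t1 = x1 @ p2 # q2 # z1" "snd p2 = snd q1" "snd q2 = snd p1"
    "snd p1 = snd q1 \<longrightarrow> p2 = p1 \<and> q2 = q1" "snd p1 \<noteq> snd q1 \<longrightarrow> fst p1 = fst q1 \<and> fst p2 = fst q2"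
    "fst p2 = fst q1 \<and> fst q2 = fst p1 \<longrightarrow> B1 = smoothing_colored x1 p1 q1 z1"
    using c(2)[unfolded r1] sm by (rule smoothing_chainE)
  have out: "fst q2 = fst p1" "fst p2 = fst q1"
  proof -
    have *: "map snd (x @ q # p # z) = map snd (x1 @ p2 # q2 # z1)" using x1(2) pz t(2,3) by simp
    show "fst q2 = fst p1" "fst p2 = fst q1"
      using outside_colors[OF A E pq c(1)[unfolded r1] c(3)[unfolded t(1)] _ _ _ *] A1(2) B1(3) len by auto
  qed
  have same: "fst p1 = fst q1"
  proof (cases "snd p1 = snd q1")
    case True
    then have "q2 = q1" using t(4) by blast
    with out(1) show ?thesis by simp
  next
    case False
    then show ?thesis using t(5) by blast
  qed
  have "p2 = q1" using out(2) t(2) by (rule prod_eqI)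
  moreover have "q2 = p1" using out(1) t(3) by (rule prod_eqI)
  ultimately have swap: "t1 = x1 @ q1 # p1 # z1" using t(1) by simp
  have "coloring (A1 @ [((length x, Cross u), t1)] @ E1) (map fst C)"
    unfolding coloring_def using c(1,3) crossing_cstep[of x1 "length x" p1 q1 z1 u] A1(2) B1(3) r1 swap len
    by (auto simp: chain_append)
  then obtain n where n: "A1 @ [((length x, Cross u), t1)] @ E1 = recolor n C"
    using univ unfolding universal_def by blast
  have "length A1 = length A" "length E1 = length E" using A1(2) B1(3) by (metis length_map)+
  with n have eq: "A1 = recolor n A" "t1 = recolor_row n (x @ q # p # z)" "E1 = recolor n E"
    by (simp_all add: recolor_def)
  have "x1 @ q1 # p1 # z1 = recolor_row n x @ (n (fst q), snd q) # (n (fst p), snd p) # recolor_row n z"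
    using eq(2) swap by simp
  then have xz: "x1 = recolor_row n x" "z1 = recolor_row n z" "q1 = (n (fst q), snd q)" "p1 = (n (fst p), snd p)"
    using len by auto
  have nn: "n (fst q) = n (fst p)" using same xz by simp
  then have nm: "n \<circ> merge = n" by (auto simp: merge_def fun_eq_iff)
  have "B1 = smoothing_colored x1 p1 q1 z1" using t(6) out by simp
  then have "Z = recolor n C0"
  proof -
    have "recolor n (recolor merge A) = A1" "recolor n (recolor merge E) = E1"
      by (simp_all add: recolor_comp nm eq(1,3))
    moreover have "recolor n (smoothing_colored x0 p0 q0 z0) = B1"
      unfolding \<open>B1 = _\<close> using xz nn by (simp add: smoothing_colored_def recolor_def recolor_row_comp nm)
    ultimately show ?thesis by (simp add: C0_def A1(1) B1(1))
  qed
  then show "\<exists>m. Z = recolor m C0" by blast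
qed

lemma merge_vimage: "merge -` S = (if fst p \<in> S then insert (fst q) S else S - {fst q})"
  by (auto simp: merge_def split: if_splits)

lemma keep_merge: "keep S x0 = recolor_row merge (keep (merge -` S) x)"
  by (rule keep_recolor)

lemma sub_C0_aux:
  "sub S [] C0 = sub (merge -` S) [] A @ sub S (x0 @ p0 # q0 # z0) (smoothing_colored x0 p0 q0 z0) @
    sub (merge -` S) (x @ q # p # z) E"
proof -
  have "sub S [] C0 = sub S [] (recolor merge A) @ sub S (x0 @ p0 # q0 # z0) (smoothing_colored x0 p0 q0 z0) @
      sub S (x0 @ q0 # p0 # z0) (recolor merge E)"
    unfolding C0_def using chains0 by (simp add: csub_append)
  then show ?thesis
    using sub_recolor[of S merge "[]" A] sub_recolor[of S merge "x @ q # p # z" E] by simp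
qed

lemma sub_C: "sub S [] C = sub S [] A @
    (if fst p \<in> S \<and> fst q \<in> S then [(length (keep S x), Cross u)] else []) @ sub S (x @ q # p # z) E"
  using csub_append[OF A, of S] by simp

text \<open>Without the merged colour \<open>fst p\<close> nothing of the crossing is left in either
  diagram; \<open>fst q\<close> is removed from the set because it is not a colour of
  \<open>C0\<close>.\<close>

lemma sub_C0_outside:
  assumes "fst p \<notin> S"
  shows "sub S [] C0 = sub (S - {fst q}) [] C"
  unfolding sub_C0_aux sub_C merge_vimage using assms by (simp add: sub_smoothing_colored)

lemma sub_C0_inside:
  assumes "fst p \<in> S"
  defines "T \<equiv> insert (fst q) S"
  shows "sub S [] C0 = sub T [] A @ smoothing (map snd (keep T (x @ p # q # z))) (length (keep T x)) @
    sub T (x @ q # p # z) E"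
proof -
  have T: "merge -` S = T" "fst p \<in> T" "fst q \<in> T" using assms by (simp_all add: merge_vimage)
  have "sub S (x0 @ p0 # q0 # z0) (smoothing_colored x0 p0 q0 z0) =
      smoothing (map snd (keep T (x @ p # q # z))) (length (keep T x))"
  proof -
    have "keep T (x @ p # q # z) = keep T x @ p # q # keep T z" using T by simp
    then have "smoothing (map snd (keep T (x @ p # q # z))) (length (keep T x)) =
        (if snd p = snd q then [] else [(length (keep T x), Cap), (length (keep T x), Cup (snd q))])"
      by (simp only: smoothing_split[OF refl])
    moreover have "sub S (x0 @ p0 # q0 # z0) (smoothing_colored x0 p0 q0 z0) =
        (if snd p = snd q then [] else [(length (keep T x), Cap), (length (keep T x), Cup (snd q))])"
      using assms(1) keep_merge[of S] T(1) by (simp add: sub_smoothing_colored)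
    ultimately show ?thesis by simp
  qed
  then show ?thesis unfolding sub_C0_aux T(1) by simp
qed

end

lemma z_over_w_var_w: "z_over_w * var_w = var_z"
  by (simp add: z_over_w_def laurent_monom_mult)

lemma positive_split: "length x = i \<Longrightarrow> positive (map snd (x @ p # q # z)) i u \<longleftrightarrow> (u \<longleftrightarrow> snd p = snd q)"
  by (auto simp: positive_def nth_append)

context homflypt
begin

text \<open>A block that contains both colours retains the crossing with its sign, so its sublinks
  again form a Conway triple, to which the relation of \<open>R\<close> with coefficient
  \<open>w\<close> applies.\<close>

lemma R_sub_skein:
  assumes "mixed_crossing A E x z p q u" "positive (map snd (x @ p # q # z)) (length x) u"
    "fst p \<in> S" "fst q \<in> S"
  shows "R (sub S [] (A @ [((length x, Cross u), x @ q # p # z)] @ E)) -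
      R (sub S [] (A @ [((length x, Cross (\<not> u)), x @ q # p # z)] @ E)) =
      var_w * R (sub (S - {fst q}) [] (mixed_crossing.C0 A E x z p q))"
proof -
  interpret mixed_crossing A E x z p q u by fact
  have pS: "fst p \<in> S - {fst q}" using assms(3) pq by simp
  have T: "insert (fst q) (S - {fst q}) = S" using assms(4) by blast
  let ?n = "length (keep S x)"
  have k: "keep S (x @ p # q # z) = keep S x @ p # q # keep S z" using assms(3,4) by simp
  have 1: "sub S [] (A @ [((length x, Cross v), x @ q # p # z)] @ E) =
      sub S [] A @ [(?n, Cross v)] @ sub S (x @ q # p # z) E" for v
    using assms(3,4) csub_append[OF A, of S] by simp
  have "chain [] (A @ [((length x, Cross u), x @ q # p # z)] @ E) []"
    using coloring_D by (simp add: coloring_def)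
  from sub_link[OF this, of S] have "link_diagram (sub S [] A @ [(?n, Cross u)] @ sub S (x @ q # p # z) E)"
    unfolding 1 .
  moreover have "run [] (sub S [] A) = Some (map snd (keep S (x @ p # q # z)))"
    using sub_run[OF A, of S] by simp
  moreover have "positive (map snd (keep S (x @ p # q # z))) ?n u"
    using assms(2) unfolding k positive_split[OF refl] .
  ultimately show ?thesis
    using R_skein unfolding 1 sub_C0_inside[OF pS] T by blast
qed

lemma Phi_mixed_skein:
  assumes "mixed_crossing A E x z p q u" "positive (map snd (x @ p # q # z)) (length x) u"
  shows "Phi R (map fst A @ [(length x, Cross u)] @ map fst E) -
      Phi R (map fst A @ [(length x, Cross (\<not> u))] @ map fst E) =
      var_z * Phi R (map fst A @ smoothing (map snd (x @ p # q # z)) (length x) @ map fst E)"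
proof -
  interpret mixed_crossing A E x z p q u by fact
  let ?C' = "A @ [((length x, Cross (\<not> u)), x @ q # p # z)] @ E"
  let ?D' = "map fst A @ [(length x, Cross (\<not> u))] @ map fst E"
  let ?K = "colors C" and ?L = "colors C - {fst q}"
  let ?F = "\<lambda>S. R (sub S [] C)" and ?F' = "\<lambda>S. R (sub S [] ?C')" and ?H = "\<lambda>S. R (sub S [] C0)"
  \<comment> \<open>The factor of a block after smoothing: a block containing both colours is
    replaced by the sublink with the merged component, any other block is as in
    \<open>C\<close>.\<close>
  define G where "G S = (if fst p \<in> S \<and> fst q \<in> S then ?H (S - {fst q}) else ?F S)" for S
  have link: "link_diagram D'" if "coloring B D'" for B :: "'a cdiagram" and D'
    using that chain_run[of "[]" B "[]"] by (auto simp: coloring_def link_diagram_def)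
  have C': "coloring ?C' ?D'" "universal ?C'" "colors ?C' = ?K"
    using switch_coloring[OF coloring_D] switch_universal[OF univ] by simp_all
  have fin: "finite ?K" by (rule finite_colors)
  have ne: "?K \<noteq> {}" "?L \<noteq> {}" using fst_in_colors pq by auto
  have 1: "Phi R D = z_over_w ^ (card ?K - 1) * psum ?K weight ?F"
    by (rule Phi_universal[OF coloring_D univ link[OF coloring_D] ne(1)])
  have 2: "Phi R ?D' = z_over_w ^ (card ?K - 1) * psum ?K weight ?F'"
    using Phi_universal[OF C'(1,2) link[OF C'(1)]] ne(1) C'(3) by simp
  have 3: "Phi R D0 = z_over_w ^ (card ?L - 1) * psum ?L weight ?H"
    using Phi_universal[OF coloring_D0 universal_C0 link[OF coloring_D0]] ne(2) unfolding colors_C0 .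
  let ?P = "{\<pi>. partition_on ?K \<pi>}"
  let ?same = "\<lambda>\<pi>. \<exists>S\<in>\<pi>. fst p \<in> S \<and> fst q \<in> S"
  have finP: "finite ?P" by (rule finitely_many_partition_on[OF fin])
  have sep: "?F S = ?F' S" if "\<not> (fst p \<in> S \<and> fst q \<in> S)" for S
    using that by (cases "fst p \<in> S") (simp_all add: csub_append[OF A])
  have diff: "weight (card \<pi>) * prod ?F \<pi> - weight (card \<pi>) * prod ?F' \<pi> =
      (if ?same \<pi> then var_w * (weight (card \<pi>) * prod G \<pi>) else 0)" if \<pi>: "\<pi> \<in> ?P" for \<pi>
  proof (cases "?same \<pi>")
    case True
    then obtain T where T: "T \<in> \<pi>" "fst p \<in> T" "fst q \<in> T" by blast
    have P: "partition_on ?K \<pi>" using \<pi> by simp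
    have fin\<pi>: "finite \<pi>" using finite_elements[OF fin P] .
    have other: "fst p \<notin> S" if "S \<in> \<pi> - {T}" for S
      using that T disjointD[OF partition_onD2[OF P], of S T] by auto
    have "prod ?F' (\<pi> - {T}) = prod ?F (\<pi> - {T})" "prod G (\<pi> - {T}) = prod ?F (\<pi> - {T})"
      using other sep by (auto intro!: prod.cong simp: G_def)
    then have "prod ?F \<pi> = ?F T * prod ?F (\<pi> - {T})" "prod ?F' \<pi> = ?F' T * prod ?F (\<pi> - {T})"
      "prod G \<pi> = ?H (T - {fst q}) * prod ?F (\<pi> - {T})"
      using prod.remove[OF fin\<pi> T(1), of ?F] prod.remove[OF fin\<pi> T(1), of ?F'] prod.remove[OF fin\<pi> T(1), of G] T(2,3)
      by (simp_all add: G_def)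
    moreover have "?F T - ?F' T = var_w * ?H (T - {fst q})"
      by (rule R_sub_skein[OF assms T(2,3)])
    ultimately show ?thesis using True
      by (simp add: right_diff_distrib[symmetric] left_diff_distrib[symmetric] mult_ac)
  next
    case False
    then have "prod ?F \<pi> = prod ?F' \<pi>" using sep by (intro prod.cong) auto
    then show ?thesis unfolding if_not_P[OF False] by simp
  qed
  have "psum ?K weight ?F - psum ?K weight ?F' =
      (\<Sum>\<pi>\<in>?P. if ?same \<pi> then var_w * (weight (card \<pi>) * prod G \<pi>) else 0)"
    unfolding psum_def sum_subtractf[symmetric] by (rule sum.cong[OF refl diff])
  also have "\<dots> = var_w * (\<Sum>\<pi> | partition_on ?K \<pi> \<and> ?same \<pi>. weight (card \<pi>) * prod G \<pi>)"
    unfolding sum_distrib_left using finP by (simp add: sum.inter_filter[symmetric])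
  also have "(\<Sum>\<pi> | partition_on ?K \<pi> \<and> ?same \<pi>. weight (card \<pi>) * prod G \<pi>) =
      psum ?L weight (\<lambda>S. G (if fst p \<in> S then insert (fst q) S else S))"
    by (rule psum_merge[OF fst_in_colors pq])
  also have "\<dots> = psum ?L weight ?H"
  proof (rule psum_cong)
    fix S assume "S \<subseteq> ?L"
    then have q: "fst q \<notin> S" by blast
    show "G (if fst p \<in> S then insert (fst q) S else S) = ?H S"
    proof (cases "fst p \<in> S")
      case False
      then show ?thesis using sub_C0_outside[of S] q by (simp add: G_def)
    qed (use q in \<open>simp add: G_def\<close>)
  qed
  finally have "psum ?K weight ?F - psum ?K weight ?F' = var_w * psum ?L weight ?H" .
  \<comment> \<open>The smoothed link has one component fewer, so one factor \<open>z / w\<close> of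
    the prefactor is left over; it turns the coefficient \<open>w\<close> of \<open>R\<close> into
    \<open>z\<close>.\<close>
  moreover have "z_over_w ^ (card ?K - 1) * var_w = var_z * z_over_w ^ (card ?L - 1)"
  proof -
    have "card ?L = card ?K - 1" by (rule card_Diff_singleton[OF fst_in_colors(2)])
    moreover have "card ?L \<ge> 1" using ne(2) fin by (simp add: Suc_leI card_gt_0_iff)
    ultimately have "card ?K - 1 = Suc (card ?L - 1)" by simp
    then have "z_over_w ^ (card ?K - 1) = z_over_w ^ (card ?L - 1) * z_over_w" by simp
    then show ?thesis by (simp only: mult.assoc z_over_w_var_w mult.commute[of var_z])
  qed
  ultimately show ?thesis
    unfolding 1 2 3 right_diff_distrib[symmetric] by (simp only: mult.assoc[symmetric])
qed

theorem Phi_mixed: "mixed_skein (Phi R)"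
  unfolding mixed_skein_def
proof (intro allI impI)
  fix Lp Lm L0 a b
  assume "conway_triple Lp Lm L0 a b \<and> \<not> same_component Lp a b"
  then have t: "conway_triple Lp Lm L0 a b" and ns: "\<not> same_component Lp a b" by auto
  from t show "Phi R Lp - Phi R Lm = var_z * Phi R L0"
  proof cases
    case (1 P i u Q s)
    obtain C where C: "coloring C Lp" "universal C" "\<And>x. x \<in> points Lp \<Longrightarrow> color C x = component Lp x"
      using component_coloring[of Lp] 1(1,6) by metis
    obtain A E x p q z where s: "C = A @ [((i, Cross u), x @ q # p # z)] @ E" "map fst A = P" "map fst E = Q"
      "chain [] A (x @ p # q # z)" "chain (x @ q # p # z) E []" "length x = i"
      "color C (length P, i) = fst p" "color C (length P, i + 1) = fst q"
      by (rule crossing_split[OF C(1)[unfolded 1(1)]])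
    have st: "s = map snd (x @ p # q # z)" using chain_run[OF s(4)] s(2) 1(7) by simp
    have "crow C (length P) = x @ p # q # z" using crow_prefix[OF s(4)] s(1,2) by auto
    then have "(length P, i) \<in> points Lp" "(length P, i + 1) \<in> points Lp"
      unfolding points_eq[OF C(1)] using 1(1) s(6) by auto
    then have "fst p \<noteq> fst q" using C(3) s(7,8) ns component_eq_iff 1(4,5) by metis
    then have mc: "mixed_crossing A E x z p q u"
      using s(4-6) C(2) unfolding s(1) by unfold_locales auto
    show ?thesis
      using Phi_mixed_skein[OF mc] 1(8) unfolding 1(1-3) st s(2,3,6) by simp
  qed
qed

end

section \<open>Unlinked knots\<close>

lemma csub_all:
  "chain r C r' \<Longrightarrow> row_colors r \<union> colors C \<subseteq> S \<Longrightarrow> sub S r C = map fst C"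
proof (induction C arbitrary: r)
  case (Cons c C)
  obtain i e t where c: "c = ((i, e), t)" by (metis surj_pair)
  have st: "cstep r (i, e) t" and ch: "chain t C r'" using Cons.prems(1) c by auto
  have "sub S t C = map fst C" by (rule Cons.IH[OF ch]) (use Cons.prems(2) c in auto)
  moreover have "survives S r (i, e) t"
    using Cons.prems(2) c unfolding survives_def row_colors_def colors_simps
    by (auto dest!: in_set_takeD in_set_dropD)
  moreover have "keep S (take i r) = take i r"
    using Cons.prems(2) row_colors_take[of i r] unfolding keep_def by (intro filter_True) (auto simp: row_colors_def)
  moreover have "i \<le> length r" using cstep_lengths[OF st] by simp
  ultimately show ?case by (simp add: c)
qed simp

lemma csub_none: "chain r C r' \<Longrightarrow> S \<inter> (row_colors r \<union> colors C) = {} \<Longrightarrow> csub S r C = []"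
proof (induction C arbitrary: r)
  case (Cons c C)
  obtain i e t where c: "c = ((i, e), t)" by (metis surj_pair)
  have st: "cstep r (i, e) t" and ch: "chain t C r'" using Cons.prems(1) c by auto
  have "csub S t C = []" by (rule Cons.IH[OF ch]) (use Cons.prems(2) c in auto)
  moreover have "\<not> survives S r (i, e) t"
  proof -
    obtain x y y' z where a: "r = x @ y @ z" "t = x @ y' @ z" "length x = i" "clocal e y y'"
      using st by (rule cstepE)
    have "fst ` set (y @ y') \<noteq> {}" using a(4) by (cases e) auto
    then obtain k where k: "k \<in> fst ` set (y @ y')" unfolding ex_in_conv[symmetric] ..
    have "fst ` set (y @ y') \<subseteq> row_colors r \<union> row_colors t" unfolding a(1,2) by (auto simp: row_colors_def)
    then have "k \<in> row_colors r \<union> row_colors t" using k by (rule subsetD)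
    then have "k \<in> row_colors r \<union> colors (c # C)" unfolding c colors_simps snd_conv by blast
    then have "k \<notin> S" using Cons.prems(2) by blast
    then have "\<not> fst ` set (y @ y') \<subseteq> S" using k by blast
    then show ?thesis using survives_block[OF a(4), of S x z] a by simp
  qed
  ultimately show ?case by (simp add: c)
qed simp

text \<open>If no event survived, the restricted chain would stay at the empty row, yet the row in
  which a colour of \<open>S\<close> occurs keeps a strand. This supplies the nonemptiness that
  \<open>R_split\<close> requires.\<close>

lemma sub_nonempty:
  assumes "chain [] C []" "S \<inter> colors C \<noteq> {}"
  shows "sub S [] C \<noteq> []"
proof
  assume "sub S [] C = []"
  then have e: "csub S [] C = []" by simp
  obtain k where k: "k \<in> S" "k \<in> colors C" using assms(2) by blast
  then obtain l where l: "l < length C" "k \<in> row_colors (snd (C ! l))"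
    unfolding colors_def by (auto simp: in_set_conv_nth)
  have C: "C = take (Suc l) C @ drop (Suc l) C" by simp
  then obtain r where r: "chain [] (take (Suc l) C) r" using assms(1) chain_append by metis
  have "csub S [] C = csub S [] (take (Suc l) C) @ csub S r (drop (Suc l) C)"
    using csub_append[OF r, of S "drop (Suc l) C"] by simp
  then have "csub S [] (take (Suc l) C) = []" using e by simp
  then have "keep S r = []" using chain_csub[OF r, of S] by simp
  moreover have "r = snd (C ! l)"
    using r l(1) unfolding chain_iff_nth by (simp add: take_Suc_conv_app_nth)
  ultimately show False using k l(2) by (auto simp: keep_def filter_empty_conv row_colors_def)
qed

text \<open>The split formula is demanded for all nonempty sublinks at once, because the blocks of a
  partition are sublinks.\<close>

definition multiplicative :: "'k set \<Rightarrow> ('k set \<Rightarrow> laurent) \<Rightarrow> bool" where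
  "multiplicative K f \<longleftrightarrow> (\<forall>S \<subseteq> K. S \<noteq> {} \<longrightarrow> f S = eta ^ (card S - 1) * (\<Prod>k\<in>S. f {k}))"

text \<open>For \<open>k \<in> S\<close> exactly one factor of the product, that of
  \<open>k\<close>, acquires \<alpha>, so both sides of the formula are scaled alike; the inverse
  \<beta> permits cancellation. This is how the formula survives the first Reidemeister
  move.\<close>

lemma multiplicative_scale:
  assumes "finite K" "\<And>S. f S = (if k \<in> S then \<alpha> else 1) * g S" "\<beta> * \<alpha> = 1"
  shows "multiplicative K f \<longleftrightarrow> multiplicative K g"
  unfolding multiplicative_def
proof (intro all_cong imp_cong refl)
  fix S assume S: "S \<subseteq> K"
  then have fin: "finite S" using assms(1) finite_subset by blast
  have p: "(\<Prod>j\<in>S. f {j}) = (if k \<in> S then \<alpha> else 1) * (\<Prod>j\<in>S. g {j})"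
  proof -
    have "(\<Prod>j\<in>S. f {j}) = (\<Prod>j\<in>S. (if j = k then \<alpha> else 1) * g {j})"
      by (rule prod.cong[OF refl]) (use assms(2) in auto)
    also have "\<dots> = (\<Prod>j\<in>S. if j = k then \<alpha> else 1) * (\<Prod>j\<in>S. g {j})" by (rule prod.distrib)
    also have "(\<Prod>j\<in>S. if j = k then \<alpha> else 1) = (if k \<in> S then \<alpha> else 1)"
      using fin by (simp add: prod.delta)
    finally show ?thesis .
  qed
  have cancel: "\<alpha> * a = \<alpha> * b \<longleftrightarrow> a = b" for a b
  proof
    assume "\<alpha> * a = \<alpha> * b"
    then have "\<beta> * \<alpha> * a = \<beta> * \<alpha> * b" by (simp only: mult.assoc)
    then show "a = b" unfolding assms(3) by simp
  qed simp
  show "f S = eta ^ (card S - 1) * (\<Prod>k\<in>S. f {k}) \<longleftrightarrow> g S = eta ^ (card S - 1) * (\<Prod>k\<in>S. g {k})"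
  proof (cases "k \<in> S")
    case True
    have "eta ^ (card S - 1) * (\<Prod>k\<in>S. f {k}) = \<alpha> * (eta ^ (card S - 1) * (\<Prod>k\<in>S. g {k}))"
      unfolding p using True by (simp only: if_True mult.left_commute)
    then show ?thesis using assms(2)[of S] True cancel by simp
  next
    case False
    then show ?thesis using assms(2)[of S] p by simp
  qed
qed

lemma laurent_monom_power: "laurent_monom i j k l ^ n = laurent_monom (int n * i) (int n * j) (int n * k) (int n * l)"
  by (induction n) (simp_all add: laurent_monom_zero laurent_monom_mult algebra_simps)

text \<open>The exponents of \<open>eta\<close> add up to \<open>card K - 1\<close> for every
  partition: \<open>card \<pi> - 1\<close> from the weight and \<open>card S - 1\<close> from each
  block \<open>S\<close>. All partitions therefore contribute the same value \<open>f K\<close>,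
  times \<open>Ehat (card \<pi>)\<close>.\<close>

lemma psum_multiplicative:
  assumes "finite K" "K \<noteq> {}" "multiplicative K f"
  shows "psum K weight f = Ehat_inv ^ (card K - 1) * f K"
proof -
  have "weight (card \<pi>) * prod f \<pi> = Ehat (card \<pi>) * f K" if \<pi>: "\<pi> \<in> {\<pi>. partition_on K \<pi>}" for \<pi>
  proof -
    have P: "partition_on K \<pi>" using \<pi> by simp
    have S: "S \<subseteq> K \<and> S \<noteq> {} \<and> finite S" if "S \<in> \<pi>" for S
      using that partition_onD1[OF P] partition_onD3[OF P] assms(1) by (auto intro: finite_subset)
    have c: "card K = (\<Sum>S\<in>\<pi>. card S)" by (rule product_partition[OF P]) (use S in blast)
    have "prod f \<pi> = (\<Prod>S\<in>\<pi>. eta ^ (card S - 1) * (\<Prod>k\<in>S. f {k}))"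
      by (rule prod.cong[OF refl]) (use assms(3) S in \<open>simp add: multiplicative_def\<close>)
    also have "\<dots> = eta ^ (\<Sum>S\<in>\<pi>. card S - 1) * (\<Prod>S\<in>\<pi>. \<Prod>k\<in>S. f {k})"
      by (simp add: prod.distrib power_sum)
    also have "(\<Prod>S\<in>\<pi>. \<Prod>k\<in>S. f {k}) = (\<Prod>k\<in>\<Union>\<pi>. f {k})"
    proof (rule prod.Union_disjoint[symmetric, unfolded o_def])
      show "\<forall>A\<in>\<pi>. finite A" using S by blast
      show "\<forall>A\<in>\<pi>. \<forall>B\<in>\<pi>. A \<noteq> B \<longrightarrow> A \<inter> B = {}" using partition_onD2[OF P] by (auto simp: disjoint_def)
    qed
    also have "\<Union>\<pi> = K" using partition_onD1[OF P] by simp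
    also have "(\<Sum>S\<in>\<pi>. card S - 1) = card K - card \<pi>"
    proof -
      have "(\<Sum>S\<in>\<pi>. card S) = (\<Sum>S\<in>\<pi>. (card S - 1) + 1)"
      proof (rule sum.cong[OF refl])
        fix T assume "T \<in> \<pi>"
        then have "card T > 0" using S by (simp add: card_gt_0_iff)
        then show "card T = (card T - 1) + 1" by simp
      qed
      then show ?thesis using c by (simp only: sum.distrib) simp
    qed
    finally have "weight (card \<pi>) * prod f \<pi> =
        Ehat (card \<pi>) * (eta ^ (card \<pi> - 1) * eta ^ (card K - card \<pi>) * (\<Prod>k\<in>K. f {k}))"
      by (simp add: weight_def mult_ac)
    also have "eta ^ (card \<pi> - 1) * eta ^ (card K - card \<pi>) = eta ^ (card K - 1)"
      using partition_on_card_pos[OF assms(1,2) P] by (simp flip: power_add)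
    also have "eta ^ (card K - 1) * (\<Prod>k\<in>K. f {k}) = f K"
      using assms(3)[unfolded multiplicative_def, rule_format, OF order_refl assms(2)] by (rule sym)
    finally show ?thesis .
  qed
  then have "psum K weight f = (\<Sum>\<pi> | partition_on K \<pi>. Ehat (card \<pi>) * f K)"
    unfolding psum_def by (rule sum.cong[OF refl])
  then show ?thesis using sum_Ehat[OF assms(1,2)] by (simp add: sum_distrib_right[symmetric])
qed

lemma universal_recolor:
  assumes "universal C" "inj_on m (colors C)"
  shows "universal (recolor m C)"
  unfolding universal_def
proof (intro allI impI)
  fix B :: "bool cdiagram"
  assume "coloring B (map fst (recolor m C))"
  then obtain h where "B = recolor h C" using assms(1) by (auto simp: universal_def)
  also have "\<dots> = recolor (h \<circ> inv_into (colors C) m) (recolor m C)"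
    unfolding recolor_comp by (rule recolor_cong) (use assms(2) in simp)
  finally show "\<exists>h. B = recolor h (recolor m C)" by blast
qed

text \<open>The row between the two diagrams is empty, so every colouring splits; as the colours are
  disjoint, the two factorisations glue to one.\<close>

lemma universal_append:
  assumes "coloring C1 D1" "universal C1" "coloring C2 D2" "universal C2" "colors C1 \<inter> colors C2 = {}"
  shows "coloring (C1 @ C2) (D1 @ D2)" "universal (C1 @ C2)"
proof -
  show "coloring (C1 @ C2) (D1 @ D2)" using assms(1,3) by (auto simp: coloring_def chain_append)
  show "universal (C1 @ C2)"
    unfolding universal_def
  proof (intro allI impI)
    fix Z :: "bool cdiagram"
    assume Z: "coloring Z (map fst (C1 @ C2))"
    then have "map fst Z = D1 @ D2" using assms(1,3) by (simp add: coloring_def)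
    then obtain Z1 Z2 where s: "Z = Z1 @ Z2" "map fst Z1 = D1" "map fst Z2 = D2" by (rule map_append_split)
    obtain r where r: "chain [] Z1 r" "chain r Z2 []"
      using Z unfolding coloring_def s(1) chain_append by blast
    have "run [] D1 = Some (map snd r)" using chain_run[OF r(1)] s(2) by simp
    moreover have "run [] D1 = Some []" using chain_run[of "[]" C1 "[]"] assms(1) by (simp add: coloring_def)
    ultimately have "r = []" by simp
    then have "coloring Z1 D1" "coloring Z2 D2" using r s by (simp_all add: coloring_def)
    then obtain m1 m2 where m: "Z1 = recolor m1 C1" "Z2 = recolor m2 C2"
      using assms unfolding universal_def coloring_def by metis
    define m where "m k = (if k \<in> colors C1 then m1 k else m2 k)" for k
    have "recolor m1 C1 = recolor m C1" by (rule recolor_cong) (simp add: m_def)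
    moreover have "recolor m2 C2 = recolor m C2" by (rule recolor_cong) (use assms(5) in \<open>auto simp: m_def\<close>)
    ultimately have "Z = recolor m (C1 @ C2)" using s(1) m by simp
    then show "\<exists>m. Z = recolor m (C1 @ C2)" by blast
  qed
qed

lemma coloring_link: "coloring C D \<Longrightarrow> link_diagram D"
  using chain_run[of "[]" C "[]"] by (auto simp: coloring_def link_diagram_def)

lemma knot_coloring:
  assumes "knot_diagram K"
  obtains C where "coloring C K" "universal C" "colors C = {n}"
proof -
  have l: "link_diagram K" and c: "card (link_components K) = 1" using assms by (auto simp: knot_diagram_def)
  obtain C where C: "coloring C K" "universal C" "colors C = link_components K"
    using component_coloring[OF l] by metis
  obtain k where k: "colors C = {k}" using c C(3) card_1_singletonE by metis
  show thesis
  proof (rule that)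
    show "coloring (recolor (\<lambda>_. n) C) K" by (rule coloring_recolor[OF C(1)])
    show "universal (recolor (\<lambda>_. n) C)" by (rule universal_recolor[OF C(2)]) (simp add: k)
    show "colors (recolor (\<lambda>_. n) C) = {n}" by (simp add: colors_recolor k)
  qed
qed

context homflypt
begin

text \<open>Invariant under all Reidemeister moves including the first, although \<open>R\<close>
  itself is not; so it can be checked on the stack of knots in
  \<open>unlinked_knots\<close>.\<close>

definition R_multiplicative :: "nat \<Rightarrow> diagram \<Rightarrow> bool" where
  "R_multiplicative r D \<longleftrightarrow> (\<exists>C :: nat cdiagram. coloring C D \<and> universal C \<and> card (colors C) = r \<and>
     multiplicative (colors C) (\<lambda>S. R (sub S [] C)))"

lemma R_multiplicative_Phi:
  assumes "R_multiplicative r D" "r \<ge> 1"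
  shows "Phi R D = laurent_monom 0 0 0 (1 - int r) * R D"
proof -
  obtain C :: "nat cdiagram" where C: "coloring C D" "universal C" "card (colors C) = r"
    "multiplicative (colors C) (\<lambda>S. R (sub S [] C))" using assms(1) by (auto simp: R_multiplicative_def)
  have ne: "colors C \<noteq> {}" using C(3) assms(2) by auto
  have "sub (colors C) [] C = D" using csub_all[of "[]" C "[]" "colors C"] C(1) by (simp add: coloring_def)
  then have "psum (colors C) weight (\<lambda>S. R (sub S [] C)) = Ehat_inv ^ (r - 1) * R D"
    using psum_multiplicative[OF finite_colors ne C(4)] C(3) by simp
  then have "Phi R D = (z_over_w * Ehat_inv) ^ (r - 1) * R D"
    using Phi_universal[OF C(1,2) coloring_link[OF C(1)] ne, of R] C(3) by (simp add: power_mult_distrib mult.assoc)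
  \<comment> \<open>\<open>Ehat_inv\<close> is \<open>w / (z E)\<close>, hence the prefactor
    \<open>z / w\<close> cancels and \<open>E^-1\<close> to the power \<open>r - 1\<close>
    remains.\<close>
  also have "z_over_w * Ehat_inv = laurent_monom 0 0 0 (- 1)"
    by (simp add: z_over_w_def Ehat_inv_def laurent_monom_mult)
  also have "laurent_monom 0 0 0 (- 1) ^ (r - 1) = laurent_monom 0 0 0 (1 - int r)"
    using assms(2) by (simp add: laurent_monom_power of_nat_diff)
  finally show ?thesis .
qed

lemma R_multiplicative_link_move:
  assumes "link_move X Y \<or> link_move Y X" "link_diagram (P @ X @ Q)" "link_diagram (P @ Y @ Q)" "R_multiplicative n (P @ X @ Q)"
  shows "R_multiplicative n (P @ Y @ Q)"
proof -
  obtain C :: "nat cdiagram" where C: "coloring C (P @ X @ Q)" "universal C" "card (colors C) = n"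
    "multiplicative (colors C) (\<lambda>S. R (sub S [] C))" using assms(4) by (auto simp: R_multiplicative_def)
  obtain A B B' E r r' where s: "C = A @ B @ E" "map fst A = P" "map fst B = X" "map fst B' = Y" "map fst E = Q"
    "chain [] A r" "chain r B r'" "chain r B' r'" "chain r' E []"
    by (rule transfer[OF assms(1,3) C(1)])
  have m: "link_move (map fst B) (map fst B') \<or> link_move (map fst B') (map fst B)" using assms(1) s by simp
  let ?C = "A @ B' @ E"
  have C': "coloring ?C (P @ Y @ Q)" by (rule transfer_coloring[OF s(2,4,5,6,8,9)])
  have col: "colors C = colors ?C" unfolding s(1) by (rule transfer_colors[OF m s(6-9)])
  have u: "universal ?C" using transfer_universal[OF m s(6-9)] C(2) s assms(2) by simp
  have inv: "inv_a * var_a = 1" "var_a * inv_a = 1" by (simp_all add: laurent_monom_mult laurent_monom_zero)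
  \<comment> \<open>Removing a curl divides the values on sublinks through one colour
    \<open>k\<close> by \<open>a\<close> or \<open>a^-1\<close> and leaves the others alone.\<close>
  have kinked: "multiplicative (colors C) (\<lambda>S. R (sub S [] (A @ K @ E))) \<longleftrightarrow> multiplicative (colors C) (\<lambda>S. R (sub S [] (A @ E)))"
    if K: "reidemeister1 (map fst K) []" "chain r K r" "chain r E []" for K
  proof -
    obtain v i where "kink v i (map fst K)" using K(1) by cases auto
    from R_sub_kink[OF this s(6) K(2,3)] obtain k where
      k: "\<And>S. R (sub S [] (A @ K @ E)) = (if k \<in> S then (if v then var_a else inv_a) else 1) * R (sub S [] (A @ E))"
      by blast
    show ?thesis
      by (rule multiplicative_scale[OF finite_colors k, where \<beta> = "if v then inv_a else var_a"]) (simp add: inv)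
  qed
  have "iso_move X Y \<or> iso_move Y X \<or> reidemeister1 X Y \<or> reidemeister1 Y X" using assms(1) by auto
  then have "multiplicative (colors C) (\<lambda>S. R (sub S [] ?C))"
  proof (elim disjE)
    assume "iso_move X Y"
    then have "iso_move (map fst B) (map fst B')" using s by simp
    from R_sub_iso_move[OF this s(6-9)] show ?thesis using C(4) unfolding s(1) by simp
  next
    assume "iso_move Y X"
    then have "iso_move (map fst B') (map fst B)" using s by simp
    from R_sub_iso_move[OF this s(6,8,7,9)] show ?thesis using C(4) unfolding s(1) by simp
  next
    assume a: "reidemeister1 X Y"
    then have "Y = []" by cases
    then have B': "B' = []" "r' = r" using s(4,8) by simp_all
    then show ?thesis using kinked[of B] a s(3,7,9) \<open>Y = []\<close> C(4) unfolding s(1) by simp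
  next
    assume a: "reidemeister1 Y X"
    then have "X = []" by cases
    then have B': "B = []" "r' = r" using s(3,7) by simp_all
    then show ?thesis using kinked[of B'] a s(4,8,9) \<open>X = []\<close> C(4) unfolding s(1) by simp
  qed
  then show ?thesis using C' u C(3) col unfolding R_multiplicative_def by auto
qed

lemma R_multiplicative_same_link: "same_link D D' \<Longrightarrow> R_multiplicative n D \<longleftrightarrow> R_multiplicative n D'"
  unfolding same_link_def
proof (induction rule: equivclp_induct)
  case (step y z)
  have "R_multiplicative n v \<longleftrightarrow> R_multiplicative n w" if "local_change link_move v w" for v w
    using that
  proof cases
    case (1 X Y P Q)
    then show ?thesis using R_multiplicative_link_move[of X Y P Q n] R_multiplicative_link_move[of Y X P Q n] by blast
  qed
  with step show ?case by blast
qed simp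

text \<open>Colour the knots by their indices. A sublink through the last knot is a split union of
  that knot with a sublink of the earlier ones, and \<open>R_split\<close> contributes one more
  \<open>eta\<close> unless that sublink is empty.\<close>

lemma R_multiplicative_concat:
  assumes "\<forall>K \<in> set Ks. knot_diagram K"
  shows "\<exists>C :: nat cdiagram. coloring C (concat Ks) \<and> universal C \<and> colors C = {..<length Ks} \<and>
    multiplicative (colors C) (\<lambda>S. R (sub S [] C))"
  using assms
proof (induction Ks rule: rev_induct)
  case Nil
  have "universal ([] :: nat cdiagram)" by (auto simp: universal_def coloring_def recolor_def)
  then show ?case by (intro exI[of _ "[]"]) (simp add: coloring_def multiplicative_def)
next
  case (snoc K Ks)
  then obtain C :: "nat cdiagram" where C: "coloring C (concat Ks)" "universal C" "colors C = {..<length Ks}"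
    "multiplicative (colors C) (\<lambda>S. R (sub S [] C))" by auto
  let ?n = "length Ks"
  obtain B where B: "coloring B K" "universal B" "colors B = {?n}"
    using knot_coloring[of K ?n] snoc.prems by auto
  have dis: "colors C \<inter> colors B = {}" using C(3) B(3) by simp
  have chC: "chain [] C []" and chB: "chain [] B []" using C(1) B(1) by (simp_all add: coloring_def)
  have subB: "sub S [] B = (if ?n \<in> S then K else [])" for S
  proof (cases "?n \<in> S")
    case True
    then show ?thesis using csub_all[OF chB, of S] B(1,3) by (simp add: coloring_def)
  next
    case False
    then show ?thesis using csub_none[OF chB, of S] B(3) by simp
  qed
  have sub: "sub S [] (C @ B) = sub S [] C @ (if ?n \<in> S then K else [])" for S
    using csub_append[OF chC, of S B] subB[of S] by simp
  have K: "K \<noteq> []" "link_diagram K" using sub_nonempty[OF chB, of "{?n}"] B(3) subB coloring_link[OF B(1)] by auto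
  have subn: "sub {?n} [] C = []" using csub_none[OF chC, of "{?n}"] C(3) by simp
  have "multiplicative (colors (C @ B)) (\<lambda>S. R (sub S [] (C @ B)))"
    unfolding multiplicative_def
  proof (intro allI impI)
    fix S assume S: "S \<subseteq> colors (C @ B)" "S \<noteq> {}"
    then have fin: "finite S" using finite_colors finite_subset by blast
    let ?T = "S - {?n}"
    have T: "?T \<subseteq> colors C" using S(1) C(3) B(3) by auto
    have sT: "sub S [] C = sub ?T [] C"
      by (intro arg_cong[of _ _ "map fst"] csub_cong) (use C(3) in auto)
    have one: "R (sub {k} [] (C @ B)) = R (sub {k} [] C)" if "k \<in> ?T" for k using that sub by auto
    have pT: "(\<Prod>k\<in>?T. R (sub {k} [] (C @ B))) = (\<Prod>k\<in>?T. R (sub {k} [] C))"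
      by (rule prod.cong[OF refl]) (rule one)
    show "R (sub S [] (C @ B)) = eta ^ (card S - 1) * (\<Prod>k\<in>S. R (sub {k} [] (C @ B)))"
    proof (cases "?n \<in> S")
      case False
      then have "?T = S" by simp
      then show ?thesis using C(4) S(2) T pT sub[of S] False unfolding multiplicative_def by simp
    next
      case True
      have Rn: "R (sub {?n} [] (C @ B)) = R K" using sub[of "{?n}"] subn by simp
      have prod: "(\<Prod>k\<in>S. R (sub {k} [] (C @ B))) = R K * (\<Prod>k\<in>?T. R (sub {k} [] C))"
        using prod.remove[OF fin True, of "\<lambda>k. R (sub {k} [] (C @ B))"] Rn pT by simp
      have subS: "sub S [] (C @ B) = sub ?T [] C @ K" using sub[of S] True sT by simp
      show ?thesis
      proof (cases "?T = {}")
        case True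
        then have "S = {?n}" using \<open>?n \<in> S\<close> by blast
        then show ?thesis using Rn by simp
      next
        case False
        have "sub ?T [] C \<noteq> []" by (rule sub_nonempty[OF chC]) (use False T in blast)
        then have "R (sub S [] (C @ B)) = eta * R (sub ?T [] C) * R K"
          unfolding subS using R_split[OF sub_link[OF chC]] K by blast
        also have "R (sub ?T [] C) = eta ^ (card ?T - 1) * (\<Prod>k\<in>?T. R (sub {k} [] C))"
          using C(4) T False unfolding multiplicative_def by blast
        also have "card ?T = card S - 1" using True by (rule card_Diff_singleton)
        finally have *: "R (sub S [] (C @ B)) = eta * eta ^ (card S - 1 - 1) * ((\<Prod>k\<in>?T. R (sub {k} [] C)) * R K)"
          by (simp only: mult_ac)
        have "card ?T \<ge> 1" using False fin by (simp add: Suc_leI card_gt_0_iff)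
        then have "eta * eta ^ (card S - 1 - 1) = eta ^ (card S - 1)"
          using \<open>card ?T = card S - 1\<close> by (simp add: Suc_diff_Suc flip: power_Suc)
        then show ?thesis unfolding * prod by (simp only: mult_ac)
      qed
    qed
  qed
  moreover have "coloring (C @ B) (concat (Ks @ [K]))" "universal (C @ B)"
    using universal_append[OF C(1,2) B(1,2) dis] by simp_all
  moreover have "colors (C @ B) = {..<length (Ks @ [K])}" using C(3) B(3) by (auto simp: less_Suc_eq)
  ultimately show ?case by blast
qed

lemma R_multiplicative_unlinked: "unlinked_knots r D \<Longrightarrow> R_multiplicative r D"
proof -
  assume "unlinked_knots r D"
  then obtain Ks where Ks: "length Ks = r" "\<forall>K \<in> set Ks. knot_diagram K" "same_link D (concat Ks)"
    by (auto simp: unlinked_knots_def)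
  then have "R_multiplicative r (concat Ks)" using R_multiplicative_concat[OF Ks(2)] unfolding R_multiplicative_def by auto
  then show ?thesis using R_multiplicative_same_link[OF Ks(3)] by simp
qed

theorem Phi_unlinked: "unlinked_values R (Phi R)"
  unfolding unlinked_values_def using R_multiplicative_unlinked R_multiplicative_Phi by blast

end

section \<open>Pulling layers apart\<close>

lemma deforms_iso: "X \<leadsto> Y \<Longrightarrow> run s X = Some t \<Longrightarrow> iso s t X Y"
  by (simp add: deforms_def)

text \<open>Stated for a fixed row, since for \<open>i + l = 0\<close> the sweep is empty and
  nothing on the left hand side guarantees that there is a strand in position \<open>j\<close>,
  which has to pass over the new minimum.\<close>

lemma sweep_cup:
  assumes "run s (over j (i + l) @ [(j + i, Cup b)]) = Some t" "j + i < length s"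
  shows "iso s t (over j (i + l) @ [(j + i, Cup b)]) ((Suc (j + i), Cup b) # over j (Suc (Suc (i + l))))"
proof -
  let ?a = "j + i"
  let ?N = "[(Suc ?a, Cup b), (?a, Cross True), (Suc ?a, Cross True)]"
  have o: "over j (Suc (Suc (i + l))) = over j i @ [(?a, Cross True), (Suc ?a, Cross True)] @ over (Suc (Suc ?a)) l"
    using over_add[of j i "Suc (Suc l)"] by simp
  have 1: "over j (i + l) @ [(?a, Cup b)] \<leadsto> over j i @ [(?a, Cup b)] @ over (Suc (Suc ?a)) l"
    using deforms_prefix[OF far_left[of ?a "Cup b" ?a l], of "over j i"] by (simp add: over_add)
  then have "run s (over j i @ [(?a, Cup b)] @ over (Suc (Suc ?a)) l) = Some t"
    using assms(1) by (rule deforms_run)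
  then obtain r r' where r: "run s (over j i) = Some r" "run r [(?a, Cup b)] = Some r'"
    "run r' (over (Suc (Suc ?a)) l) = Some t" unfolding run_append_Some by blast
  have "length r = length s" using over_run_length[OF r(1)] by simp
  then obtain x p z where x: "r = x @ p # z" "?a = length x" using split_nth[of ?a r] assms(2) by auto
  have "run r ?N = Some r'" using r(2) unfolding x by auto
  moreover have "?N \<leadsto> [(?a, Cup b)]"
  proof -
    have "?N \<leadsto> [(?a, Cup b), (Suc ?a, Cross False), (Suc ?a, Cross True)]"
      using deforms_suffix[OF cup_slide_back[of ?a b True], of "[(Suc ?a, Cross True)]"] by simp
    also have "\<dots> \<leadsto> [(?a, Cup b)]"
      using deforms_Cons[OF cross_cancel[of True False "Suc ?a"]] by simp
    finally show ?thesis .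
  qed
  ultimately have "iso r r' [(?a, Cup b)] ?N" by (intro iso_sym[OF deforms_iso])
  from iso_context[OF this r(1,3)]
  have 2: "iso s t (over j i @ [(?a, Cup b)] @ over (Suc (Suc ?a)) l) (over j i @ ?N @ over (Suc (Suc ?a)) l)" .
  have 3: "over j i @ ?N @ over (Suc (Suc ?a)) l \<leadsto> (Suc ?a, Cup b) # over j (Suc (Suc (i + l)))"
    unfolding o using deforms_suffix[OF far_right[of j i "Suc ?a" "Cup b"],
      of "[(?a, Cross True), (Suc ?a, Cross True)] @ over (Suc (Suc ?a)) l"] by simp
  have "iso s t (over j (i + l) @ [(?a, Cup b)]) (over j i @ ?N @ over (Suc (Suc ?a)) l)"
    using deforms_iso[OF 1 assms(1)] 2 by (rule iso_trans)
  moreover have "run s (over j i @ ?N @ over (Suc (Suc ?a)) l) = Some t"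
    using r \<open>run r ?N = _\<close> by (intro run_insert)
  ultimately show ?thesis using deforms_iso[OF 3] by (blast intro: iso_trans)
qed

text \<open>A minimum born to the right of \<open>n\<close> strands may as well be born to their
  left, after which both legs pass over them. The two lemmas that follow do the same for the other
  events of an upper layer.\<close>

lemma double_sweep_cup: "[(a + n, Cup b)] \<leadsto> (a, Cup b) # over (Suc a) n @ over a n"
proof (induction n)
  case (Suc n)
  let ?i = "a + n"
  have "[(a + Suc n, Cup b)] \<leadsto> [(Suc ?i, Cup b), (?i, Cross False), (?i, Cross True)]"
  proof (rule deforms_reverse)
    show "[(Suc ?i, Cup b), (?i, Cross False), (?i, Cross True)] \<leadsto> [(a + Suc n, Cup b)]"
      using deforms_Cons[OF cross_cancel[of True False ?i]] by simp
    show "run s [(Suc ?i, Cup b), (?i, Cross False), (?i, Cross True)] = Some t"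
      if "run s [(a + Suc n, Cup b)] = Some t" for s t
      using that by (cases s ?i rule: at_cases) auto
  qed
  also have "\<dots> \<leadsto> [(?i, Cup b), (Suc ?i, Cross True), (?i, Cross True)]"
    using deforms_suffix[OF cup_slide_back[of ?i b False], of "[(?i, Cross True)]"] by simp
  also have "\<dots> \<leadsto> (a, Cup b) # over (Suc a) n @ over a n @ [(Suc ?i, Cross True), (?i, Cross True)]"
    using deforms_suffix[OF Suc, of "[(Suc ?i, Cross True), (?i, Cross True)]"] by simp
  also have "\<dots> \<leadsto> (a, Cup b) # over (Suc a) (Suc n) @ over a (Suc n)"
    using deforms_context[OF far_right[of a n "Suc ?i" "Cross True"], of "(a, Cup b) # over (Suc a) n" "[(?i, Cross True)]"]
    by (simp only: over_snoc append.simps append_assoc add_Suc) simp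
  finally show ?case .
qed simp

lemma double_sweep_cap: "over (Suc a) n @ over a n @ [(a + n, Cap)] \<leadsto> [(a, Cap)]"
proof (induction n)
  case (Suc n)
  let ?i = "a + n"
  have "over (Suc a) (Suc n) @ over a (Suc n) @ [(Suc ?i, Cap)] \<leadsto>
      over (Suc a) n @ over a n @ [(Suc ?i, Cross True), (?i, Cross True), (Suc ?i, Cap)]"
    using deforms_context[OF far_right_back[of a n "Suc ?i" "Cross True"], of "over (Suc a) n" "[(?i, Cross True), (Suc ?i, Cap)]"]
    by (simp only: over_snoc append.simps append_assoc add_Suc) simp
  also have "\<dots> \<leadsto> over (Suc a) n @ over a n @ [(Suc ?i, Cross True), (Suc ?i, Cross False), (?i, Cap)]"
    using deforms_prefix[OF cap_slide[of ?i True], of "over (Suc a) n @ over a n @ [(Suc ?i, Cross True)]"] by simp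
  also have "\<dots> \<leadsto> over (Suc a) n @ over a n @ [(?i, Cap)]"
    using deforms_context[OF cross_cancel[of False True "Suc ?i"], of "over (Suc a) n @ over a n" "[(?i, Cap)]"] by simp
  also note Suc
  finally show ?case by simp
qed simp

lemma double_sweep_cross:
  "over (Suc a) n @ over a n @ [(a + n, Cross u)] \<leadsto> (a, Cross u) # over (Suc a) n @ over a n"
proof (induction n)
  case (Suc n)
  let ?i = "a + n"
  have "over (Suc a) (Suc n) @ over a (Suc n) @ [(Suc ?i, Cross u)] \<leadsto>
      over (Suc a) n @ over a n @ [(Suc ?i, Cross True), (?i, Cross True), (Suc ?i, Cross u)]"
    using deforms_context[OF far_right_back[of a n "Suc ?i" "Cross True"], of "over (Suc a) n" "[(?i, Cross True), (Suc ?i, Cross u)]"]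
    by (simp only: over_snoc append.simps append_assoc add_Suc) simp
  also have "\<dots> \<leadsto> over (Suc a) n @ over a n @ [(?i, Cross u), (Suc ?i, Cross True), (?i, Cross True)]"
    using deforms_prefix[OF braid_back[of u True True ?i], of "over (Suc a) n @ over a n"] by simp
  also have "\<dots> \<leadsto> (a, Cross u) # over (Suc a) n @ over a n @ [(Suc ?i, Cross True), (?i, Cross True)]"
    using deforms_suffix[OF Suc, of "[(Suc ?i, Cross True), (?i, Cross True)]"] by simp
  also have "\<dots> \<leadsto> (a, Cross u) # over (Suc a) (Suc n) @ over a (Suc n)"
    using deforms_context[OF far_right[of a n "Suc ?i" "Cross True"], of "(a, Cross u) # over (Suc a) n" "[(?i, Cross True)]"]
    by (simp only: over_snoc append.simps append_assoc add_Suc) simp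
  finally show ?case by simp
qed simp

text \<open>\<open>shuffle S r\<close> starts from the strands with colours in \<open>S\<close>, followed on the right by the
  others; it moves the former over the latter, so that the row \<open>r\<close> results.\<close>

primrec shuffle_rev :: "'k set \<Rightarrow> 'k row \<Rightarrow> diagram" where
  "shuffle_rev S [] = []"
| "shuffle_rev S (p # r) =
    (if fst p \<in> S then over (length (keep S r)) (length (keep (- S) r)) else []) @ shuffle_rev S r"

definition shuffle :: "'k set \<Rightarrow> 'k row \<Rightarrow> diagram" where
  "shuffle S r = shuffle_rev S (rev r)"

lemma length_keep_rev: "length (keep S (rev r)) = length (keep S r)"
  by (simp add: keep_def rev_filter[symmetric])

lemma length_keep_Compl: "length (keep S r) + length (keep (- S) r) = length r"
  by (induction r) auto

lemma shuffle_simps [simp]: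
  "shuffle S [] = []"
  "fst p \<notin> S \<Longrightarrow> shuffle S (r @ [p]) = shuffle S r"
  "fst p \<in> S \<Longrightarrow> shuffle S (r @ [p]) = over (length (keep S r)) (length (keep (- S) r)) @ shuffle S r"
  by (simp_all add: shuffle_def length_keep_rev)

lemma shuffle_right: "length r \<le> i \<Longrightarrow> shuffle S r @ [(i, e)] \<leadsto> (i, e) # shuffle S r"
proof (induction r rule: rev_induct)
  case (snoc p r)
  show ?case
  proof (cases "fst p \<in> S")
    case True
    let ?o = "over (length (keep S r)) (length (keep (- S) r))"
    have "?o @ shuffle S r @ [(i, e)] \<leadsto> ?o @ [(i, e)] @ shuffle S r"
      using deforms_prefix snoc by simp
    also have "\<dots> \<leadsto> ((i, e) # ?o) @ shuffle S r"
      using deforms_suffix[OF far_right[of "length (keep S r)" "length (keep (- S) r)" i e]]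
        length_keep_Compl[of S r] snoc.prems by simp
    finally show ?thesis using True by simp
  qed (use snoc in simp)
qed simp

text \<open>The event only involves strands of \<open>S\<close>, which lie above the others. It can
  be pulled back to the left group, where its position counts the strands of \<open>S\<close> on its
  left.\<close>

lemma shuffle_upper:
  assumes "clocal e y y'" "row_colors (y @ y') \<subseteq> S"
  shows "shuffle S (x @ y @ z) @ [(length x, e)] \<leadsto> (length (keep S x), e) # shuffle S (x @ y' @ z)"
proof (induction z rule: rev_induct)
  case Nil
  let ?a = "length (keep S x)" and ?n = "length (keep (- S) x)"
  have an: "length x = ?a + ?n" using length_keep_Compl[of S x] by simp
  have comm: "O1 @ shuffle S x @ [(length x, e)] \<leadsto> O1 @ [(length x, e)] @ shuffle S x" for O1
    using deforms_prefix[OF shuffle_right[of x "length x" S e]] by simp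
  have slide: "O1 @ shuffle S x @ [(length x, e)] \<leadsto> O2 @ shuffle S x"
    if "O1 @ [(?a + ?n, e)] \<leadsto> O2" for O1 O2
    using comm[of O1] deforms_suffix[OF that, of "shuffle S x"] unfolding an by (simp add: deforms_trans)
  have two: "shuffle S (x @ [p, q]) = (over (Suc ?a) ?n @ over ?a ?n) @ shuffle S x"
    if "fst p \<in> S" "fst q \<in> S" for p q
    using that shuffle_simps(3)[of q S "x @ [p]"] by simp
  show ?case
  proof (cases e)
    case (Cup b)
    then obtain k where y: "y = []" "y' = [(k, b), (k, \<not> b)]" using assms(1) by auto
    have "k \<in> S" using assms(2) y by simp
    then show ?thesis using slide[of "[]" "(?a, e) # over (Suc ?a) ?n @ over ?a ?n"] double_sweep_cup[of ?a ?n b] two[of "(k, b)" "(k, \<not> b)"] y Cup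
      by simp
  next
    case Cap
    then obtain k b where y: "y = [(k, b), (k, \<not> b)]" "y' = []" using assms(1) by auto
    have "k \<in> S" using assms(2) y by simp
    then show ?thesis using slide[of "over (Suc ?a) ?n @ over ?a ?n" "[(?a, e)]"] double_sweep_cap[of ?a ?n] two[of "(k, b)" "(k, \<not> b)"] y Cap
      by simp
  next
    case (Cross u)
    then obtain p q where y: "y = [p, q]" "y' = [q, p]" using assms(1) by auto
    have S: "fst p \<in> S" "fst q \<in> S" using assms(2) y by simp_all
    then show ?thesis using slide[of "over (Suc ?a) ?n @ over ?a ?n" "(?a, e) # over (Suc ?a) ?n @ over ?a ?n"] double_sweep_cross[of ?a ?n u] 
        two[of p q] two[of q p] y Cross
      by simp
  qed
next
  case (snoc p z)
  show ?case
  proof (cases "fst p \<in> S")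
    case True
    let ?r = "x @ y @ z" and ?r' = "x @ y' @ z"
    let ?o = "over (length (keep S ?r)) (length (keep (- S) ?r))"
    let ?o' = "over (length (keep S ?r')) (length (keep (- S) ?r'))"
    have k: "keep S y = y" "keep S y' = y'" using assms(2) clocal_kept[of y y' S] by (simp_all add: row_colors_def)
    then have k0: "length (keep (- S) y) = 0" "length (keep (- S) y') = 0"
      using length_keep_Compl[of S y] length_keep_Compl[of S y'] by simp_all
    have l: "length y = ins e" "length y' = outs e" using clocal_length[OF assms(1)] by simp_all
    have "?o @ shuffle S ?r @ [(length x, e)] \<leadsto> (?o @ [(length (keep S x), e)]) @ shuffle S ?r'"
      using deforms_prefix[OF snoc] by simp
    also have "\<dots> \<leadsto> ((length (keep S x), e) # ?o') @ shuffle S ?r'"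
    proof (rule deforms_suffix)
      have "length (keep S ?r) - ins e + outs e = length (keep S ?r')" "length (keep (- S) ?r) = length (keep (- S) ?r')"
        "length (keep S x) + ins e \<le> length (keep S ?r)"
        using k k0 l by simp_all
      then show "?o @ [(length (keep S x), e)] \<leadsto> (length (keep S x), e) # ?o'" using far_left by metis
    qed
    finally show ?thesis using True shuffle_simps(3)[of p S ?r] shuffle_simps(3)[of p S ?r'] by simp
  next
    case False
    then show ?thesis using snoc shuffle_simps(2)[of p S "x @ y @ z"] shuffle_simps(2)[of p S "x @ y' @ z"] by simp
  qed
qed

text \<open>With the strand of \<open>S\<close> on top, the crossing either prolongs the shuffle by
  the one crossing that the new row requires, or cancels the last crossing of that pair.\<close>

lemma shuffle_mixed:
  assumes "fst p \<in> S \<longleftrightarrow> u" "fst q \<in> S \<longleftrightarrow> \<not> u"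
  shows "shuffle S (x @ [p, q] @ z) @ [(length x, Cross u)] \<leadsto> shuffle S (x @ [q, p] @ z)"
proof (induction z rule: rev_induct)
  case Nil
  let ?a = "length (keep S x)" and ?n = "length (keep (- S) x)"
  have an: "length x = ?a + ?n" using length_keep_Compl[of S x] by simp
  have comm: "O1 @ shuffle S x @ [(length x, Cross u)] \<leadsto> O1 @ [(?a + ?n, Cross u)] @ shuffle S x" for O1
    using deforms_prefix[OF shuffle_right[of x "length x" S "Cross u"]] an by simp
  show ?case
  proof (cases u)
    case True
    then show ?thesis
      using assms comm[of "over ?a ?n"] shuffle_simps(2)[of q S "x @ [p]"] shuffle_simps(3)[of p S "x @ [q]"]
      by (simp add: over_snoc del: over.simps)
  next
    case False
    have "over ?a (Suc ?n) @ shuffle S x @ [(length x, Cross u)] \<leadsto> over ?a ?n @ [(?a + ?n, Cross True), (?a + ?n, Cross u)] @ shuffle S x"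
      using comm[of "over ?a (Suc ?n)"] by (simp only: over_snoc append_assoc append.simps)
    also have "\<dots> \<leadsto> over ?a ?n @ shuffle S x"
      using deforms_context[OF cross_cancel[of u True "?a + ?n"], of "over ?a ?n" "shuffle S x"] False by simp
    finally show ?thesis
      using False assms shuffle_simps(3)[of q S "x @ [p]"] shuffle_simps(2)[of p S "x @ [q]"] by simp
  qed
next
  case (snoc v z)
  have k: "length (keep T (x @ [p, q] @ z)) = length (keep T (x @ [q, p] @ z))" for T by simp
  show ?case
  proof (cases "fst v \<in> S")
    case True
    then show ?thesis using deforms_prefix[OF snoc] k[of S] k[of "- S"]
      shuffle_simps(3)[of v S "x @ [p, q] @ z"] shuffle_simps(3)[of v S "x @ [q, p] @ z"] by simp
  next
    case False
    then show ?thesis using snoc shuffle_simps(2)[of v S "x @ [p, q] @ z"] shuffle_simps(2)[of v S "x @ [q, p] @ z"] by simp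
  qed
qed

lemma sweep:
  assumes "run s (over j (i + ins e + l) @ [(j + i, e)]) = Some t" "j + i < length s"
  shows "iso s t (over j (i + ins e + l) @ [(j + i, e)]) ((Suc (j + i), e) # over j (i + outs e + l))"
proof (cases e)
  case (Cup b)
  then show ?thesis using sweep_cup[of s j i l b t] assms by simp
next
  case Cap
  then show ?thesis using deforms_iso[OF sweep_cap[of j i l]] assms(1) by simp
next
  case (Cross u)
  then show ?thesis using deforms_iso[OF sweep_cross[of i "i + 2 + l" j u]] assms(1) by simp
qed

text \<open>Before the shuffle all strands of \<open>S\<close> stand on the left, so the position
  below is the number of all strands of \<open>S\<close> outside the event plus that of the other
  strands on the left of the event. The bound on \<open>s\<close> provides the strand that
  \<open>sweep\<close> asks for.\<close>

lemma shuffle_lower: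
  assumes "clocal e y y'" "row_colors (y @ y') \<subseteq> - S" "length (x @ y @ z) \<le> length s"
    "run s (shuffle S (x @ y @ z) @ [(length x, e)]) = Some t"
  shows "iso s t (shuffle S (x @ y @ z) @ [(length x, e)])
    ((length (keep S (x @ z)) + length (keep (- S) x), e) # shuffle S (x @ y' @ z))"
  using assms(3,4)
proof (induction z arbitrary: s t rule: rev_induct)
  case Nil
  have "shuffle S (x @ v) = shuffle S x" if "row_colors v \<subseteq> - S" for v
    using that
  proof (induction v rule: rev_induct)
    case (snoc p v)
    then show ?case using shuffle_simps(2)[of p S "x @ v"] by simp
  qed simp
  then have "shuffle S (x @ y) = shuffle S x" "shuffle S (x @ y') = shuffle S x" using assms(2) by simp_all
  then show ?case using deforms_iso[OF shuffle_right[of x "length x" S e]] Nil(2) length_keep_Compl[of S x] by simp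
next
  case (snoc p z)
  let ?r = "x @ y @ z" and ?r' = "x @ y' @ z"
  let ?q = "length (keep S (x @ z)) + length (keep (- S) x)"
  show ?case
  proof (cases "fst p \<in> S")
    case True
    let ?o = "over (length (keep S ?r)) (length (keep (- S) ?r))"
    let ?o' = "over (length (keep S ?r')) (length (keep (- S) ?r'))"
    let ?i = "length (keep (- S) x)" and ?j = "length (keep S (x @ z))" and ?l = "length (keep (- S) z)"
    have sh: "shuffle S (x @ y @ z @ [p]) = ?o @ shuffle S ?r" "shuffle S (x @ y' @ z @ [p]) = ?o' @ shuffle S ?r'"
      using True shuffle_simps(3)[of p S ?r] shuffle_simps(3)[of p S ?r'] by simp_all
    have k: "keep (- S) y = y" "keep (- S) y' = y'" using assms(2) clocal_kept[of y y' "- S"] by (simp_all add: row_colors_def)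
    then have k0: "length (keep S y) = 0" "length (keep S y') = 0"
      using length_keep_Compl[of S y] length_keep_Compl[of S y'] by simp_all
    have l: "length y = ins e" "length y' = outs e" using clocal_length[OF assms(1)] by simp_all
    have o: "?o = over ?j (?i + ins e + ?l)" "?o' = over ?j (?i + outs e + ?l)" using k k0 l by (simp_all add: add.assoc)
    obtain r1 where r1: "run s ?o = Some r1" "run r1 (shuffle S ?r @ [(length x, e)]) = Some t"
      using snoc.prems(2) unfolding sh append_assoc run_append_Some[of s ?o] by blast
    have "length r1 = length s" using over_run_length[OF r1(1)] by simp
    then have IH: "iso r1 t (shuffle S ?r @ [(length x, e)]) ((?q, e) # shuffle S ?r')"
      using snoc.IH[of r1 t] snoc.prems(1) r1(2) by simp
    then have 1: "iso s t (?o @ shuffle S ?r @ [(length x, e)]) (?o @ (?q, e) # shuffle S ?r')"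
      using iso_context[OF _ r1(1), of t _ _ "[]" t] by simp
    have "run s (?o @ (?q, e) # shuffle S ?r') = Some t"
      using iso_run[OF 1]
    proof (elim disjE conjE)
      assume *: "?o @ shuffle S ?r @ [(length x, e)] = ?o @ (?q, e) # shuffle S ?r'"
      show ?thesis using r1 unfolding *[symmetric] run_append_Some[of s ?o] by blast
    qed
    then obtain r2 where r2: "run s (?o @ [(?q, e)]) = Some r2" "run r2 (shuffle S ?r') = Some t"
      using run_append_Some[of s "?o @ [(?q, e)]" "shuffle S ?r'" t] by auto
    have "?j + ?i < length s" using snoc.prems(1) length_keep_Compl[of S x] length_keep_Compl[of S z] by simp
    then have "iso s r2 (?o @ [(?q, e)]) ((Suc ?q, e) # ?o')"
      using sweep[of s ?j ?i e ?l r2] r2(1) unfolding o by simp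
    from iso_context[OF this, of s "[]" "shuffle S ?r'" t]
    have "iso s t (?o @ (?q, e) # shuffle S ?r') ((Suc ?q, e) # ?o' @ shuffle S ?r')"
      using r2(2) by simp
    with 1 have "iso s t (?o @ shuffle S ?r @ [(length x, e)]) ((Suc ?q, e) # ?o' @ shuffle S ?r')"
      by (rule iso_trans)
    then show ?thesis using True unfolding sh by simp
  next
    case False
    then show ?thesis using snoc shuffle_simps(2)[of p S "x @ y @ z"] shuffle_simps(2)[of p S "x @ y' @ z"] by simp
  qed
qed

lemma commute_right:
  assumes "run s U = Some t"
  shows "U @ [(length t + b, e)] \<leadsto> (length s + b, e) # U"
  using assms
proof (induction U arbitrary: s)
  case (Cons f U)
  obtain i g where f: "f = (i, g)" by (metis surj_pair)
  obtain s1 where s1: "step s (i, g) = Some s1" "run s1 U = Some t"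
    using Cons.prems f unfolding run_Cons_Some by blast
  have "f # U @ [(length t + b, e)] \<leadsto> [(i, g), (length s1 + b, e)] @ U"
    using deforms_Cons[OF Cons.IH[OF s1(2)]] f by simp
  also have "\<dots> \<leadsto> [(length s + b, e), (i, g)] @ U"
    using step_lengths[OF s1(1)]
    by (intro deforms_suffix nth_event_up[where k = "length s + b - i - ins g"]) auto
  finally show ?case by (simp add: f)
qed simp

lemma shuffle_run_length: "run s (shuffle S r) = Some t \<Longrightarrow> length t = length s"
proof (induction r arbitrary: s t rule: rev_induct)
  case (snoc p r)
  show ?case
  proof (cases "fst p \<in> S")
    case True
    then obtain v where "run s (over (length (keep S r)) (length (keep (- S) r))) = Some v" "run v (shuffle S r) = Some t"
      using snoc.prems unfolding shuffle_simps(3)[OF True] run_append_Some by blast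
    then show ?thesis using snoc.IH over_run_length by metis
  qed (use snoc in simp)
qed simp

section \<open>Separating two layers\<close>

fun layered :: "'k set \<Rightarrow> 'k row \<Rightarrow> 'k cdiagram \<Rightarrow> bool" where
  "layered S r [] \<longleftrightarrow> True"
| "layered S r (c # C) \<longleftrightarrow> (case fst c of (i, e) \<Rightarrow>
     \<forall>u. e = Cross u \<longrightarrow> (fst (r ! i) \<in> S) \<noteq> (fst (r ! Suc i) \<in> S) \<longrightarrow> (u \<longleftrightarrow> fst (r ! i) \<in> S)) \<and> layered S (snd c) C"

lemma layered_append: "chain r A s \<Longrightarrow> layered S r (A @ B) \<longleftrightarrow> layered S r A \<and> layered S s B"
  by (induction A arbitrary: r) auto

lemma csub_step:
  assumes "clocal e y y'"
  shows "sub S (x @ y @ z) [((length x, e), x @ y' @ z)] =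
    (if row_colors (y @ y') \<subseteq> S then [(length (keep S x), e)] else [])"
  using survives_block[OF assms, of S x z] by (simp add: row_colors_def)

lemma clocal_colors:
  assumes "clocal e y y'"
  obtains "row_colors (y @ y') \<subseteq> S" "\<not> row_colors (y @ y') \<subseteq> - S"
  | "row_colors (y @ y') \<subseteq> - S" "\<not> row_colors (y @ y') \<subseteq> S"
  | u p q where "e = Cross u" "y = [p, q]" "y' = [q, p]" "(fst p \<in> S) \<noteq> (fst q \<in> S)"
proof (cases e)
  case (Cup b)
  then obtain k where "row_colors (y @ y') = {k}" using assms by auto
  then show thesis using that(1,2) by (cases "k \<in> S") simp_all
next
  case Cap
  then obtain k where "row_colors (y @ y') = {k}" using assms by auto
  then show thesis using that(1,2) by (cases "k \<in> S") simp_all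
next
  case (Cross u)
  then obtain p q where "y = [p, q]" "y' = [q, p]" using assms by auto
  then show thesis using Cross that by (cases "fst p \<in> S"; cases "fst q \<in> S") auto
qed

text \<open>The invariant, kept while events are added at the top: the lower layer, then the upper
  layer on its left, then a shuffle producing the current row. A new event is pushed down into its
  layer, or absorbed by the shuffle if it is a mixed crossing. For a closed diagram the shuffle is
  empty and the two layers are stacked.\<close>

lemma layering:
  assumes "chain [] C r" "layered S [] C"
  shows "iso [] (map snd r) (map fst C) (sub (- S) [] C @ sub S [] C @ shuffle S r)"
  using assms
proof (induction C arbitrary: r rule: rev_induct)
  case (snoc c C)
  obtain i e t0 where c: "c = ((i, e), t0)" by (metis surj_pair)
  obtain s where s: "chain [] C s" "cstep s (i, e) r" "t0 = r"
    using snoc.prems(1) unfolding chain_append c by auto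
  have lay: "layered S [] C" "layered S s [c]" using snoc.prems(2) layered_append[OF s(1)] by blast+
  obtain x y y' z where a: "s = x @ y @ z" "r = x @ y' @ z" "length x = i" "clocal e y y'"
    using s(2) by (rule cstepE)
  have c': "c = ((length x, e), x @ y' @ z)" using c s(3) a by simp
  let ?L = "sub (- S) [] C" and ?U = "sub S [] C" and ?t = "map snd r"
  have ends: "sub T [] (C @ [c]) = sub T [] C @ (if row_colors (y @ y') \<subseteq> T then [(length (keep T x), e)] else [])" for T
    using csub_append[OF s(1), of T "[c]"] csub_step[OF a(4), of T x z] unfolding a(1) c' by simp
  have run1: "run (map snd s) [(i, e)] = Some ?t" using cstep_step[OF s(2)] by simp
  have 1: "iso [] ?t (map fst (C @ [c])) ((?L @ ?U) @ shuffle S s @ [(i, e)])"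
    using iso_context[OF snoc.IH[OF s(1) lay(1)], of "[]" "[]" "[(i, e)]" ?t] run1 c by simp
  have "run [] (map fst (C @ [c])) = Some ?t" using chain_run[OF snoc.prems(1)] by simp
  then have run2: "run [] ((?L @ ?U) @ shuffle S s @ [(i, e)]) = Some ?t" using iso_run[OF 1] by auto
  from a(4) show ?case
  proof (rule clocal_colors[of e y y' S])
    assume S: "row_colors (y @ y') \<subseteq> S" "\<not> row_colors (y @ y') \<subseteq> - S"
    have "shuffle S s @ [(i, e)] \<leadsto> (length (keep S x), e) # shuffle S r"
      unfolding a(1,2) a(3)[symmetric] by (rule shuffle_upper[OF a(4) S(1)])
    from deforms_iso[OF deforms_prefix[OF this] run2] 1
    have "iso [] ?t (map fst (C @ [c])) ((?L @ ?U) @ (length (keep S x), e) # shuffle S r)" by (rule iso_trans[rotated])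
    then show ?thesis unfolding ends if_P[OF S(1)] if_not_P[OF S(2)] by simp
  next
    assume S: "row_colors (y @ y') \<subseteq> - S" "\<not> row_colors (y @ y') \<subseteq> S"
    let ?m = "length (keep (- S) x)"
    obtain w where w: "run [] (?L @ ?U) = Some w" "run w (shuffle S s @ [(i, e)]) = Some ?t"
      using run2 unfolding run_append_Some[of "[]" "?L @ ?U"] by blast
    obtain v where v: "run w (shuffle S s) = Some v" "run v [(i, e)] = Some ?t"
      using w(2) unfolding run_append_Some by blast
    \<comment> \<open>\<open>shuffle_lower\<close> needs a lower bound on the width of the row
      \<open>w\<close>. The shuffle preserves width, and its result is known from the induction
      hypothesis.\<close>
    have "length v = length s"
    proof -
      have "run [] ((?L @ ?U) @ shuffle S s) = Some v"
        unfolding run_append_Some[of "[]" "?L @ ?U"] using w(1) v(1) by blast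
      then have "run [] (?L @ ?U @ shuffle S s) = Some v" by (simp only: append_assoc)
      moreover have "run [] (?L @ ?U @ shuffle S s) = Some (map snd s)"
        using iso_run[OF snoc.IH[OF s(1) lay(1)]] chain_run[OF s(1)] by auto
      ultimately have "map snd s = v" by simp
      then show ?thesis by auto
    qed
    then have lw: "length s \<le> length w" using shuffle_run_length[OF v(1)] by simp
    have "keep (- S) y = y" using clocal_kept[of y y' "- S"] S(1) by (simp add: row_colors_def)
    then have "length (keep S y) = 0" using length_keep_Compl[of S y] by simp
    then have ks: "length (map snd (keep S s)) = length (keep S (x @ z))" unfolding a(1) by simp
    have "iso w ?t (shuffle S s @ [(i, e)]) ((length (keep S (x @ z)) + ?m, e) # shuffle S r)"
      using shuffle_lower[OF a(4) S(1), of x z w ?t] lw w(2) unfolding a(1,2) a(3)[symmetric] by simp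
    from iso_context[OF this w(1), of "[]" ?t] 1
    have 2: "iso [] ?t (map fst (C @ [c])) (?L @ (?U @ [(length (keep S (x @ z)) + ?m, e)]) @ shuffle S r)"
      by (simp add: iso_trans[rotated])
    \<comment> \<open>The upper layer starts on no strands of its own and ends with those of
      \<open>keep S s\<close>, so an event to its right moves below it and loses that
      offset.\<close>
    have "?U @ [(length (keep S (x @ z)) + ?m, e)] \<leadsto> (?m, e) # ?U"
      using commute_right[OF sub_run[OF s(1), of S], of ?m e] ks by simp
    note d = deforms_context[OF this, of ?L "shuffle S r"]
    have "run [] (?L @ (?U @ [(length (keep S (x @ z)) + ?m, e)]) @ shuffle S r) = Some ?t"
      using iso_run[OF 2] \<open>run [] (map fst (C @ [c])) = Some ?t\<close> by auto
    from deforms_iso[OF d this] 2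
    have "iso [] ?t (map fst (C @ [c])) (?L @ ((?m, e) # ?U) @ shuffle S r)" by (rule iso_trans[rotated])
    then show ?thesis unfolding ends if_P[OF S(1)] if_not_P[OF S(2)] by simp
  next
    fix u p q assume m: "e = Cross u" "y = [p, q]" "y' = [q, p]" "(fst p \<in> S) \<noteq> (fst q \<in> S)"
    have "s ! i = p" "s ! Suc i = q" using a(1,3) m(2) by (auto simp: nth_append)
    then have "fst p \<in> S \<longleftrightarrow> u" using lay(2) c m by auto
    moreover then have "fst q \<in> S \<longleftrightarrow> \<not> u" using m(4) by blast
    ultimately have "shuffle S s @ [(i, e)] \<leadsto> shuffle S r"
      unfolding a(1,2) a(3)[symmetric] m(1-3) by (rule shuffle_mixed)
    from deforms_iso[OF deforms_prefix[OF this] run2] 1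
    have "iso [] ?t (map fst (C @ [c])) ((?L @ ?U) @ shuffle S r)" by (rule iso_trans[rotated])
    then show ?thesis unfolding ends using m by auto
  qed
qed simp

lemma keep_keep: "keep T (keep S r) = keep (S \<inter> T) r"
  by (simp add: keep_def Int_def conj_commute)

lemma csub_blocks:
  assumes "cstep r (i, e) t"
  obtains x y y' z where "r = x @ y @ z" "t = x @ y' @ z" "length x = i" "clocal e y y'"
    "\<And>S C. csub S r (((i, e), t) # C) =
       (if row_colors (y @ y') \<subseteq> S then [((length (keep S x), e), keep S t)] else []) @ csub S t C"
proof -
  obtain x y y' z where a: "r = x @ y @ z" "t = x @ y' @ z" "length x = i" "clocal e y y'"
    using assms by (rule cstepE)
  have "survives S r (i, e) t \<longleftrightarrow> row_colors (y @ y') \<subseteq> S" for S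
    using survives_block[OF a(4), of S x z] unfolding a(1,2) a(3)[symmetric] by (simp only: row_colors_def)
  moreover have "take i r = x" using a by simp
  ultimately have "csub S r (((i, e), t) # C) =
       (if row_colors (y @ y') \<subseteq> S then [((length (keep S x), e), keep S t)] else []) @ csub S t C" for S C
    by simp
  with a show thesis by (rule that)
qed

lemma kept_row: "row_colors y \<subseteq> S \<Longrightarrow> keep S y = y"
  using clocal_kept[of y "[]" S] by (simp add: row_colors_def)

lemma row_colors_keep: "row_colors (keep S r) = row_colors r \<inter> S"
  by (auto simp: row_colors_def keep_def)

lemma not_kept_row:
  assumes "clocal e y y'" "\<not> row_colors (y @ y') \<subseteq> S"
  shows "keep S y = keep S y'"
  using clocal_not_kept[OF assms(1)] assms(2) by (simp only: row_colors_def)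

lemma csub_csub: "chain r C r' \<Longrightarrow> csub T (keep S r) (csub S r C) = csub (S \<inter> T) r C"
proof (induction C arbitrary: r)
  case (Cons c C)
  obtain i e t where c: "c = ((i, e), t)" by (metis surj_pair)
  have st: "cstep r (i, e) t" and ch: "chain t C r'" using Cons.prems c by auto
  obtain x y y' z where a: "r = x @ y @ z" "t = x @ y' @ z" "length x = i" "clocal e y y'"
    and e: "\<And>S C. csub S r (((i, e), t) # C) =
       (if row_colors (y @ y') \<subseteq> S then [((length (keep S x), e), keep S t)] else []) @ csub S t C"
    using st by (rule csub_blocks) (rule that; assumption)
  show ?case
  proof (cases "row_colors (y @ y') \<subseteq> S")
    case True
    then have k: "keep S y = y" "keep S y' = y'" by (simp_all add: kept_row)
    have "keep S r = keep S x @ y @ keep S z" "keep S t = keep S x @ y' @ keep S z" by (simp_all add: a k)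
    then have "survives T (keep S r) (length (keep S x), e) (keep S t) \<longleftrightarrow> row_colors (y @ y') \<subseteq> T"
      using survives_block[OF a(4), of T "keep S x" "keep S z"] by (simp only: row_colors_def)
    moreover have "take (length (keep S x)) (keep S r) = keep S x" by (simp add: a)
    ultimately show ?thesis unfolding c e using Cons.IH[OF ch] True by (simp add: keep_keep)
  next
    case False
    then have "keep S r = keep S t" using not_kept_row[OF a(4) False] by (simp add: a)
    moreover have "\<not> row_colors (y @ y') \<subseteq> S \<inter> T" using False by blast
    then have "csub (S \<inter> T) r (c # C) = csub (S \<inter> T) t C" unfolding c e by simp
    moreover have "csub S r (c # C) = csub S t C" unfolding c e using False by simp
    ultimately show ?thesis using Cons.IH[OF ch] by simp
  qed
qed simp

lemma colors_csub: "colors (csub S r C) \<subseteq> S"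
proof (induction C arbitrary: r)
  case (Cons c C)
  obtain i e t where "c = ((i, e), t)" by (metis surj_pair)
  with Cons[of t] show ?case by (auto simp: row_colors_keep)
qed simp

lemma colors_empty:
  assumes "chain [] C []" "colors C = {}"
  shows "C = []"
proof -
  have "map fst C = sub {} [] C" using csub_all[OF assms(1), of "{}"] assms(2) by simp
  also have "\<dots> = []" using csub_none[OF assms(1), of "{}"] by simp
  finally show ?thesis by simp
qed

text \<open>Strands of larger colours belong on top.\<close>

definition wrong :: "'k :: linorder row \<Rightarrow> nat \<times> event \<Rightarrow> bool" where
  "wrong r ie \<longleftrightarrow> (\<exists>u. snd ie = Cross u \<and> fst (r ! fst ie) \<noteq> fst (r ! Suc (fst ie)) \<and>
     (u \<longleftrightarrow> fst (r ! fst ie) < fst (r ! Suc (fst ie))))"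

fun wrong_crossings :: "'k :: linorder row \<Rightarrow> 'k cdiagram \<Rightarrow> nat" where
  "wrong_crossings r [] = 0"
| "wrong_crossings r (c # C) = (if wrong r (fst c) then 1 else 0) + wrong_crossings (snd c) C"

lemma wrong_crossings_append: "chain r A s \<Longrightarrow> wrong_crossings r (A @ B) = wrong_crossings r A + wrong_crossings s B"
  by (induction A arbitrary: r) auto

lemma wrong_crossing_exists:
  assumes "chain r C r'" "wrong_crossings r C \<noteq> 0"
  shows "\<exists>A c E s. C = A @ c # E \<and> chain r A s \<and> wrong s (fst c)"
  using assms
proof (induction C arbitrary: r)
  case (Cons c C)
  show ?case
  proof (cases "wrong r (fst c)")
    case True
    then have "c # C = [] @ c # C \<and> chain r [] r \<and> wrong r (fst c)" by simp
    then show ?thesis by blast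
  next
    case False
    then have "\<exists>A d E s. C = A @ d # E \<and> chain (snd c) A s \<and> wrong s (fst d)"
      using Cons.IH[of "snd c"] Cons.prems by simp
    then obtain A d E s where "C = A @ d # E" "chain (snd c) A s" "wrong s (fst d)" by blast
    then have "c # C = (c # A) @ d # E \<and> chain r (c # A) s \<and> wrong s (fst d)" using Cons.prems(1) by simp
    then show ?thesis by blast
  qed
qed simp

lemma wrong_crossings_csub: "chain r C r' \<Longrightarrow> wrong_crossings r C = 0 \<Longrightarrow> wrong_crossings (keep S r) (csub S r C) = 0"
proof (induction C arbitrary: r)
  case (Cons c C)
  obtain i e t where c: "c = ((i, e), t)" by (metis surj_pair)
  have st: "cstep r (i, e) t" and ch: "chain t C r'" using Cons.prems c by auto
  obtain x y y' z where a: "r = x @ y @ z" "t = x @ y' @ z" "length x = i" "clocal e y y'"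
    and e: "\<And>S C. csub S r (((i, e), t) # C) =
       (if row_colors (y @ y') \<subseteq> S then [((length (keep S x), e), keep S t)] else []) @ csub S t C"
    using st by (rule csub_blocks) (rule that; assumption)
  have w: "\<not> wrong r (i, e)" and b: "wrong_crossings t C = 0" using Cons.prems(2) by (auto simp: c split: if_splits)
  have IH: "wrong_crossings (keep S t) (csub S t C) = 0" by (rule Cons.IH[OF ch b])
  show ?case
  proof (cases "row_colors (y @ y') \<subseteq> S")
    case True
    then have k: "keep S y = y" by (simp add: kept_row)
    have "\<not> wrong (keep S r) (length (keep S x), e)"
    proof (cases e)
      case (Cross u)
      then obtain p q where "y = [p, q]" using a(4) by auto
      then show ?thesis using w k Cross a(1,3) by (auto simp: wrong_def nth_append)
    qed (simp_all add: wrong_def)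
    then show ?thesis unfolding c e using IH True by simp
  next
    case False
    then have "keep S r = keep S t" using not_kept_row[OF a(4) False] by (simp add: a)
    then show ?thesis unfolding c e using IH False by simp
  qed
qed simp

lemma wrong_crossings_layered: "wrong_crossings r C = 0 \<Longrightarrow> layered {n..} r C"
proof (induction C arbitrary: r)
  case (Cons c C)
  obtain i e t where c: "c = ((i, e), t)" by (metis surj_pair)
  have "\<not> wrong r (i, e)" "wrong_crossings t C = 0" using Cons.prems by (auto simp: c split: if_splits)
  then show ?case using Cons.IH[of t] by (auto simp: c wrong_def)
qed simp

text \<open>The largest colour is split off as the upper layer. Passing to the remaining colours
  creates no wrong crossings, so the induction hypothesis applies to the restricted diagram.\<close>

lemma layers:
  fixes C :: "nat cdiagram"
  assumes "chain [] C []" "wrong_crossings [] C = 0" "colors C \<subseteq> {..<n}"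
  shows "iso [] [] (map fst C) (concat (map (\<lambda>k. sub {k} [] C) [0..<n]))"
  using assms
proof (induction n arbitrary: C)
  case 0
  then show ?case using colors_empty[of C] by simp
next
  case (Suc n)
  let ?C = "csub {..<n} [] C"
  have "iso [] [] (map fst C) (sub (- {n..}) [] C @ sub {n..} [] C)"
    using layering[OF Suc.prems(1) wrong_crossings_layered[OF Suc.prems(2), of n]] by simp
  also have "- {n..} = {..<n}" by auto
  also have "sub {n..} [] C = sub {n} [] C"
    using sub_restrict[of "{n..}" C] sub_restrict[of "{n}" C] Suc.prems(3)
    by (smt (verit) Int_def atLeast_iff Collect_cong lessThan_iff less_Suc_eq_le order_antisym order_refl singleton_iff subsetD)
  finally have 1: "iso [] [] (map fst C) (sub {..<n} [] C @ sub {n} [] C)" .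
  have "iso [] [] (map fst ?C) (concat (map (\<lambda>k. sub {k} [] ?C) [0..<n]))"
    using Suc.IH[of ?C] chain_csub[OF Suc.prems(1), of "{..<n}"] wrong_crossings_csub[OF Suc.prems(1,2), of "{..<n}"] colors_csub[of "{..<n}" "[]" C]
    by simp
  also have "map (\<lambda>k. sub {k} [] ?C) [0..<n] = map (\<lambda>k. sub {k} [] C) [0..<n]"
  proof (rule map_cong[OF refl])
    fix k assume "k \<in> set [0..<n]"
    then have "{..<n} \<inter> {k} = {k}" by auto
    then show "sub {k} [] ?C = sub {k} [] C" using csub_csub[OF Suc.prems(1), of "{k}" "{..<n}"] by simp
  qed
  finally have "iso [] [] (sub {..<n} [] C) (concat (map (\<lambda>k. sub {k} [] C) [0..<n]))" .
  from iso_context[OF this, of "[]" "[]" "sub {n} [] C" "[]"]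
  have "iso [] [] (sub {..<n} [] C @ sub {n} [] C) (concat (map (\<lambda>k. sub {k} [] C) [0..<Suc n]))"
    using sub_link[OF Suc.prems(1), of "{n}"] by (simp add: link_diagram_def)
  with 1 show ?case by (rule iso_trans)
qed

text \<open>\<open>b\<close> recolours the strands of \<open>r\<close> with colours in \<open>S\<close>, all other strands are coloured \<open>False\<close>.
  Thus colourings of a sublink extend to the whole link, and sublinks of universally coloured
  diagrams are universally coloured.\<close>

primrec paint :: "'k set \<Rightarrow> 'k row \<Rightarrow> bool row \<Rightarrow> bool row" where
  "paint S [] b = []"
| "paint S (p # r) b = (if fst p \<in> S then hd b # paint S r (tl b) else (False, snd p) # paint S r b)"

lemma paint_append: "length b = length (keep S x) \<Longrightarrow> paint S (x @ y) (b @ b') = paint S x b @ paint S y b'"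
  by (induction x arbitrary: b) (auto simp: length_Suc_conv)

lemma paint_all: "row_colors r \<subseteq> S \<Longrightarrow> length b = length r \<Longrightarrow> paint S r b = b"
  by (induction r arbitrary: b) (auto simp: length_Suc_conv)

lemma paint_recolor:
  "length b = length (keep S r) \<Longrightarrow> paint S r b = recolor_row m r \<Longrightarrow> b = recolor_row m (keep S r)"
  by (induction r arbitrary: b) (auto simp: length_Suc_conv split: if_splits)

lemma length_paint [simp]: "length (paint S r b) = length r"
  by (induction r arbitrary: b) auto

lemma clocal_paint:
  assumes "clocal e y y'" "\<not> row_colors (y @ y') \<subseteq> S" "length b = length (keep S y)"
  shows "clocal e (paint S y b) (paint S y' b)"
proof (cases e)
  case (Cross u)
  then obtain p q where "y = [p, q]" "y' = [q, p]" using assms(1) by auto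
  then show ?thesis using assms Cross by (cases "fst p \<in> S"; cases "fst q \<in> S") (auto simp: length_Suc_conv)
qed (use assms in auto)

text \<open>At a surviving event \<open>Z\<close> copies the colours of \<open>B\<close>. An erased
  event leaves \<open>b\<close> as it is: at most one strand of \<open>S\<close> takes part in it,
  and the other strands are all painted \<open>False\<close>.\<close>

lemma lift_sub:
  assumes "chain r C r'" "chain b B b'" "map fst B = sub S r C" "length b = length (keep S r)"
  shows "\<exists>Z. map fst Z = map fst C \<and> chain (paint S r b) Z (paint S r' b') \<and>
    (\<forall>m. Z = recolor m C \<longrightarrow> B = recolor m (csub S r C))"
  using assms
proof (induction C arbitrary: r b B)
  case (Cons c C)
  obtain i e t where c: "c = ((i, e), t)" by (metis surj_pair)
  have st: "cstep r (i, e) t" and ch: "chain t C r'" using Cons.prems(1) c by auto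
  obtain x y y' z where a: "r = x @ y @ z" "t = x @ y' @ z" "length x = i" "clocal e y y'"
    and ce: "\<And>S C. csub S r (((i, e), t) # C) =
       (if row_colors (y @ y') \<subseteq> S then [((length (keep S x), e), keep S t)] else []) @ csub S t C"
    using st by (rule csub_blocks) (rule that; assumption)
  obtain bx by0 bz where b: "b = bx @ by0 @ bz" "length bx = length (keep S x)" "length by0 = length (keep S y)"
    "length bz = length (keep S z)"
  proof (rule that)
    let ?n = "length (keep S x)" and ?m = "length (keep S y)"
    show "b = take ?n b @ take ?m (drop ?n b) @ drop ?m (drop ?n b)" by (simp only: append_take_drop_id)
  qed (use Cons.prems(4) a(1) in simp_all)
  have pr: "paint S r b = paint S x bx @ paint S y by0 @ paint S z bz"
    using b by (simp add: a(1) paint_append)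
  show ?case
  proof (cases "row_colors (y @ y') \<subseteq> S")
    case True
    then have k: "keep S y = y" "keep S y' = y'" by (simp_all add: kept_row)
    then have ly: "length by0 = ins e" using b(3) clocal_length[OF a(4)] by simp
    obtain d B1 where B: "B = d # B1" "fst d = (length bx, e)" "map fst B1 = sub S t C"
      using Cons.prems(3) True b(2) unfolding c ce by (cases B) auto
    have "cstep b (length bx, e) (snd d)" "chain (snd d) B1 b'" using Cons.prems(2) B by simp_all
    then obtain by1 where by1: "clocal e by0 by1" "snd d = bx @ by1 @ bz" and ch1: "chain (bx @ by1 @ bz) B1 b'"
      using cstep_block[OF ly, of bx bz "snd d"] b(1) by auto
    have ly1: "length by1 = length (keep S y')" using clocal_length[OF by1(1)] clocal_length[OF a(4)] k by simp
    have lt: "length (bx @ by1 @ bz) = length (keep S t)" using b ly1 by (simp add: a(2))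
    obtain Z where Z: "map fst Z = map fst C" "chain (paint S t (bx @ by1 @ bz)) Z (paint S r' b')"
      "\<And>m. Z = recolor m C \<Longrightarrow> B1 = recolor m (csub S t C)"
      using Cons.IH[OF ch ch1 B(3) lt] by blast
    have "paint S t (bx @ by1 @ bz) = paint S x bx @ by1 @ paint S z bz"
      using b ly1 True k by (simp add: a(2) paint_append paint_all)
    moreover have "paint S r b = paint S x bx @ by0 @ paint S z bz"
      using b(3) True k unfolding pr by (simp add: paint_all)
    ultimately have "cstep (paint S r b) (i, e) (paint S t (bx @ by1 @ bz))"
      using by1(1) a(3) unfolding cstep_def
      by (intro exI[of _ "paint S x bx"] exI[of _ by0] exI[of _ by1] exI[of _ "paint S z bz"]) simp
    moreover have "B = recolor m (csub S r (c # C))"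
      if "((i, e), paint S t (bx @ by1 @ bz)) # Z = recolor m (c # C)" for m
    proof -
      have "paint S t (bx @ by1 @ bz) = recolor_row m t" "Z = recolor m C" using that by (simp_all add: recolor_def c)
      then have "bx @ by1 @ bz = recolor_row m (keep S t)" "B1 = recolor m (csub S t C)"
        using paint_recolor[OF lt] Z(3) by simp_all
      then show ?thesis using B by1(2) True b(2) unfolding c ce by (cases d) (simp add: recolor_def)
    qed
    ultimately show ?thesis using Z by (intro exI[of _ "((i, e), paint S t (bx @ by1 @ bz)) # Z"]) (simp add: c)
  next
    case False
    have kt: "keep S y = keep S y'" using not_kept_row[OF a(4) False] .
    have lt: "length b = length (keep S t)" using Cons.prems(4) kt by (simp add: a)
    have B: "map fst B = sub S t C" using Cons.prems(3) False unfolding c ce by simp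
    obtain Z where Z: "map fst Z = map fst C" "chain (paint S t b) Z (paint S r' b')"
      "\<And>m. Z = recolor m C \<Longrightarrow> B = recolor m (csub S t C)"
      using Cons.IH[OF ch Cons.prems(2) B lt] by blast
    have "paint S t b = paint S x bx @ paint S y' by0 @ paint S z bz"
      using b kt by (simp add: a(2) paint_append)
    then have "cstep (paint S r b) (i, e) (paint S t b)"
      using clocal_paint[OF a(4) False b(3)] a(3) unfolding cstep_def pr
      by (intro exI[of _ "paint S x bx"] exI[of _ "paint S y by0"] exI[of _ "paint S y' by0"] exI[of _ "paint S z bz"]) simp
    moreover have "B = recolor m (csub S r (c # C))" if "((i, e), paint S t b) # Z = recolor m (c # C)" for m
    proof -
      have "csub S r (c # C) = csub S t C" unfolding c ce using False by simp
      then show ?thesis using that Z(3)[of m] by (simp add: recolor_def)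
    qed
    ultimately show ?thesis using Z by (intro exI[of _ "((i, e), paint S t b) # Z"]) (simp add: c)
  qed
qed simp

lemma universal_csub:
  assumes "coloring C D" "universal C"
  shows "coloring (csub S [] C) (sub S [] C)" "universal (csub S [] C)"
proof -
  have ch: "chain [] C []" using assms(1) by (simp add: coloring_def)
  then show "coloring (csub S [] C) (sub S [] C)" using chain_csub[OF ch, of S] by (simp add: coloring_def)
  show "universal (csub S [] C)"
    unfolding universal_def
  proof (intro allI impI)
    fix B :: "bool cdiagram"
    assume "coloring B (sub S [] C)"
    then obtain Z where Z: "map fst Z = map fst C" "chain [] Z []" "\<And>m. Z = recolor m C \<Longrightarrow> B = recolor m (csub S [] C)"
      using lift_sub[OF ch, of "[]" B "[]" S] by (auto simp: coloring_def)
    then obtain m where "Z = recolor m C" using assms(2) unfolding universal_def coloring_def by blast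
    with Z(3) show "\<exists>m. B = recolor m (csub S [] C)" by blast
  qed
qed

lemma knot_sub:
  assumes "coloring C D" "universal C" "k \<in> colors C"
  shows "knot_diagram (sub {k} [] C)"
proof -
  have ch: "chain [] C []" using assms(1) by (simp add: coloring_def)
  have "csub {k} [] C \<noteq> []" using sub_nonempty[OF ch, of "{k}"] assms(3) by simp
  then have "colors (csub {k} [] C) \<noteq> {}" using colors_empty chain_csub[OF ch, of "{k}"] by auto
  then have "colors (csub {k} [] C) = {k}" using colors_csub[of "{k}" "[]" C] by blast
  then show ?thesis
    using card_link_components[OF universal_csub[OF assms(1,2)] sub_link[OF ch], of "{k}"] sub_link[OF ch, of "{k}"]
    by (simp add: knot_diagram_def)
qed

lemma regular_isotopic_same_link: "regular_isotopic D D' \<Longrightarrow> same_link D D'"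
  unfolding regular_isotopic_def same_link_def
proof (induction rule: equivclp_induct)
  case (step y z)
  have "local_change link_move v w" if "local_change iso_move v w" for v w
    using that by cases (auto intro!: local_change.intros)
  with step(2) have "local_change link_move y z \<or> local_change link_move z y" by blast
  with step(3) show ?case by (rule equivclp_into_equivclp)
qed simp

lemma unlinked_layers:
  fixes C :: "nat cdiagram"
  assumes "coloring C D" "universal C" "colors C = {..<n}" "wrong_crossings [] C = 0"
  shows "unlinked_knots n D"
proof -
  let ?Ks = "map (\<lambda>k. sub {k} [] C) [0..<n]"
  have D: "map fst C = D" "chain [] C []" using assms(1) by (simp_all add: coloring_def)
  have "same_link D (concat ?Ks)"
    using layers[OF D(2) assms(4), of n] assms(3) unfolding D(1)
    by (intro regular_isotopic_same_link iso_imp_regular_isotopic) simp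
  moreover have "\<forall>K \<in> set ?Ks. knot_diagram K" using knot_sub[OF assms(1,2)] assms(3) by auto
  ultimately show ?thesis
    unfolding unlinked_knots_def using coloring_link[OF assms(1)] by (intro conjI exI[of _ ?Ks]) simp_all
qed

section \<open>Uniqueness\<close>

text \<open>The condition \<open>ins e = outs e\<close> singles out crossings: minima have 0 and 2
  ends, maxima 2 and 0.\<close>

definition crossings :: "diagram \<Rightarrow> nat" where
  "crossings D = length (filter (\<lambda>(i, e). ins e = outs e) D)"

lemma crossings_append [simp]: "crossings (A @ B) = crossings A + crossings B"
  by (simp add: crossings_def)

lemma crossings_smoothing: "crossings (smoothing s i) = 0" "crossings [(i, Cross u)] = 1"
  by (simp_all add: crossings_def smoothing_def)

lemma (in mixed_crossing) crossings_D0: "crossings D0 < crossings D"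
  unfolding crossings_append crossings_smoothing by simp

lemma (in mixed_crossing) mixed_skein_switch:
  assumes "mixed_skein I" "positive s (length x) u"
  shows "I D - I (map fst A @ [(length x, Cross (\<not> u))] @ map fst E) = var_z * I D0"
proof -
  have "run [] (map fst A) = Some s" using chain_run[OF A] by simp
  then have t: "conway_triple D (map fst A @ [(length x, Cross (\<not> u))] @ map fst E) D0
      (length (map fst A), length x) (length (map fst A), length x + 1)"
    using conway_triple.intros[of "map fst A" "length x" u "map fst E" s] coloring_link[OF coloring_D] assms(2) by blast
  have "crow C (length A) = x @ p # q # z" using crow_prefix[OF A] .
  then have "color C (length A, length x) \<noteq> color C (length A, length x + 1)"
    using pq by (simp add: color_def nth_append)
  then have "\<not> same_component D (length (map fst A), length x) (length (map fst A), length x + 1)"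
    using same_component_color[OF coloring_D] by (metis length_map)
  then show ?thesis using assms(1) t unfolding mixed_skein_def by blast
qed

lemma wrong_crossing_switch:
  fixes C :: "'k :: linorder cdiagram"
  assumes "coloring C D" "universal C" "wrong_crossings [] C \<noteq> 0"
  obtains A E x z p q u where "mixed_crossing A E x z p q u"
    "C = A @ [((length x, Cross u), x @ q # p # z)] @ E"
    "wrong_crossings [] (A @ [((length x, Cross (\<not> u)), x @ q # p # z)] @ E) < wrong_crossings [] C"
proof -
  have ch: "chain [] C []" using assms(1) by (simp add: coloring_def)
  obtain A c E s where b: "C = A @ c # E" "chain [] A s" "wrong s (fst c)"
    using wrong_crossing_exists[OF ch assms(3)] by blast
  obtain i e t where c: "c = ((i, e), t)" by (metis surj_pair)
  obtain u where u: "e = Cross u" "fst (s ! i) \<noteq> fst (s ! Suc i)" "u \<longleftrightarrow> fst (s ! i) < fst (s ! Suc i)"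
    using b(3) by (auto simp: c wrong_def)
  have st: "cstep s (i, e) t" and E: "chain t E []"
    using ch chain_end_unique[OF b(2)] unfolding b(1) chain_append c by auto
  obtain x y y' z where a: "s = x @ y @ z" "t = x @ y' @ z" "length x = i" "clocal e y y'"
    using st by (rule cstepE)
  then obtain p q where y: "y = [p, q]" "y' = [q, p]" using u(1) by auto
  have s: "s = x @ p # q # z" and t: "t = x @ q # p # z" using a y by simp_all
  have pq: "s ! i = p" "s ! Suc i = q" using a(3) by (auto simp: s nth_append)
  have C: "C = A @ [((length x, Cross u), x @ q # p # z)] @ E" using b(1) c u(1) a(3) t by simp
  show thesis
  proof (rule that[of A E x z p q u])
    show "mixed_crossing A E x z p q u"
      using b(2) E assms(2) u(2) unfolding C s t pq[unfolded s] by unfold_locales (use pq s in auto)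
    show "wrong_crossings [] (A @ [((length x, Cross (\<not> u)), x @ q # p # z)] @ E) < wrong_crossings [] C"
      using wrong_crossings_append[OF b(2)] u(2,3) pq a(3) unfolding C s by (auto simp: wrong_def)
  qed (rule C)
qed

text \<open>\<open>I\<close> is never computed; it is compared with \<open>Phi R\<close>, which
  obeys the same relations. The outer induction on the number of crossings serves the smoothed
  diagram, the inner one on the wrong crossings serves the switched diagram, and diagrams without
  wrong crossings are unlinked knots, where both values are prescribed.\<close>

lemma (in homflypt) Phi_determined:
  assumes I: "regular_isotopy_invariant I" "mixed_skein I" "unlinked_values R I"
  shows "link_diagram D \<Longrightarrow> card (link_components D) \<ge> 1 \<Longrightarrow> I D = Phi R D"
proof (induction "crossings D" arbitrary: D rule: less_induct)
  case less
  have colored: "I X = Phi R X"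
    if "coloring C X" "universal C" "colors C = {..<n}" "n \<ge> 1" "crossings X = crossings D"
    for C :: "nat cdiagram" and X n
    using that
  proof (induction "wrong_crossings [] C" arbitrary: C X rule: less_induct)
    case (less C X)
    show ?case
    proof (cases "wrong_crossings [] C = 0")
      case True
      then have "unlinked_knots n X" using unlinked_layers[OF less.prems(1-3)] by simp
      then show ?thesis using I(3) Phi_unlinked less.prems(4) unfolding unlinked_values_def by simp
    next
      case False
      obtain A E x z p q u where m: "mixed_crossing A E x z p q u"
        "C = A @ [((length x, Cross u), x @ q # p # z)] @ E"
        "wrong_crossings [] (A @ [((length x, Cross (\<not> u)), x @ q # p # z)] @ E) < wrong_crossings [] C"
        by (rule wrong_crossing_switch[OF less.prems(1,2) False])
      let ?C = "\<lambda>v. A @ [((length x, Cross v), x @ q # p # z)] @ E"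
      let ?X = "\<lambda>v. map fst A @ [(length x, Cross v)] @ map fst E"
      let ?s = "map snd (x @ p # q # z)"
      let ?L = "map fst A @ smoothing ?s (length x) @ map fst E"
      interpret m: mixed_crossing A E x z p q u by (rule m(1))
      have m': "mixed_crossing A E x z p q v" for v
        using m.A m.E m.pq switch_universal[OF m.univ] by unfold_locales
      have X: "X = ?X u" using less.prems(1) unfolding m(2) by (simp add: coloring_def)
      have "I (?X (\<not> u)) = Phi R (?X (\<not> u))"
      proof (rule less.hyps[OF m(3)])
        show "coloring (?C (\<not> u)) (?X (\<not> u))" "universal (?C (\<not> u))"
          using switch_coloring[OF m.coloring_D] switch_universal[OF m.univ] by blast+
        show "colors (?C (\<not> u)) = {..<n}" using less.prems(3) unfolding m(2) by simp
        show "crossings (?X (\<not> u)) = crossings D" using less.prems(5) unfolding X by (simp add: crossings_def)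
      qed (rule less.prems(4))
      moreover have "I ?L = Phi R ?L"
      \<comment> \<open>This is the outer induction hypothesis, cited by its statement because the
        inner induction reuses its name.\<close>
      proof (rule \<open>\<And>D'. crossings D' < crossings D \<Longrightarrow> link_diagram D' \<Longrightarrow> card (link_components D') \<ge> 1 \<Longrightarrow> I D' = Phi R D'\<close>)
        show "crossings ?L < crossings D" using m.crossings_D0 less.prems(5) unfolding X by simp
        show l: "link_diagram ?L" by (rule coloring_link[OF m.coloring_D0])
        have "fst p \<in> colors m.C0" unfolding m.colors_C0 using m.fst_in_colors m.pq by blast
        then have "card (colors m.C0) \<noteq> 0" using finite_colors[of m.C0] by auto
        then show "card (link_components ?L) \<ge> 1"
          unfolding card_link_components[OF m.coloring_D0 m.universal_C0 l] by simp
      qed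
      moreover have "J (?X v) - J (?X (\<not> v)) = var_z * J ?L" if "mixed_skein J" "positive ?s (length x) v" for J v
        using mixed_crossing.mixed_skein_switch[OF m' that] .
      \<comment> \<open>The wrong crossing may have either sign. \<open>v\<close> is the flag that
        makes it positive, and the Conway triple is read off from \<open>?X v\<close>, whether or
        not this is the diagram \<open>X\<close> itself.\<close>
      moreover obtain v where v: "positive ?s (length x) v" by (auto simp: positive_def)
      ultimately have "I (?X v) - I (?X (\<not> v)) = Phi R (?X v) - Phi R (?X (\<not> v))" "I (?X (\<not> u)) = Phi R (?X (\<not> u))"
        using I(2) Phi_mixed by simp_all
      then show ?thesis unfolding X by (cases "u = v") auto
    qed
  qed
  obtain B where B: "coloring B D" "universal B" "colors B = link_components D"
    using component_coloring[OF less.prems(1)] by metis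
  \<comment> \<open>Numbering the components in an arbitrary way provides the order that decides
    which crossings are wrong.\<close>
  obtain h where h: "bij_betw h (colors B) {0..<card (colors B)}"
    using ex_bij_betw_finite_nat[OF finite_colors] by blast
  show ?case
  proof (rule colored)
    show "coloring (recolor h B) D" by (rule coloring_recolor[OF B(1)])
    show "universal (recolor h B)" by (rule universal_recolor[OF B(2) bij_betw_imp_inj_on[OF h]])
    show "colors (recolor h B) = {..<card (colors B)}"
      using bij_betw_imp_surj_on[OF h] by (simp add: colors_recolor atLeast0LessThan)
    show "card (colors B) \<ge> 1" using less.prems(2) B(3) by simp
  qed simp
qed

theorem theorem5:
  fixes R :: "diagram \<Rightarrow> laurent"
  assumes "regular_homflypt R"
  shows "(\<forall>H. regular_isotopy_invariant H \<and> mixed_skein H \<and> unlinked_values R H \<longrightarrow>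
            (\<forall>D. link_diagram D \<and> card (link_components D) \<ge> 1 \<longrightarrow> H D = Phi R D))
       \<and> (regular_isotopy_invariant (Phi R) \<and> mixed_skein (Phi R) \<and> unlinked_values R (Phi R))"
proof -
  interpret homflypt R by unfold_locales (rule assms)
  show ?thesis using Phi_determined Phi_regular_isotopy_invariant Phi_mixed Phi_unlinked by blast
qed

end
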